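(* Let $n\ge 2$. There is a homomorphism from $\mathcal{TO}_n$ to the group of units of the ring $\mathbb Z_{n-1}=\mathbb Z/(n-1)\mathbb Z$ with kernel $\mathcal{TO}_{n,1}$, and there is a homomorphism from $\mathcal O_n$ to the group of units of $\mathbb Z_{n-1}$ with kernel $\mathcal O_{n,1}$.
   Context: Notation. Maps act on the right. $X_n=\{0,\ldots,n-1\}$; $X_n^*$ (resp. $X_n^k$) is the set of finite words (words of length $k$) over $X_n$; $\epsilon$ is the empty word; for $1\le r\le n-1$, $\dot{\mathbf r}=\{\dot 0,\ldots,\dot{(r-1)}\}$ is a further ordered alphabet; $X_{n,r}^+=\{\dot a w:\dot a\in\dot{\mathbf r},\,w\in X_n^*\}$, $X_{n,r}^*=X_{n,r}^+\cup\{\epsilon\}$. $\mathfrak C_n=X_n^\omega$ and $\mathfrak C_{n,r}=\{\dot a x:\dot a\in\dot{\mathbf r},\,x\in\mathfrak C_n\}$ are Cantor spaces. For $n=2$ the ring $\mathbb Z_{1}$ is trivial and its group of units is the trivial group. The relation $\simeq$ on $\mathfrak C_{n,r}$: $x\simeq y$ iff $x=y$, or $\{x,y\}=\{w\,i\,000\ldots,\;w\,(i-1)(n-1)(n-1)\ldots\}$ with $w\in X_{n,r}^+$ and $0<i\le n-1$, or $\{x,y\}=\{\dot a\,00\ldots,\;\dot{(a-1)}(n-1)(n-1)\ldots\}$ with $0<a\le r-1$, or $\{x,y\}=\{\dot 0\,00\ldots,\;\dot{(r-1)}(n-1)(n-1)\ldots\}$. Transducers over $X_n$. A transducer $\langle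 X_n,Q,\pi,\lambda\rangle$ has transition function $\pi:X_n\times Q\to Q$ and output function $\lambda:X_n\times Q\to X_n^*$, extended to words by $\pi(wi,q)=\pi(i,\pi(w,q))$, $\lambda(wi,q)=\lambda(w,q)\lambda(i,\pi(w,q))$, such that infinite inputs give infinite outputs; $h_q:\mathfrak C_n\to\mathfrak C_n$ is the continuous map $\delta\mapsto\lambda(\delta,q)$. Fixing an initial state $q_0$ gives an initial transducer, representing $h_{q_0}$; it is minimal if all states are reachable from $q_0$, $h_q\neq h_p$ for distinct states $q,p$, and for every state $q$ and letter $i$, $\lambda(i,q)$ is the greatest common prefix of $\{(i\delta)h_q:\delta\in\mathfrak C_n\}$. A transducer is synchronizing at level $k$ if for each $\Gamma\in X_n^k$ the state $\pi(\Gamma,q)$ does not depend on $q$ (the state forced by $\Gamma$); its core is the sub-transducer on the states forced by words of $X_n^k$. Transducers over $\mathfrak C_{n,r}$. An initial transducer $A_{q_0}$ over $\mathfrak C_{n,r}$ has state set $Q=R\sqcup S$ with $R$ finite, $q_0\in R$, and functions $\pi,\lambda$ defined on $(\dot{\mathbf r}\times\{q_0\})\sqcup(X_n\times(Q\setminus\{q_0\}))$, $\pi$ with values in $Q\setminus\{q_0\}$ and $\lambda$ with values in $X_{n,r}^*\sqcup X_n^*$, such that: a transition from a state of $R$ outputs $\epsilon$ if it ends in $R$ and a word of $X_{n,r}^+$ if it ends in $S$; transitions from $S$ end in $S$ with output in $X_n^*$; infinite words read from states of $S$ give infinite output; no state of $R$ lies on a cycle. It represents the map $h_{q_0}:\mathfrak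 C_{n,r}\to\mathfrak C_{n,r}$. It is minimal if all its states are reachable from $q_0$, distinct states $q,p$ induce distinct maps $\delta\mapsto\lambda(\delta,q)$, $\delta\mapsto\lambda(\delta,p)$ on infinite words, and for every state $q$ and every letter $i$ readable from $q$, $\lambda(i,q)$ is the greatest common prefix of $\{\lambda(i\delta,q):\delta\in\mathfrak C_n\}$; every homeomorphism of $\mathfrak C_{n,r}$ is represented by a unique minimal transducer. It is synchronizing if for some $k$ the state reached by reading a word of length $k$ from any state from which it can be read depends only on the word; its core is then the transducer over $X_n$ formed by the states forced by words of $X_n^k$. Groups. $\mathcal B_{n,r}$ is the group of homeomorphisms $h$ of $\mathfrak C_{n,r}$ such that the minimal transducers of $h$ and $h^{-1}$ are finite and synchronizing; $\mathcal{TB}_{n,r}$ is the subgroup of those $h\in\mathcal B_{n,r}$ preserving $\simeq$. For $h\in\mathcal B_{n,r}$ let $\mathrm{Core}(h)$ be the core of its minimal transducer (a transducer over $X_n$, up to renaming states). $\mathcal O_{n,r}=\{\mathrm{Core}(h):h\in\mathcal B_{n,r}\}$, $\mathcal{TO}_{n,r}=\{\mathrm{Core}(h):h\in\mathcal{TB}_{n,r}\}$, $\mathcal O_n=\bigcup_{1\le r\le n-1}\mathcal O_{n,r}$ (which equals $\mathcal O_{n,n-1}$), $\mathcal{TO}_n=\mathcal{TO}_{n,n-1}$. The product of $g,h\in\mathcal O_n$ is the core of the minimal transducer representing $h_{q_1}$ followed by $h_{q_2}$, for any states $q_1$ of $g$ and $q_2$ of $h$ (independent of the choice). With this product $\mathcal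 O_n$ is a group, each $\mathcal O_{n,r}$ and $\mathcal{TO}_{n,r}$ is a subgroup, $\mathcal O_{n,r}\cong\mathrm{Out}(G_{n,r})$ and $\mathcal{TO}_{n,r}\cong\mathrm{Out}(T_{n,r})$ for the Higman–Thompson groups $G_{n,r}$ and $T_{n,r}$. *)

theory Defs
  imports "HOL-Analysis.Function_Topology" "HOL-Algebra.IntRing"
begin

section \<open>Words, infinite words and Cantor spaces\<close>

text \<open>
  All words are lists over one type of letters: \<open>Let i\<close> is the letter \<open>i\<close> of \<open>X\<^sub>n\<close>,
  and \<open>Dot a\<close> is the dotted letter \<open>a\<close>. Infinite words are functions on \<open>nat\<close>.
\<close>

datatype letter = Dot nat | Let nat

type_synonym word = "letter list"
type_synonym infword = "nat \<Rightarrow> letter"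

definition X :: "nat \<Rightarrow> letter set" where
  "X n = Let ` {..<n}"

definition dots :: "nat \<Rightarrow> letter set" where
  "dots r = Dot ` {..<r}"

definition pluswords :: "nat \<Rightarrow> nat \<Rightarrow> word set" where
  "pluswords n r = {a # w | a w. a \<in> dots r \<and> w \<in> lists (X n)}"

definition pre :: "nat \<Rightarrow> infword \<Rightarrow> word" where
  "pre k x = map x [0..<k]"

definition conc :: "word \<Rightarrow> infword \<Rightarrow> infword" where
  "conc w x = (\<lambda>i. if i < length w then w ! i else x (i - length w))"

definition cantor :: "nat \<Rightarrow> infword set" where
  "cantor n = {x. \<forall>i. x i \<in> X n}"

definition cantor_dot_top :: "nat \<Rightarrow> nat \<Rightarrow> infword topology" where
  "cantor_dot_top n r =
     product_topology (\<lambda>i. discrete_topology (if i = 0 then dots r else X n)) UNIV"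

definition cantor_dot :: "nat \<Rightarrow> nat \<Rightarrow> infword set" where
  "cantor_dot n r = {x. x 0 \<in> dots r \<and> (\<forall>i. x (Suc i) \<in> X n)}"

lemma topspace_cantor_dot_top: "topspace (cantor_dot_top n r) = cantor_dot n r"
proof -
  have "x \<in> cantor_dot n r \<longleftrightarrow> (\<forall>i. x i \<in> (if i = 0 then dots r else X n))" for x
    unfolding cantor_dot_def by (auto simp: gr0_conv_Suc)
  then show ?thesis
    by (auto simp: cantor_dot_top_def PiE_iff)
qed

definition simeq :: "nat \<Rightarrow> nat \<Rightarrow> infword \<Rightarrow> infword \<Rightarrow> bool" where
  "simeq n r x y \<longleftrightarrow>
     x = y
   \<or> (\<exists>w \<in> pluswords n r. \<exists>i. 0 < i \<and> i \<le> n - 1 \<and>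
        {x, y} = {conc (w @ [Let i]) (\<lambda>_. Let 0), conc (w @ [Let (i - 1)]) (\<lambda>_. Let (n - 1))})
   \<or> (\<exists>a. 0 < a \<and> a \<le> r - 1 \<and>
        {x, y} = {conc [Dot a] (\<lambda>_. Let 0), conc [Dot (a - 1)] (\<lambda>_. Let (n - 1))})
   \<or> {x, y} = {conc [Dot 0] (\<lambda>_. Let 0), conc [Dot (r - 1)] (\<lambda>_. Let (n - 1))}"


section \<open>Transducers\<close>

text \<open>
  One record serves for transducers over \<open>X\<^sub>n\<close> and for those over the dotted Cantor space;
  \<open>inp T q\<close> is the set of letters readable from \<open>q\<close>. The values of \<open>inp T\<close>, \<open>trans T\<close> and
  \<open>out T\<close> matter only on states and letters readable from them.
\<close>

record 's transducer =
  states :: "'s set"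
  inp :: "'s \<Rightarrow> letter set"
  trans :: "letter \<Rightarrow> 's \<Rightarrow> 's"
  out :: "letter \<Rightarrow> 's \<Rightarrow> word"

definition wtrans :: "'s transducer \<Rightarrow> word \<Rightarrow> 's \<Rightarrow> 's" where
  "wtrans T w q = fold (trans T) w q"

primrec wout :: "'s transducer \<Rightarrow> word \<Rightarrow> 's \<Rightarrow> word" where
  "wout T [] q = []"
| "wout T (i # w) q = out T i q @ wout T w (trans T i q)"

primrec can_read :: "'s transducer \<Rightarrow> word \<Rightarrow> 's \<Rightarrow> bool" where
  "can_read T [] q \<longleftrightarrow> True"
| "can_read T (i # w) q \<longleftrightarrow> i \<in> inp T q \<and> can_read T w (trans T i q)"

lemma wtrans_snoc: "wtrans T (w @ [i]) q = trans T i (wtrans T w q)"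
  by (simp add: wtrans_def)

lemma wout_snoc: "wout T (w @ [i]) q = wout T w q @ out T i (wtrans T w q)"
  by (induction w arbitrary: q) (simp_all add: wtrans_def)

definition runs :: "'s transducer \<Rightarrow> 's \<Rightarrow> infword set" where
  "runs T q = {x. \<forall>k. can_read T (pre k x) q}"

definition inf_output :: "'s transducer \<Rightarrow> 's \<Rightarrow> infword \<Rightarrow> bool" where
  "inf_output T q x \<longleftrightarrow> (\<forall>m. \<exists>k. m \<le> length (wout T (pre k x) q))"

text \<open>
  The output on an infinite word is the limit of the outputs on its finite prefixes; it is
  meaningful only when \<open>inf_output T q x\<close> holds. On words over \<open>X\<^sub>n\<close>, \<open>iout T q\<close> is the map \<open>h\<^sub>q\<close>.
\<close>

definition iout :: "'s transducer \<Rightarrow> 's \<Rightarrow> infword \<Rightarrow> infword" where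
  "iout T q x = (\<lambda>i. wout T (pre (LEAST k. i < length (wout T (pre k x) q)) x) q ! i)"

definition transducer :: "nat \<Rightarrow> 's transducer \<Rightarrow> bool" where
  "transducer n T \<longleftrightarrow>
     (\<forall>q \<in> states T. inp T q = X n)
   \<and> (\<forall>q \<in> states T. \<forall>i \<in> X n. trans T i q \<in> states T \<and> out T i q \<in> lists (X n))
   \<and> (\<forall>q \<in> states T. \<forall>x \<in> cantor n. inf_output T q x)"

definition dot_transducer :: "nat \<Rightarrow> nat \<Rightarrow> 's transducer \<Rightarrow> 's \<Rightarrow> 's set \<Rightarrow> 's set \<Rightarrow> bool" where
  "dot_transducer n r A q0 R S \<longleftrightarrow>
     states A = R \<union> S \<and> R \<inter> S = {} \<and> finite R \<and> q0 \<in> R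
   \<and> (\<forall>q \<in> states A. inp A q = (if q = q0 then dots r else X n))
   \<and> (\<forall>q \<in> states A. \<forall>i \<in> inp A q. trans A i q \<in> states A - {q0})
   \<and> (\<forall>q \<in> R. \<forall>i \<in> inp A q.
        (trans A i q \<in> R \<longrightarrow> out A i q = []) \<and>
        (trans A i q \<in> S \<longrightarrow> out A i q \<in> pluswords n r))
   \<and> (\<forall>q \<in> S. \<forall>i \<in> inp A q. trans A i q \<in> S \<and> out A i q \<in> lists (X n))
   \<and> (\<forall>q \<in> S. \<forall>x \<in> cantor n. inf_output A q x)
   \<and> (\<forall>q \<in> R. \<forall>w. w \<noteq> [] \<and> can_read A w q \<longrightarrow> wtrans A w q \<noteq> q)"

definition greatest_common_prefix :: "word \<Rightarrow> infword set \<Rightarrow> bool" where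
  "greatest_common_prefix w Y \<longleftrightarrow>
     (\<forall>x \<in> Y. pre (length w) x = w)
   \<and> (\<forall>v. (\<forall>x \<in> Y. pre (length v) x = v) \<longrightarrow> length v \<le> length w)"

text \<open>
  In the second clause \<open>runs T p\<close> and \<open>runs T q\<close> are the domains of the two induced maps.
\<close>

definition minimal :: "'s transducer \<Rightarrow> 's \<Rightarrow> bool" where
  "minimal T q0 \<longleftrightarrow>
     (\<forall>q \<in> states T. \<exists>w. can_read T w q0 \<and> wtrans T w q0 = q)
   \<and> (\<forall>p \<in> states T. \<forall>q \<in> states T. p \<noteq> q \<longrightarrow>
        \<not> (runs T p = runs T q \<and> (\<forall>x \<in> runs T p. iout T p x = iout T q x)))
   \<and> (\<forall>q \<in> states T. \<forall>i \<in> inp T q.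
        greatest_common_prefix (out T i q) (iout T q ` {x \<in> runs T q. x 0 = i}))"

definition sync_level :: "'s transducer \<Rightarrow> nat \<Rightarrow> bool" where
  "sync_level T k \<longleftrightarrow>
     (\<forall>w. length w = k \<longrightarrow>
        (\<forall>p \<in> states T. \<forall>q \<in> states T.
           can_read T w p \<and> can_read T w q \<longrightarrow> wtrans T w p = wtrans T w q))"

definition synchronizing :: "'s transducer \<Rightarrow> bool" where
  "synchronizing T \<longleftrightarrow> (\<exists>k. sync_level T k)"

text \<open>
  The states forced by words of length \<open>k\<close> are the same for every synchronizing level \<open>k\<close>, so
  the choice of the least one is immaterial.
\<close>

definition core :: "nat \<Rightarrow> 's transducer \<Rightarrow> 's transducer" where
  "core n T = T\<lparr>states := {wtrans T w q | w q. w \<in> lists (X n) \<and>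
     length w = (LEAST k. sync_level T k) \<and> q \<in> states T \<and> can_read T w q}\<rparr>"

definition transducer_iso :: "'s transducer \<Rightarrow> 't transducer \<Rightarrow> bool" where
  "transducer_iso T U \<longleftrightarrow> (\<exists>f. bij_betw f (states T) (states U) \<and>
     (\<forall>q \<in> states T. inp U (f q) = inp T q \<and>
        (\<forall>i \<in> inp T q. trans U i (f q) = f (trans T i q) \<and> out U i (f q) = out T i q)))"

text \<open>
  A transducer up to renaming its states is represented by the set of all its isomorphic copies
  with natural numbers as states. Since initial transducers that satisfy the reachability
  condition of minimality are countable, nothing is lost by taking states in \<open>nat\<close>.
\<close>

type_synonym transducer_class = "nat transducer set"

definition iso_class :: "'s transducer \<Rightarrow> transducer_class" where
  "iso_class T = {U. transducer_iso T U}"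


section \<open>The groups\<close>

definition min_dot_rep :: "nat \<Rightarrow> nat \<Rightarrow> (infword \<Rightarrow> infword) \<Rightarrow> 's transducer \<Rightarrow> bool" where
  "min_dot_rep n r h A \<longleftrightarrow> (\<exists>q0 R S. dot_transducer n r A q0 R S \<and> minimal A q0 \<and>
     (\<forall>x \<in> cantor_dot n r. iout A q0 x = h x))"

definition fin_sync_min :: "nat \<Rightarrow> nat \<Rightarrow> (infword \<Rightarrow> infword) \<Rightarrow> bool" where
  "fin_sync_min n r h \<longleftrightarrow>
     (\<exists>A :: nat transducer. min_dot_rep n r h A \<and> finite (states A) \<and> synchronizing A)"

definition B :: "nat \<Rightarrow> nat \<Rightarrow> (infword \<Rightarrow> infword) set" where
  "B n r = {h \<in> extensional (cantor_dot n r).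
     homeomorphic_map (cantor_dot_top n r) (cantor_dot_top n r) h \<and>
     fin_sync_min n r h \<and> fin_sync_min n r (inv_into (cantor_dot n r) h)}"

definition TB :: "nat \<Rightarrow> nat \<Rightarrow> (infword \<Rightarrow> infword) set" where
  "TB n r = {h \<in> B n r. \<forall>x \<in> cantor_dot n r. \<forall>y \<in> cantor_dot n r.
     simeq n r (h x) (h y) \<longleftrightarrow> simeq n r x y}"

definition Core :: "nat \<Rightarrow> nat \<Rightarrow> (infword \<Rightarrow> infword) \<Rightarrow> transducer_class" where
  "Core n r h = iso_class (core n (SOME A :: nat transducer. min_dot_rep n r h A))"

definition O_set :: "nat \<Rightarrow> nat \<Rightarrow> transducer_class set" where
  "O_set n r = Core n r ` B n r"

definition TO_set :: "nat \<Rightarrow> nat \<Rightarrow> transducer_class set" where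
  "TO_set n r = Core n r ` TB n r"

definition min_rep :: "nat \<Rightarrow> (infword \<Rightarrow> infword) \<Rightarrow> 's transducer \<Rightarrow> bool" where
  "min_rep n f M \<longleftrightarrow> (\<exists>q0 \<in> states M. transducer n M \<and> minimal M q0 \<and>
     (\<forall>x \<in> cantor n. iout M q0 x = f x))"

definition Core_map :: "nat \<Rightarrow> (infword \<Rightarrow> infword) \<Rightarrow> transducer_class" where
  "Core_map n f = iso_class (core n (SOME M :: nat transducer. min_rep n f M))"

text \<open>
  Maps act on the right, so in the product of \<open>g\<close> and \<open>h\<close> the map of \<open>g\<close> is applied first. The
  result does not depend on the representatives and states chosen.
\<close>

definition core_mult :: "nat \<Rightarrow> transducer_class \<Rightarrow> transducer_class \<Rightarrow> transducer_class" where
  "core_mult n g h = (SOME E. \<exists>T \<in> g. \<exists>U \<in> h. \<exists>q1 \<in> states T. \<exists>q2 \<in> states U.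
     E = Core_map n (iout U q2 \<circ> iout T q1))"

definition id_transducer :: "nat \<Rightarrow> nat transducer" where
  "id_transducer n = \<lparr>states = {0}, inp = (\<lambda>_. X n), trans = (\<lambda>_ _. 0), out = (\<lambda>i _. [i])\<rparr>"

definition O_group :: "nat \<Rightarrow> transducer_class monoid" where
  "O_group n = \<lparr>carrier = (\<Union>r \<in> {1..n - 1}. O_set n r), mult = core_mult n,
     one = iso_class (id_transducer n)\<rparr>"

definition TO_group :: "nat \<Rightarrow> transducer_class monoid" where
  "TO_group n = (O_group n)\<lparr>carrier := TO_set n (n - 1)\<rparr>"

end

theory Submission
  imports Defs "HOL-Number_Theory.Cong"
begin

text \<open>
  A clopen set is a finite disjoint union of cones, and the number of cones is determined modulo
  \<open>n - 1\<close>. For \<open>h \<in> B n r\<close> synchronization implies that the images of all cones under \<open>h\<close> have the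
  same number \<open>a\<close> of cones modulo \<open>n - 1\<close>; it is also the number of cones in the image of each state of
  the core. Since a cone of the image is the image of a cone under the next map, this number is
  multiplicative, and comparing \<open>h\<close> with its inverse shows that it is a unit. This is the homomorphism.
  Counting the cones of the whole space gives \<open>r * a = r\<close>, hence \<open>a = 1\<close> if \<open>r = 1\<close>. Conversely, if
  \<open>a = 1\<close>, then the image of a cone under \<open>h\<close> can be mapped onto the space with one dotted letter by a
  prefix replacement; this yields an element of \<open>B n 1\<close> with the same core. If \<open>h\<close> preserves
  \<open>\<simeq>\<close>, then the image has exactly two boundary points, so it is an arc of the circle, and the
  replacement can be chosen to preserve the order.

  Transducers are handled through the local maps of \<open>h\<close>, obtained by cancelling the greatest common prefix
  of the images of a cone: they are the maps induced by the states of the minimal transducer.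
\<close>

section \<open>Infinite words\<close>

text \<open>An element of the groups is a class of transducers that forgets the map
  \<open>h\<close>, so the value of the homomorphism has to be read off the states alone. This works
  because the output written before a state is reached merely puts a fixed word in front of an
  image, which does not change the number of its cones. Two maps, possibly on spaces with different
  numbers of dotted letters, have the same core once the sets of their local maps at long words
  agree; so no transducer is ever modified, and the prefix replacements only have to preserve that
  set. One reduction serves three inclusions. With one dotted letter as target it yields both
  kernels; with \<open>n - 1\<close> dotted letters its congruence holds for every signature, which
  places \<open>TO_set n 1\<close> inside \<open>TO_set n (n - 1)\<close>. Only part of the space
  serves as source, for two reasons: a proper arc has two ends that its image inherits, while the
  full circle has none; and a copy of the space with any number of dotted letters up to
  \<open>n - 1\<close> fits below a single dotted letter.\<close>

definition sdrop :: "nat \<Rightarrow> infword \<Rightarrow> infword" where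
  "sdrop k x = (\<lambda>i. x (i + k))"

lemma length_pre [simp]: "length (pre k x) = k"
  by (simp add: pre_def)

lemma nth_pre [simp]: "i < k \<Longrightarrow> pre k x ! i = x i"
  by (simp add: pre_def)

lemma pre_0 [simp]: "pre 0 x = []"
  by (simp add: pre_def)

lemma pre_eq_iff: "pre k x = pre k y \<longleftrightarrow> (\<forall>i<k. x i = y i)"
  by (simp add: list_eq_iff_nth_eq)

lemma pre_Suc: "pre (Suc k) x = pre k x @ [x k]"
  by (simp add: pre_def)

lemma pre_mono: "pre k x = pre k y \<Longrightarrow> m \<le> k \<Longrightarrow> pre m x = pre m y"
  by (auto simp: pre_eq_iff)

lemma conc_Nil [simp]: "conc [] x = x"
  by (simp add: conc_def)

lemma conc_append [simp]: "conc (u @ v) x = conc u (conc v x)"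
  by (auto simp: conc_def fun_eq_iff nth_append)

lemma conc_nth: "i < length u \<Longrightarrow> conc u x i = u ! i"
  by (simp add: conc_def)

lemma conc_nth_plus [simp]: "conc u x (i + length u) = x i" "conc u x (length u + i) = x i"
  by (simp_all add: conc_def)

lemma pre_conc: "m \<le> length u \<Longrightarrow> pre m (conc u x) = take m u"
  by (rule nth_equalityI) (auto simp: conc_nth)

lemma pre_length_conc [simp]: "pre (length u) (conc u x) = u"
  by (simp add: pre_conc)

lemma pre_plus_conc: "pre (length u + m) (conc u x) = u @ pre m x"
  by (rule nth_equalityI) (auto simp: conc_def nth_append)

lemma sdrop_conc [simp]: "sdrop (length u) (conc u x) = x"
  by (simp add: sdrop_def)

lemma conc_pre_sdrop [simp]: "conc (pre k x) (sdrop k x) = x"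
  by (auto simp: conc_def sdrop_def fun_eq_iff)

lemma conc_inject [simp]: "conc u x = conc u y \<longleftrightarrow> x = y"
  by (metis sdrop_conc)

lemma inj_conc: "inj_on (conc u) A"
  by (simp add: inj_on_def)

lemma conc_eq_conc_same_length:
  "length u = length v \<Longrightarrow> conc u x = conc v y \<longleftrightarrow> u = v \<and> x = y"
  by (metis conc_inject pre_length_conc)

lemma sdrop_sdrop: "sdrop k (sdrop m x) = sdrop (m + k) x"
  by (simp add: sdrop_def fun_eq_iff add_ac)

lemma sdrop_plus_conc: "sdrop (length u + m) (conc u x) = sdrop m x"
  by (metis sdrop_conc sdrop_sdrop)

lemma pre_eq_append_conc: "pre (length u) x = u \<Longrightarrow> x = conc u (sdrop (length u) x)"
  by (metis conc_pre_sdrop)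

lemma conc_single_0 [simp]: "conc [i] x 0 = i" "conc (i # w) x 0 = i"
  by (simp_all add: conc_def)

lemma conc_eq_conc_le:
  assumes "conc u x = conc v y" "length u \<le> length v"
  obtains t where "v = u @ t" "x = conc t y"
proof -
  have "take (length u) v = u"
    using assms by (metis pre_conc pre_length_conc)
  then have v: "v = u @ drop (length u) v"
    by (metis append_take_drop_id)
  then have "conc u x = conc u (conc (drop (length u) v) y)"
    using assms by (metis conc_append)
  with v that show thesis by simp
qed

lemma cantor_conc_iff: "conc w x \<in> cantor n \<longleftrightarrow> w \<in> lists (X n) \<and> x \<in> cantor n"
proof -
  have "conc w x \<in> cantor n \<longleftrightarrow> (\<forall>i<length w. w ! i \<in> X n) \<and> x \<in> cantor n"
    unfolding cantor_def
  proof (simp, intro iffI conjI allI impI)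
    fix i assume a: "\<forall>i. conc w x i \<in> X n"
    show "x i \<in> X n" using a[rule_format, of "length w + i"] by simp
    show "w ! i \<in> X n" if "i < length w" using a[rule_format, of i] that by (simp add: conc_def)
  next
    fix i assume "(\<forall>i<length w. w ! i \<in> X n) \<and> (\<forall>i. x i \<in> X n)"
    then show "conc w x i \<in> X n" by (simp add: conc_def)
  qed
  then show ?thesis unfolding in_lists_conv_set by (metis in_set_conv_nth)
qed

lemma dots_X_disjoint: "a \<in> dots r \<Longrightarrow> a \<notin> X n"
  by (auto simp: dots_def X_def)

lemma cantor_dot_cantor_disjoint: "x \<in> cantor_dot n r \<Longrightarrow> x \<notin> cantor n"
  by (auto simp: cantor_dot_def cantor_def dest: dots_X_disjoint)

lemma cantor_dot_Cons_iff: "conc (a # w) x \<in> cantor_dot n r \<longleftrightarrow> a \<in> dots r \<and> conc w x \<in> cantor n"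
  by (auto simp: cantor_dot_def cantor_def conc_def nth_Cons split: nat.splits)

lemma pluswords_Cons [simp]: "a # w \<in> pluswords n r \<longleftrightarrow> a \<in> dots r \<and> w \<in> lists (X n)"
  by (auto simp: pluswords_def)

lemma Nil_pluswords [simp]: "[] \<notin> pluswords n r"
  by (simp add: pluswords_def)

lemma cantor_dot_conc_iff:
  "w \<noteq> [] \<Longrightarrow> conc w x \<in> cantor_dot n r \<longleftrightarrow> w \<in> pluswords n r \<and> x \<in> cantor n"
  by (cases w) (auto simp: cantor_dot_Cons_iff cantor_conc_iff)

lemma pluswords_append_iff:
  "u \<noteq> [] \<Longrightarrow> u @ v \<in> pluswords n r \<longleftrightarrow> u \<in> pluswords n r \<and> v \<in> lists (X n)"
  by (cases u) auto

lemma pluswords_appendI: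
  "u \<in> pluswords n r \<Longrightarrow> v \<in> lists (X n) \<Longrightarrow> u @ v \<in> pluswords n r"
  by (cases u) auto

lemma pluswords_conc: "w \<in> pluswords n r \<Longrightarrow> x \<in> cantor n \<Longrightarrow> conc w x \<in> cantor_dot n r"
  by (cases w) (auto simp: cantor_dot_Cons_iff cantor_conc_iff)

lemma cantor_dot_pre: "x \<in> cantor_dot n r \<Longrightarrow> 0 < k \<Longrightarrow> pre k x \<in> pluswords n r \<and> sdrop k x \<in> cantor n"
  by (metis cantor_dot_conc_iff conc_pre_sdrop length_pre list.size(3) less_irrefl)

lemma cantor_pre: "x \<in> cantor n \<Longrightarrow> pre k x \<in> lists (X n) \<and> sdrop k x \<in> cantor n"
  by (metis cantor_conc_iff conc_pre_sdrop)

lemma Let_in_X [simp]: "Let i \<in> X n \<longleftrightarrow> i < n" "Dot i \<notin> X n"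
  by (auto simp: X_def)

lemma Dot_in_dots [simp]: "Dot a \<in> dots r \<longleftrightarrow> a < r" "Let a \<notin> dots r"
  by (auto simp: dots_def)

lemma const_in_cantor [simp]: "(\<lambda>_. Let i) \<in> cantor n \<longleftrightarrow> i < n"
  by (auto simp: cantor_def)

lemma finite_X [simp]: "finite (X n)" and card_X [simp]: "card (X n) = n"
  by (auto simp: X_def card_image inj_on_def)

lemma finite_dots [simp]: "finite (dots r)" and card_dots [simp]: "card (dots r) = r"
  by (auto simp: dots_def card_image inj_on_def)

lemma finite_X_words [simp]: "finite {w \<in> lists (X n). length w = k}"
  using finite_lists_length_eq[OF finite_X, of n k] by (simp add: in_lists_conv_set subset_eq)

lemma finite_X_words_le: "finite {w \<in> lists (X n). length w \<le> k}"
  using finite_lists_length_le[OF finite_X, of n k] by (simp add: in_lists_conv_set subset_eq)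

lemma finite_pluswords_le: "finite {w \<in> pluswords n r. length w \<le> k}"
proof (rule finite_subset)
  show "{w \<in> pluswords n r. length w \<le> k} \<subseteq> (\<lambda>(a, w). a # w) ` (dots r \<times> {w \<in> lists (X n). length w \<le> k})"
    by (auto simp: pluswords_def)
qed (use finite_X_words_le in simp)

lemma pluswords_split:
  assumes "w \<in> pluswords n r" "k < length w"
  obtains u v where "w = u @ v" "u \<in> pluswords n r" "v \<in> lists (X n)" "length v = k"
proof
  show "w = take (length w - k) w @ drop (length w - k) w" by simp
  have "take (length w - k) w @ drop (length w - k) w \<in> pluswords n r" "take (length w - k) w \<noteq> []"
    using assms by auto
  then show "take (length w - k) w \<in> pluswords n r" "drop (length w - k) w \<in> lists (X n)"
    using pluswords_append_iff by blast+
qed (use assms in simp)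


section \<open>Common prefixes and local maps\<close>

text \<open>For a set with fewer than two points all lengths are common, so \<open>GREATEST\<close>
  has no meaning there. The facts below therefore assume two distinct members, which an injective
  map on \<open>cantor n\<close> provides.\<close>

definition gcp_len :: "infword set \<Rightarrow> nat" where
  "gcp_len Y = (GREATEST m. \<forall>x\<in>Y. \<forall>y\<in>Y. pre m x = pre m y)"

lemma le_gcp_len_iff:
  assumes "a \<in> Y" "b \<in> Y" "a \<noteq> b"
  shows "m \<le> gcp_len Y \<longleftrightarrow> (\<forall>x\<in>Y. \<forall>y\<in>Y. pre m x = pre m y)"
proof -
  let ?P = "\<lambda>m. \<forall>x\<in>Y. \<forall>y\<in>Y. pre m x = pre m y"
  obtain i where "a i \<noteq> b i" using assms(3) by auto
  then have bound: "m \<le> i" if "?P m" for m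
    using that assms(1,2) unfolding pre_eq_iff by (meson not_le)
  have "?P 0" by simp
  then have "?P (gcp_len Y)"
    unfolding gcp_len_def using bound by (rule GreatestI_nat[of ?P 0 i])
  then have "?P m" if "m \<le> gcp_len Y"
    using that by (meson pre_mono)
  moreover have "m \<le> gcp_len Y" if "?P m"
    unfolding gcp_len_def using that bound by (rule Greatest_le_nat[of ?P m i])
  ultimately show ?thesis
    by (rule iffI)
qed

lemma gcp_len_conc:
  assumes "a \<in> Y" "b \<in> Y" "a \<noteq> b"
  shows "gcp_len (conc u ` Y) = length u + gcp_len Y"
proof -
  have 1: "m \<le> gcp_len (conc u ` Y) \<longleftrightarrow> (\<forall>x\<in>Y. \<forall>y\<in>Y. pre m (conc u x) = pre m (conc u y))" for m
    using le_gcp_len_iff[of "conc u a" "conc u ` Y" "conc u b" m] assms by simp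
  have "length u + m \<le> gcp_len (conc u ` Y) \<longleftrightarrow> m \<le> gcp_len Y" for m
    unfolding 1 by (simp add: pre_plus_conc le_gcp_len_iff[OF assms])
  moreover have "length u \<le> gcp_len (conc u ` Y)"
    unfolding 1 by simp
  ultimately show ?thesis
    by (metis (no_types) le_Suc_ex le_antisym nat_add_left_cancel_le order_refl)
qed

lemma greatest_common_prefix_iff:
  assumes "a \<in> Y" "b \<in> Y" "a \<noteq> b" "x \<in> Y"
  shows "greatest_common_prefix w Y \<longleftrightarrow> w = pre (gcp_len Y) x"
proof
  have P: "\<forall>x\<in>Y. \<forall>y\<in>Y. pre (gcp_len Y) x = pre (gcp_len Y) y"
    by (rule iffD1[OF le_gcp_len_iff[OF assms(1-3)] order_refl])
  show "greatest_common_prefix w Y" if w: "w = pre (gcp_len Y) x"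
    unfolding greatest_common_prefix_def
  proof (intro conjI allI impI)
    show "\<forall>x\<in>Y. pre (length w) x = w" unfolding w length_pre using P assms(4) by blast
  next
    fix v assume "\<forall>x\<in>Y. pre (length v) x = v"
    then show "length v \<le> length w" using le_gcp_len_iff[OF assms(1-3)] w by simp
  qed
  assume g: "greatest_common_prefix w Y"
  then have "length w \<le> gcp_len Y"
    unfolding greatest_common_prefix_def using le_gcp_len_iff[OF assms(1-3)] by metis
  moreover have "gcp_len Y \<le> length w"
    using g P assms(4) unfolding greatest_common_prefix_def by (metis length_pre)
  ultimately show "w = pre (gcp_len Y) x"
    using g assms(4) unfolding greatest_common_prefix_def by auto
qed

lemma cantor_two:
  assumes "2 \<le> n"
  shows "(\<lambda>_. Let 0) \<in> cantor n" "(\<lambda>_. Let 1) \<in> cantor n" "(\<lambda>_. Let 0) \<noteq> (\<lambda>_. Let 1 :: letter)"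
  using assms by (auto simp: fun_eq_iff)

lemma image_two:
  assumes "2 \<le> n" "inj_on y (cantor n)"
  obtains a b where "a \<in> y ` cantor n" "b \<in> y ` cantor n" "a \<noteq> b"
proof
  show "y (\<lambda>_. Let 0) \<in> y ` cantor n" "y (\<lambda>_. Let 1) \<in> y ` cantor n"
    using cantor_two[OF assms(1)] by auto
  show "y (\<lambda>_. Let 0) \<noteq> y (\<lambda>_. Let 1)"
    using cantor_two[OF assms(1)] inj_onD[OF assms(2)] by metis
qed

text \<open>Restricted to \<open>cantor n\<close>, hence equal as a function whenever the maps agree
  there; equality of local maps can then stand for equality of states.\<close>

definition strip :: "nat \<Rightarrow> (infword \<Rightarrow> infword) \<Rightarrow> infword \<Rightarrow> infword" where
  "strip n y = (\<lambda>x\<in>cantor n. sdrop (gcp_len (y ` cantor n)) (y x))"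

definition strip_pre :: "nat \<Rightarrow> (infword \<Rightarrow> infword) \<Rightarrow> word" where
  "strip_pre n y = pre (gcp_len (y ` cantor n)) (y (\<lambda>_. Let 0))"

text \<open>\<open>loc n f w\<close> is the local map of \<open>f\<close> at \<open>w\<close>, which determines the state reached by reading \<open>w\<close>.\<close>

definition loc :: "nat \<Rightarrow> (infword \<Rightarrow> infword) \<Rightarrow> word \<Rightarrow> infword \<Rightarrow> infword" where
  "loc n f w = strip n (\<lambda>x. f (conc w x))"

lemma strip_cong: "(\<And>x. x \<in> cantor n \<Longrightarrow> y x = z x) \<Longrightarrow> strip n y = strip n z"
  unfolding strip_def by (metis (mono_tags, lifting) image_cong restrict_ext)

lemma strip_pre_cong: "2 \<le> n \<Longrightarrow> (\<And>x. x \<in> cantor n \<Longrightarrow> y x = z x) \<Longrightarrow> strip_pre n y = strip_pre n z"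
  unfolding strip_pre_def by (metis cantor_two(1) image_cong)

text \<open>A fixed word in front moves the greatest common prefix by its length. What remains after
  stripping is unchanged, so local maps forget the output written before.\<close>

lemma strip_conc:
  assumes "2 \<le> n" "inj_on y (cantor n)"
  shows "strip n (\<lambda>x. conc u (y x)) = strip n y"
    and "strip_pre n (\<lambda>x. conc u (y x)) = u @ strip_pre n y"
proof -
  obtain a b where ab: "a \<in> y ` cantor n" "b \<in> y ` cantor n" "a \<noteq> b"
    using image_two assms by metis
  have "gcp_len ((\<lambda>x. conc u (y x)) ` cantor n) = length u + gcp_len (y ` cantor n)"
    using gcp_len_conc[OF ab] by (simp add: image_image)
  then show "strip n (\<lambda>x. conc u (y x)) = strip n y"
      "strip_pre n (\<lambda>x. conc u (y x)) = u @ strip_pre n y"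
    by (simp_all add: strip_def sdrop_plus_conc strip_pre_def pre_plus_conc)
qed

lemma conc_strip:
  assumes "2 \<le> n" "inj_on y (cantor n)" "x \<in> cantor n"
  shows "conc (strip_pre n y) (strip n y x) = y x"
proof -
  obtain a b where ab: "a \<in> y ` cantor n" "b \<in> y ` cantor n" "a \<noteq> b"
    using image_two assms by metis
  have "pre (gcp_len (y ` cantor n)) (y (\<lambda>_. Let 0)) = pre (gcp_len (y ` cantor n)) (y x)"
    using le_gcp_len_iff[OF ab, of "gcp_len (y ` cantor n)"] assms cantor_two by blast
  then show ?thesis
    using assms(3) by (simp add: strip_pre_def strip_def)
qed

lemma strip_pre_greatest:
  assumes "2 \<le> n" "inj_on y (cantor n)"
  shows "greatest_common_prefix w (y ` cantor n) \<longleftrightarrow> w = strip_pre n y"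
proof -
  obtain a b where "a \<in> y ` cantor n" "b \<in> y ` cantor n" "a \<noteq> b"
    using image_two assms by metis
  then show ?thesis
    unfolding strip_pre_def
    by (rule greatest_common_prefix_iff) (use cantor_two[OF assms(1)] in simp)
qed

lemma strip_inj:
  assumes "2 \<le> n" "inj_on y (cantor n)"
  shows "inj_on (strip n y) (cantor n)"
  using conc_strip[OF assms] assms(2) unfolding inj_on_def by metis

lemma length_strip_pre:
  assumes "2 \<le> n" "inj_on y (cantor n)"
  shows "m \<le> length (strip_pre n y) \<longleftrightarrow> (\<forall>x\<in>cantor n. \<forall>x'\<in>cantor n. pre m (y x) = pre m (y x'))"
proof -
  obtain a b where "a \<in> y ` cantor n" "b \<in> y ` cantor n" "a \<noteq> b"
    using image_two assms by metis
  from le_gcp_len_iff[OF this] show ?thesis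
    by (simp add: strip_pre_def)
qed


section \<open>Continuity in terms of prefixes\<close>

text \<open>On a compact space this is continuity. The uniform bound on the input length is what
  later makes outputs nonempty and images of cones visible at a single level.\<close>

definition ucont :: "infword set \<Rightarrow> (infword \<Rightarrow> infword) \<Rightarrow> bool" where
  "ucont A f \<longleftrightarrow> (\<forall>m. \<exists>K. \<forall>x\<in>A. \<forall>y\<in>A. pre K x = pre K y \<longrightarrow> pre m (f x) = pre m (f y))"

lemma ucontD:
  assumes "ucont A f"
  obtains K where "\<And>x y k. \<lbrakk>x \<in> A; y \<in> A; K \<le> k; pre k x = pre k y\<rbrakk> \<Longrightarrow> pre m (f x) = pre m (f y)"
  using assms unfolding ucont_def by (meson pre_mono)

lemma ucont_cong: "(\<And>x. x \<in> A \<Longrightarrow> f x = g x) \<Longrightarrow> ucont A f \<longleftrightarrow> ucont A g"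
  by (simp add: ucont_def)

lemma ucont_comp:
  assumes "ucont A f" "ucont A' g" "f ` A \<subseteq> A'"
  shows "ucont A (\<lambda>x. g (f x))"
  unfolding ucont_def
proof
  fix m
  obtain K where K: "\<And>x y k. \<lbrakk>x \<in> A'; y \<in> A'; K \<le> k; pre k x = pre k y\<rbrakk> \<Longrightarrow> pre m (g x) = pre m (g y)"
    using ucontD[OF assms(2)] by metis
  obtain L where L: "\<And>x y k. \<lbrakk>x \<in> A; y \<in> A; L \<le> k; pre k x = pre k y\<rbrakk> \<Longrightarrow> pre K (f x) = pre K (f y)"
    using ucontD[OF assms(1)] by metis
  show "\<exists>K. \<forall>x\<in>A. \<forall>y\<in>A. pre K x = pre K y \<longrightarrow> pre m (g (f x)) = pre m (g (f y))"
    using K[OF _ _ order_refl] L[OF _ _ order_refl] assms(3) by (intro exI[of _ L]) blast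
qed

lemma ucont_conc: "ucont A (conc w)"
  unfolding ucont_def by (metis append_take_drop_id length_pre pre_mono le_add2 pre_plus_conc)

lemma ucont_conc_iff: "ucont A (\<lambda>x. conc w (f x)) \<longleftrightarrow> ucont A f"
proof
  assume "ucont A f"
  then show "ucont A (\<lambda>x. conc w (f x))"
    using ucont_comp[OF _ ucont_conc[of UNIV w]] by blast
next
  assume a: "ucont A (\<lambda>x. conc w (f x))"
  show "ucont A f" unfolding ucont_def
  proof
    fix m show "\<exists>K. \<forall>x\<in>A. \<forall>y\<in>A. pre K x = pre K y \<longrightarrow> pre m (f x) = pre m (f y)"
      using a[unfolded ucont_def, rule_format, of "length w + m"] by (simp add: pre_plus_conc)
  qed
qed

lemma ucont_loc:
  assumes "2 \<le> n" "inj_on (\<lambda>x. f (conc w x)) (cantor n)" "ucont A f" "conc w ` cantor n \<subseteq> A"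
  shows "ucont (cantor n) (loc n f w)"
proof -
  have "ucont (cantor n) (\<lambda>x. f (conc w x))"
    by (rule ucont_comp[OF ucont_conc assms(3,4)])
  then have "ucont (cantor n) (\<lambda>x. conc (strip_pre n (\<lambda>x. f (conc w x))) (loc n f w x))"
    by (subst ucont_cong[OF conc_strip[OF assms(1,2), folded loc_def]]) 
  then show ?thesis by (simp add: ucont_conc_iff)
qed

lemma loc_cong: "(\<And>x. x \<in> cantor n \<Longrightarrow> f (conc w x) = g (conc w x)) \<Longrightarrow> loc n f w = loc n g w"
  unfolding loc_def by (rule strip_cong)

lemma loc_eqI:
  assumes "2 \<le> n" "inj_on y (cantor n)"
    "\<And>x. x \<in> cantor n \<Longrightarrow> f (conc w x) = conc u (y x)"
    "\<And>x. x \<in> cantor n \<Longrightarrow> g (conc w' x) = conc u' (y x)"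
  shows "loc n f w = loc n g w'"
proof -
  have "loc n f w = strip n (\<lambda>x. conc u (y x))"
    unfolding loc_def by (rule strip_cong) (rule assms(3))
  also have "\<dots> = strip n (\<lambda>x. conc u' (y x))"
    by (simp add: strip_conc[OF assms(1,2)])
  also have "\<dots> = loc n g w'"
    unfolding loc_def by (rule strip_cong) (simp add: assms(4))
  finally show ?thesis .
qed

text \<open>A basic open set of the product constrains finitely many coordinates; beyond the largest
  of them any continuation stays inside.\<close>

lemma openin_cantor_dot_top:
  "openin (cantor_dot_top n r) S \<longleftrightarrow>
     S \<subseteq> cantor_dot n r \<and> (\<forall>x\<in>S. \<exists>k. \<forall>y\<in>cantor_dot n r. pre k y = pre k x \<longrightarrow> y \<in> S)"
  (is "_ \<longleftrightarrow> ?R")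
proof
  assume o: "openin (cantor_dot_top n r) S"
  show ?R
  proof (intro conjI ballI)
    show "S \<subseteq> cantor_dot n r"
      using openin_subset[OF o] by (simp add: topspace_cantor_dot_top)
    fix x assume x: "x \<in> S"
    let ?A = "\<lambda>i. if i = 0 then dots r else X n"
    from o x obtain U where U: "finite {i. U i \<noteq> ?A i}" "x \<in> Pi\<^sub>E UNIV U" "Pi\<^sub>E UNIV U \<subseteq> S"
      unfolding cantor_dot_top_def openin_product_topology_alt by auto
    then obtain K where K: "i < K" if "U i \<noteq> ?A i" for i
      using finite_nat_set_iff_bounded by fastforce
    have "y \<in> S" if y: "y \<in> cantor_dot n r" "pre K y = pre K x" for y
    proof -
      have "y i \<in> U i" for i
      proof (cases "i < K")
        case True
        then show ?thesis using y(2) U(2) by (auto simp: pre_eq_iff PiE_iff)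
      next
        case False
        then have "U i = ?A i" using K by blast
        then show ?thesis using y(1) by (cases i) (auto simp: cantor_dot_def)
      qed
      then show ?thesis using U(3) by (auto simp: PiE_iff)
    qed
    then show "\<exists>k. \<forall>y\<in>cantor_dot n r. pre k y = pre k x \<longrightarrow> y \<in> S" by blast
  qed
next
  assume R: ?R
  show "openin (cantor_dot_top n r) S"
    unfolding cantor_dot_top_def openin_product_topology_alt
  proof
    fix x assume x: "x \<in> S"
    then obtain k where k: "\<forall>y\<in>cantor_dot n r. pre k y = pre k x \<longrightarrow> y \<in> S"
      using R by blast
    let ?A = "\<lambda>i. if i = 0 then dots r else X n"
    let ?U = "\<lambda>i. if i < k then {x i} else ?A i"
    have xc: "x i \<in> ?A i" for i
      using R x by (cases i) (auto simp: cantor_dot_def)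
    have "finite {i. ?U i \<noteq> ?A i}"
      by (rule finite_subset[of _ "{..<k}"]) auto
    moreover have "\<forall>i. openin (discrete_topology (?A i)) (?U i)"
    proof
      fix i show "openin (discrete_topology (?A i)) (?U i)"
        using xc[of i] by (cases "i = 0") auto
    qed
    moreover have "x \<in> Pi\<^sub>E UNIV ?U"
      using xc by (auto simp: PiE_iff)
    moreover have "Pi\<^sub>E UNIV ?U \<subseteq> S"
    proof
      fix y assume y: "y \<in> Pi\<^sub>E UNIV ?U"
      have "y i \<in> ?A i" for i
        using y xc[of i] by (cases "i < k") (auto simp: PiE_iff split: if_splits)
      note yA = this
      have "y 0 \<in> dots r" "y (Suc i) \<in> X n" for i
        using yA[of 0] yA[of "Suc i"] by simp_all
      then have "y \<in> cantor_dot n r"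
        unfolding cantor_dot_def by simp
      moreover have "pre k y = pre k x"
        using y by (auto simp: pre_eq_iff PiE_iff split: if_splits)
      ultimately show "y \<in> S" using k by blast
    qed
    ultimately show "\<exists>U. finite {i \<in> UNIV. U i \<noteq> topspace (discrete_topology (?A i))} \<and>
        (\<forall>i\<in>UNIV. openin (discrete_topology (?A i)) (U i)) \<and> x \<in> Pi\<^sub>E UNIV U \<and> Pi\<^sub>E UNIV U \<subseteq> S"
      by (intro exI[of _ ?U]) simp
  qed
qed

lemma compact_space_cantor_dot_top: "compact_space (cantor_dot_top n r)"
  unfolding cantor_dot_top_def
  by (subst compact_space_product_topology) (auto simp: compact_space_def compactin_discrete_topology)

text \<open>Compactness turns the prefix lengths \<open>k x\<close>, which depend on the point, into
  one: finitely many of the sets \<open>W x\<close> cover the space, and the largest of their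
  lengths works everywhere.\<close>

lemma continuous_map_cantor_dot_top_iff:
  "continuous_map (cantor_dot_top n r) (cantor_dot_top n r) f \<longleftrightarrow>
     f ` cantor_dot n r \<subseteq> cantor_dot n r \<and> ucont (cantor_dot n r) f" (is "_ \<longleftrightarrow> ?R")
proof
  let ?C = "cantor_dot n r"
  assume f: "continuous_map (cantor_dot_top n r) (cantor_dot_top n r) f"
  have fC: "f ` ?C \<subseteq> ?C"
    using continuous_map_image_subset_topspace[OF f] by (simp add: topspace_cantor_dot_top)
  moreover have "ucont ?C f"
    unfolding ucont_def
  proof
    fix m
    define V where "V x = {y \<in> ?C. pre m (f y) = pre m (f x)}" for x
    have "openin (cantor_dot_top n r) (V x)" for x
    proof -
      have o: "openin (cantor_dot_top n r) {y \<in> ?C. pre m y = pre m (f x)}"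
        unfolding openin_cantor_dot_top by (intro conjI ballI exI[of _ m]) auto
      have "V x = {y \<in> topspace (cantor_dot_top n r). f y \<in> {y \<in> ?C. pre m y = pre m (f x)}}"
        unfolding V_def topspace_cantor_dot_top using fC by blast
      then show ?thesis
        using openin_continuous_map_preimage[OF f o] by simp
    qed
    then have "\<exists>k. \<forall>y\<in>?C. pre k y = pre k x \<longrightarrow> y \<in> V x" if "x \<in> ?C" for x
      using that unfolding openin_cantor_dot_top by (auto simp: V_def)
    then obtain k where k: "\<And>x y. x \<in> ?C \<Longrightarrow> y \<in> ?C \<Longrightarrow> pre (k x) y = pre (k x) x \<Longrightarrow> y \<in> V x"
      by metis
    define W where "W x = {y \<in> ?C. pre (k x) y = pre (k x) x}" for x
    have "openin (cantor_dot_top n r) (W x)" for x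
      unfolding openin_cantor_dot_top W_def by (intro conjI ballI exI[of _ "k x"]) auto
    moreover have "?C \<subseteq> \<Union> (W ` ?C)"
      by (auto simp: W_def)
    moreover have "compactin (cantor_dot_top n r) ?C"
      using compact_space_cantor_dot_top[of n r] by (simp add: compact_space_def topspace_cantor_dot_top)
    ultimately obtain F where F: "finite F" "F \<subseteq> W ` ?C" "?C \<subseteq> \<Union> F"
      unfolding compactin_def by (metis (no_types, lifting) imageE)
    then obtain P where P: "finite P" "P \<subseteq> ?C" "F = W ` P"
      using finite_subset_image by metis
    \<comment> \<open>The space is empty for \<open>r = 0\<close>, and then so is \<open>P\<close>;
      \<open>0\<close> keeps \<open>Max\<close> defined.\<close>
    define K where "K = Max (insert 0 (k ` P))"
    have kK: "k p \<le> K" if "p \<in> P" for p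
      unfolding K_def using that P(1) by simp
    show "\<exists>K. \<forall>x\<in>?C. \<forall>y\<in>?C. pre K x = pre K y \<longrightarrow> pre m (f x) = pre m (f y)"
    proof (intro exI[of _ K] ballI impI)
      fix x y assume xy: "x \<in> ?C" "y \<in> ?C" "pre K x = pre K y"
      then obtain p where p: "p \<in> P" "x \<in> W p" using F(3) P(3) by blast
      then have "pre (k p) x = pre (k p) p" "pre (k p) y = pre (k p) p"
        using pre_mono[OF xy(3) kK[OF p(1)]] by (auto simp: W_def)
      then have "x \<in> V p" "y \<in> V p" using k p P(2) xy by blast+
      then show "pre m (f x) = pre m (f y)" by (simp add: V_def)
    qed
  qed
  ultimately show ?R by blast
next
  let ?C = "cantor_dot n r"
  assume R: ?R
  show "continuous_map (cantor_dot_top n r) (cantor_dot_top n r) f"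
    unfolding continuous_map_def topspace_cantor_dot_top
  proof (intro conjI allI impI)
    show "f \<in> ?C \<rightarrow> ?C" using R by blast
    fix U assume "openin (cantor_dot_top n r) U"
    note U = this[unfolded openin_cantor_dot_top]
    show "openin (cantor_dot_top n r) {x \<in> ?C. f x \<in> U}"
      unfolding openin_cantor_dot_top
    proof (intro conjI ballI)
      fix x assume x: "x \<in> {x \<in> ?C. f x \<in> U}"
      then obtain m where m: "\<forall>y\<in>?C. pre m y = pre m (f x) \<longrightarrow> y \<in> U" using U by blast
      from R obtain K where "\<forall>x\<in>?C. \<forall>y\<in>?C. pre K x = pre K y \<longrightarrow> pre m (f x) = pre m (f y)"
        unfolding ucont_def by blast
      then show "\<exists>k. \<forall>y\<in>?C. pre k y = pre k x \<longrightarrow> y \<in> {x \<in> ?C. f x \<in> U}"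
        using m R x by (intro exI[of _ K]) (metis (no_types, lifting) image_subset_iff mem_Collect_eq)
    qed auto
  qed
qed

lemma homeomorphic_map_cantor_dot_top_iff:
  "homeomorphic_map (cantor_dot_top n r) (cantor_dot_top n r) h \<longleftrightarrow>
     bij_betw h (cantor_dot n r) (cantor_dot n r) \<and> ucont (cantor_dot n r) h \<and>
     ucont (cantor_dot n r) (inv_into (cantor_dot n r) h)" (is "?L \<longleftrightarrow> ?R")
proof
  let ?T = "cantor_dot_top n r" and ?C = "cantor_dot n r"
  assume L: ?L
  then have bij: "bij_betw h ?C ?C"
    unfolding homeomorphic_eq_everything_map topspace_cantor_dot_top bij_betw_def by blast
  from L obtain g where g: "homeomorphic_maps ?T ?T h g"
    unfolding homeomorphic_map_maps by blast
  then have "continuous_map ?T ?T h" "continuous_map ?T ?T g"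
      and gh: "\<forall>x\<in>?C. g (h x) = x"
    unfolding homeomorphic_maps_def topspace_cantor_dot_top by blast+
  then have "ucont ?C h" "ucont ?C g"
    unfolding continuous_map_cantor_dot_top_iff by blast+
  moreover have "g y = inv_into ?C h y" if "y \<in> ?C" for y
    using that bij gh by (metis bij_betw_imp_surj_on f_inv_into_f inv_into_into)
  ultimately show ?R
    using bij ucont_cong[of ?C g "inv_into ?C h"] by blast
next
  let ?T = "cantor_dot_top n r" and ?C = "cantor_dot n r"
  assume R: ?R
  then have "continuous_map ?T ?T h" "continuous_map ?T ?T (inv_into ?C h)"
    unfolding continuous_map_cantor_dot_top_iff
    by (auto simp: bij_betw_def inv_into_into)
  then have "homeomorphic_maps ?T ?T h (inv_into ?C h)"
    unfolding homeomorphic_maps_def topspace_cantor_dot_top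
    using R by (auto simp: bij_betw_inv_into_left bij_betw_inv_into_right)
  then show ?L unfolding homeomorphic_map_maps by blast
qed


section \<open>Counting cones\<close>

definition cone :: "nat \<Rightarrow> word \<Rightarrow> infword set" where
  "cone n w = conc w ` cantor n"

definition cones :: "nat \<Rightarrow> nat \<Rightarrow> infword set \<Rightarrow> word set" where
  "cones n L U = {w. length w = L \<and> cone n w \<subseteq> U}"

definition clopen_level :: "nat \<Rightarrow> nat \<Rightarrow> infword set \<Rightarrow> bool" where
  "clopen_level n L U \<longleftrightarrow> finite (cones n L U) \<and> U = (\<Union>w\<in>cones n L U. cone n w)"

text \<open>
  A clopen set is a disjoint union of cones whose number is determined modulo \<open>n - 1\<close>, since
  splitting a cone replaces it by \<open>n\<close> cones.
\<close>

definition has_sig :: "nat \<Rightarrow> infword set \<Rightarrow> nat \<Rightarrow> bool" where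
  "has_sig n U a \<longleftrightarrow> (\<exists>L. clopen_level n L U \<and> [card (cones n L U) = a] (mod (n - 1)))"

lemma cone_ex: "2 \<le> n \<Longrightarrow> \<exists>x. x \<in> cone n w"
  using cantor_two(1) unfolding cone_def by blast

lemma cone_same_length: "x \<in> cone n u \<Longrightarrow> x \<in> cone n v \<Longrightarrow> length u = length v \<Longrightarrow> u = v"
  unfolding cone_def using conc_eq_conc_same_length by blast

lemma cone_mono: "v \<in> lists (X n) \<Longrightarrow> cone n (w @ v) \<subseteq> cone n w"
  by (auto simp: cone_def cantor_conc_iff)

lemma conc_image_cone: "conc v ` cone n w = cone n (v @ w)"
  by (auto simp: cone_def image_image)

lemma mem_cone_conc: "x \<in> cantor n \<Longrightarrow> conc w x \<in> cone n w"
  by (auto simp: cone_def)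

text \<open>Cones are nonempty, and cones of words of equal length are equal or disjoint. Hence a
  covering by cones of level \<open>L\<close> already lists all of them.\<close>

lemma clopen_levelI:
  assumes "2 \<le> n" "finite W" "\<And>w. w \<in> W \<Longrightarrow> length w = L" "U = (\<Union>w\<in>W. cone n w)"
  shows "clopen_level n L U" "cones n L U = W"
proof -
  show *: "cones n L U = W"
  proof
    show "W \<subseteq> cones n L U" using assms by (auto simp: cones_def)
    show "cones n L U \<subseteq> W"
    proof
      fix w assume w: "w \<in> cones n L U"
      obtain x where x: "x \<in> cone n w" using cone_ex[OF assms(1)] by blast
      then obtain w' where "w' \<in> W" "x \<in> cone n w'" using w assms(4) by (auto simp: cones_def)
      then show "w \<in> W" using cone_same_length[OF x, of w'] w assms(3) by (auto simp: cones_def)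
    qed
  qed
  show "clopen_level n L U" unfolding clopen_level_def * using assms by simp
qed

lemma UN_cone_letters: "(\<Union>i<n. cone n (w @ [Let i])) = cone n w"
proof
  show "(\<Union>i<n. cone n (w @ [Let i])) \<subseteq> cone n w"
    using cone_mono[of "[Let _]"] by (intro UN_least) simp
  show "cone n w \<subseteq> (\<Union>i<n. cone n (w @ [Let i]))"
  proof
    fix x assume "x \<in> cone n w"
    then obtain y where y: "y \<in> cantor n" "x = conc w y" by (auto simp: cone_def)
    then have "x = conc (w @ [y 0]) (sdrop 1 y)" "y 0 \<in> X n" "sdrop 1 y \<in> cantor n"
      using conc_pre_sdrop[of 1 y] cantor_pre[OF y(1), of 1] by (auto simp: pre_def cantor_def)
    moreover from this obtain i where "i < n" "y 0 = Let i" by (auto simp: X_def)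
    ultimately have "x \<in> cone n (w @ [Let i])" using mem_cone_conc by metis
    then show "x \<in> (\<Union>i<n. cone n (w @ [Let i]))" using \<open>i < n\<close> by blast
  qed
qed

lemma clopen_level_Suc:
  assumes "2 \<le> n" "clopen_level n L U"
  shows "clopen_level n (Suc L) U" "card (cones n (Suc L) U) = n * card (cones n L U)"
proof -
  let ?f = "\<lambda>(w, i). w @ [Let i]"
  let ?W = "?f ` (cones n L U \<times> {..<n})"
  have fin: "finite (cones n L U)"
    using assms(2) by (simp add: clopen_level_def)
  have U0: "U = (\<Union>w\<in>cones n L U. cone n w)"
    using assms(2) by (simp add: clopen_level_def)
  also have "(\<Union>w\<in>cones n L U. cone n w) = (\<Union>w\<in>cones n L U. \<Union>i<n. cone n (w @ [Let i]))"
    by (simp add: UN_cone_letters)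
  also have "\<dots> = (\<Union>w\<in>?W. cone n w)" by auto
  finally have U: "U = (\<Union>w\<in>?W. cone n w)" .
  have W: "finite ?W" "\<And>w. w \<in> ?W \<Longrightarrow> length w = Suc L"
    using fin by (auto simp: cones_def)
  have "clopen_level n (Suc L) U \<and> cones n (Suc L) U = ?W"
    by (intro conjI clopen_levelI[OF assms(1) W U])
  then show "clopen_level n (Suc L) U" "card (cones n (Suc L) U) = n * card (cones n L U)"
    by (auto simp: card_image inj_on_def card_cartesian_product)
qed

lemma clopen_level_add:
  assumes "2 \<le> n" "clopen_level n L U"
  shows "clopen_level n (L + k) U \<and> [card (cones n (L + k) U) = card (cones n L U)] (mod (n - 1))"
proof (induction k)
  case (Suc k)
  have "[n = 1] (mod (n - 1))"
    using assms(1) by (simp add: cong_altdef_nat)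
  then have "[n * card (cones n (L + k) U) = 1 * card (cones n (L + k) U)] (mod (n - 1))"
    by (rule cong_scalar_right)
  then have "[n * card (cones n (L + k) U) = card (cones n L U)] (mod (n - 1))"
    using Suc cong_trans by auto
  then show ?case
    using clopen_level_Suc[OF assms(1), of "L + k"] Suc by simp
qed (use assms in simp)

text \<open>A level can be raised freely, so any two clopen sets can be compared at a common level;
  uniqueness and additivity of the count rely on this.\<close>

lemma has_sig_level:
  assumes "2 \<le> n" "has_sig n U a"
  obtains L where "\<And>l. L \<le> l \<Longrightarrow> clopen_level n l U \<and> [card (cones n l U) = a] (mod (n - 1))"
  using assms clopen_level_add unfolding has_sig_def by (metis cong_trans le_iff_add)

lemma has_sig_unique: "2 \<le> n \<Longrightarrow> has_sig n U a \<Longrightarrow> has_sig n U b \<Longrightarrow> [a = b] (mod (n - 1))"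
  by (metis cong_sym cong_trans has_sig_level le_add1 le_add2)

lemma has_sig_cong: "[a = b] (mod (n - 1)) \<Longrightarrow> has_sig n U a \<Longrightarrow> has_sig n U b"
  unfolding has_sig_def using cong_trans by blast

lemma has_sig_cone: "2 \<le> n \<Longrightarrow> has_sig n (cone n w) 1"
  using clopen_levelI[of n "{w}" "length w" "cone n w"] unfolding has_sig_def by auto

lemma clopen_level_imp_has_sig: "clopen_level n L U \<Longrightarrow> \<exists>a. has_sig n U a"
  unfolding has_sig_def by (meson cong_refl)

lemma has_sig_conc:
  assumes "2 \<le> n"
  shows "has_sig n (conc v ` U) a \<longleftrightarrow> has_sig n U a"
proof
  assume "has_sig n U a"
  then obtain L where L: "clopen_level n L U" "[card (cones n L U) = a] (mod (n - 1))"
    unfolding has_sig_def by blast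
  have "conc v ` U = conc v ` (\<Union>w\<in>cones n L U. cone n w)"
    using L(1) by (simp add: clopen_level_def)
  also have "\<dots> = (\<Union>w\<in>(@) v ` cones n L U. cone n w)"
    by (simp add: image_UN conc_image_cone)
  finally have U: "conc v ` U = (\<Union>w\<in>(@) v ` cones n L U. cone n w)" .
  then have "clopen_level n (length v + L) (conc v ` U)" "cones n (length v + L) (conc v ` U) = (@) v ` cones n L U"
    using L(1) by (intro clopen_levelI[OF assms _ _ U]; auto simp: clopen_level_def cones_def)+
  then show "has_sig n (conc v ` U) a"
    unfolding has_sig_def using L(2) by (intro exI[of _ "length v + L"]) (simp add: card_image inj_on_def)
next
  assume "has_sig n (conc v ` U) a"
  then obtain L where "\<And>l. L \<le> l \<Longrightarrow> clopen_level n l (conc v ` U) \<and> [card (cones n l (conc v ` U)) = a] (mod (n - 1))"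
    using has_sig_level[OF assms] by blast
  then have L: "clopen_level n (length v + L) (conc v ` U)" "[card (cones n (length v + L) (conc v ` U)) = a] (mod (n - 1))"
    by auto
  \<comment> \<open>At level \<open>length v + L\<close> every word is at least as long as
    \<open>v\<close>, and a word whose cone lies in the image under \<open>conc v\<close> must then
    extend \<open>v\<close>.\<close>
  let ?W = "cones n (length v + L) (conc v ` U)"
  have v: "\<exists>u. w = v @ u" if w: "w \<in> ?W" for w
  proof -
    obtain x where "x \<in> cone n w" using cone_ex[OF assms] by blast
    then obtain y z where "conc w y = conc v z" using w by (auto simp: cones_def cone_def)
    then show ?thesis using conc_eq_conc_le[of v z w y] w by (auto simp: cones_def)
  qed
  define V where "V = (@) v -` ?W"
  have W: "?W = (@) v ` V"
    using v by (auto simp: V_def)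
  have "conc v ` U = (\<Union>w\<in>?W. cone n w)"
    using L(1) unfolding clopen_level_def by (rule conjunct2)
  also have "\<dots> = conc v ` (\<Union>u\<in>V. cone n u)"
    by (subst W) (simp add: image_UN conc_image_cone)
  finally have U: "U = (\<Union>u\<in>V. cone n u)"
    by (simp only: inj_image_eq_iff[OF inj_conc])
  have "finite ?W" using L(1) unfolding clopen_level_def by (rule conjunct1)
  then have V: "finite V"
    unfolding V_def by (rule finite_vimageI) (simp add: inj_on_def)
  have VL: "\<And>w. w \<in> V \<Longrightarrow> length w = L"
    unfolding V_def cones_def by simp
  have "clopen_level n L U" "cones n L U = V"
    using clopen_levelI[OF assms V VL U] by metis+
  moreover have "card V = card ?W"
    unfolding W by (simp add: card_image inj_on_def)
  ultimately show "has_sig n U a"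
    unfolding has_sig_def using L(2) by auto
qed

lemma has_sig_empty: "2 \<le> n \<Longrightarrow> has_sig n {} 0"
  using clopen_levelI[of n "{}" 0 "{}"] unfolding has_sig_def by auto

lemma has_sig_Un:
  assumes "2 \<le> n" "has_sig n U a" "has_sig n V b" "U \<inter> V = {}"
  shows "has_sig n (U \<union> V) (a + b)"
proof -
  obtain L where L: "clopen_level n L U" "[card (cones n L U) = a] (mod (n - 1))"
      "clopen_level n L V" "[card (cones n L V) = b] (mod (n - 1))"
    using has_sig_level[OF assms(1,2)] has_sig_level[OF assms(1,3)] by (metis le_add1 le_add2)
  have UV: "U \<union> V = (\<Union>w\<in>cones n L U \<union> cones n L V. cone n w)" "finite (cones n L U \<union> cones n L V)"
    using L(1,3) unfolding clopen_level_def by blast+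
  have "clopen_level n L (U \<union> V)" "cones n L (U \<union> V) = cones n L U \<union> cones n L V"
    by (rule clopen_levelI[OF assms(1) UV(2) _ UV(1)], force simp: cones_def)+
  moreover have "cones n L U \<inter> cones n L V = {}"
    using assms(4) cone_ex[OF assms(1)] unfolding cones_def by blast
  then have "card (cones n L U \<union> cones n L V) = card (cones n L U) + card (cones n L V)"
    using L by (intro card_Un_disjoint) (auto simp: clopen_level_def)
  ultimately show ?thesis
    unfolding has_sig_def using cong_add[OF L(2,4)] by auto
qed

lemma has_sig_UN:
  assumes "2 \<le> n" "finite I" "\<And>i. i \<in> I \<Longrightarrow> has_sig n (U i) (a i)"
    "\<And>i j. i \<in> I \<Longrightarrow> j \<in> I \<Longrightarrow> i \<noteq> j \<Longrightarrow> U i \<inter> U j = {}"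
  shows "has_sig n (\<Union>i\<in>I. U i) (\<Sum>i\<in>I. a i)"
  using assms(2-)
proof (induction I)
  case (insert i I)
  have "U i \<inter> (\<Union>j\<in>I. U j) = {}" using insert by fastforce
  then show ?case
    using insert has_sig_Un[OF assms(1), of "U i" "a i" "\<Union>j\<in>I. U j" "\<Sum>j\<in>I. a j"] by auto
qed (simp add: has_sig_empty assms(1))

lemma has_sig_UN_const:
  assumes "2 \<le> n" "finite I" "\<And>i. i \<in> I \<Longrightarrow> has_sig n (U i) a"
    "\<And>i j. i \<in> I \<Longrightarrow> j \<in> I \<Longrightarrow> i \<noteq> j \<Longrightarrow> U i \<inter> U j = {}"
  shows "has_sig n (\<Union>i\<in>I. U i) (card I * a)"
  using has_sig_UN[of n I U "\<lambda>_. a"] assms by simp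

lemma cone_split: "cone n w = (\<Union>v\<in>{v \<in> lists (X n). length v = k}. cone n (w @ v))"
proof
  show "(\<Union>v\<in>{v \<in> lists (X n). length v = k}. cone n (w @ v)) \<subseteq> cone n w"
    using cone_mono by blast
  show "cone n w \<subseteq> (\<Union>v\<in>{v \<in> lists (X n). length v = k}. cone n (w @ v))"
  proof
    fix x assume "x \<in> cone n w"
    then obtain y where y: "y \<in> cantor n" "x = conc w y" by (auto simp: cone_def)
    then have "x = conc (w @ pre k y) (sdrop k y)" by simp
    then have "x \<in> cone n (w @ pre k y)" "pre k y \<in> lists (X n)"
      using cantor_pre[OF y(1), of k] unfolding cone_def by blast+
    then show "x \<in> (\<Union>v\<in>{v \<in> lists (X n). length v = k}. cone n (w @ v))" by force
  qed
qed

section \<open>Transducers\<close>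

lemma wtrans_Nil [simp]: "wtrans T [] q = q"
  by (simp add: wtrans_def)

lemma wtrans_Cons [simp]: "wtrans T (i # w) q = wtrans T w (trans T i q)"
  by (simp add: wtrans_def)

lemma wtrans_append [simp]: "wtrans T (u @ v) q = wtrans T v (wtrans T u q)"
  by (simp add: wtrans_def)

lemma wout_append [simp]: "wout T (u @ v) q = wout T u q @ wout T v (wtrans T u q)"
  by (induction u arbitrary: q) auto

lemma can_read_append [simp]:
  "can_read T (u @ v) q \<longleftrightarrow> can_read T u q \<and> can_read T v (wtrans T u q)"
  by (induction u arbitrary: q) auto

lemma runs_conc: "conc w x \<in> runs T q \<longleftrightarrow> can_read T w q \<and> x \<in> runs T (wtrans T w q)"
proof
  assume "conc w x \<in> runs T q"
  then have a: "can_read T (pre k (conc w x)) q" for k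
    by (simp add: runs_def)
  have "can_read T w q \<and> can_read T (pre k x) (wtrans T w q)" for k
    using a[of "length w + k"] by (simp add: pre_plus_conc)
  then show "can_read T w q \<and> x \<in> runs T (wtrans T w q)"
    by (simp add: runs_def)
next
  assume a: "can_read T w q \<and> x \<in> runs T (wtrans T w q)"
  have "can_read T (pre k (conc w x)) q" for k
  proof -
    have "can_read T (pre (length w + k) (conc w x)) q"
      using a by (simp add: runs_def pre_plus_conc)
    moreover have "pre (length w + k) (conc w x) = pre k (conc w x) @ drop k (pre (length w + k) (conc w x))"
      by (metis append_take_drop_id conc_pre_sdrop le_add2 length_pre pre_conc)
    ultimately show ?thesis by (metis can_read_append)
  qed
  then show "conc w x \<in> runs T q"
    by (simp add: runs_def)
qed

lemma pre_le_append: "k \<le> l \<Longrightarrow> \<exists>v. pre l x = pre k x @ v"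
  by (metis append_take_drop_id conc_pre_sdrop length_pre pre_conc)

lemma wout_pre_nth:
  assumes "i < length (wout T (pre k x) q)" "k \<le> l"
  shows "i < length (wout T (pre l x) q)" "wout T (pre l x) q ! i = wout T (pre k x) q ! i"
  using pre_le_append[OF assms(2), of x] assms(1) by (auto simp: nth_append)

text \<open>Longer prefixes only extend the output, so any prefix whose output reaches position
  \<open>i\<close> gives the same letter as the least one used in \<open>iout\<close>.\<close>

lemma iout_nth: "i < length (wout T (pre k x) q) \<Longrightarrow> iout T q x i = wout T (pre k x) q ! i"
  unfolding iout_def
  by (metis (mono_tags, lifting) LeastI_ex Least_le wout_pre_nth(2))

lemma iout_eqI:
  assumes "inf_output T q x" "\<And>k. pre (length (wout T (pre k x) q)) y = wout T (pre k x) q"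
  shows "iout T q x = y"
proof
  fix i
  obtain k where "Suc i \<le> length (wout T (pre k x) q)"
    using assms(1) unfolding inf_output_def by blast
  then have i: "i < length (wout T (pre k x) q)" by simp
  have "y i = wout T (pre k x) q ! i"
    using i assms(2)[of k] by (metis nth_pre)
  then show "iout T q x i = y i"
    using iout_nth[OF i] by simp
qed

lemma pre_iout: "pre (length (wout T (pre k x) q)) (iout T q x) = wout T (pre k x) q"
  by (rule nth_equalityI) (auto simp: iout_nth)

lemma inf_output_conc: "inf_output T q (conc w x) \<longleftrightarrow> inf_output T (wtrans T w q) x"
proof
  assume a: "inf_output T q (conc w x)"
  show "inf_output T (wtrans T w q) x"
    unfolding inf_output_def
  proof
    fix m
    obtain k where "length (wout T w q) + m \<le> length (wout T (pre k (conc w x)) q)"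
      using a unfolding inf_output_def by blast
    moreover have "length (wout T (pre k (conc w x)) q) \<le> length (wout T (pre (length w + k) (conc w x)) q)"
      using pre_le_append[of k "length w + k" "conc w x"] by auto
    ultimately show "\<exists>k. m \<le> length (wout T (pre k x) (wtrans T w q))"
      by (intro exI[of _ k]) (simp add: pre_plus_conc)
  qed
next
  assume a: "inf_output T (wtrans T w q) x"
  show "inf_output T q (conc w x)"
    unfolding inf_output_def
  proof
    fix m
    obtain k where "m \<le> length (wout T (pre k x) (wtrans T w q))"
      using a unfolding inf_output_def by blast
    then show "\<exists>k. m \<le> length (wout T (pre k (conc w x)) q)"
      by (intro exI[of _ "length w + k"]) (simp add: pre_plus_conc)
  qed
qed

lemma pre_append_prefix: "pre (length (u @ v)) y = u @ v \<Longrightarrow> pre (length u) y = u"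
  by (metis conc_append pre_eq_append_conc pre_length_conc)

lemma iout_conc:
  assumes "inf_output T (wtrans T w q) x"
  shows "iout T q (conc w x) = conc (wout T w q) (iout T (wtrans T w q) x)"
proof (rule iout_eqI)
  show "inf_output T q (conc w x)" using assms by (simp add: inf_output_conc)
  fix k
  let ?y = "conc (wout T w q) (iout T (wtrans T w q) x)"
  have "pre (length (wout T (pre (length w + k) (conc w x)) q)) ?y = wout T (pre (length w + k) (conc w x)) q"
    by (simp add: pre_plus_conc pre_iout)
  moreover obtain v where "pre (length w + k) (conc w x) = pre k (conc w x) @ v"
    using pre_le_append[of k "length w + k" "conc w x"] by auto
  ultimately show "pre (length (wout T (pre k (conc w x)) q)) ?y = wout T (pre k (conc w x)) q"
    by (metis pre_append_prefix wout_append)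
qed


subsection \<open>The minimal transducer of a map\<close>

text \<open>
  A state of the minimal transducer of a map is identified with the domain and the map that it
  induces.
\<close>

type_synonym pmap = "infword set \<times> (infword \<Rightarrow> infword)"

text \<open>Injectivity makes greatest common prefixes exist, uniform continuity makes outputs
  infinite, and extensionality makes equality of pairs the same as equality of induced maps.\<close>

definition pmap :: "nat \<Rightarrow> nat \<Rightarrow> pmap \<Rightarrow> bool" where
  "pmap n r s \<longleftrightarrow> (fst s = cantor n \<or> fst s = cantor_dot n r) \<and> inj_on (snd s) (fst s) \<and>
     ucont (fst s) (snd s) \<and> snd s \<in> extensional (fst s)"

definition letters :: "nat \<Rightarrow> nat \<Rightarrow> infword set \<Rightarrow> letter set" where
  "letters n r A = (if A = cantor n then X n else dots r)"

definition step_state :: "nat \<Rightarrow> letter \<Rightarrow> pmap \<Rightarrow> pmap" where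
  "step_state n i s = (cantor n, loc n (snd s) [i])"

definition step_out :: "nat \<Rightarrow> letter \<Rightarrow> pmap \<Rightarrow> word" where
  "step_out n i s = strip_pre n (\<lambda>x. snd s (conc [i] x))"

lemma cantor_neq_cantor_dot: "2 \<le> n \<Longrightarrow> cantor n \<noteq> cantor_dot n r"
  using cantor_two(1) cantor_dot_cantor_disjoint by blast

lemma conc_letter_iff:
  assumes "2 \<le> n" "A = cantor n \<or> A = cantor_dot n r"
  shows "conc [i] x \<in> A \<longleftrightarrow> i \<in> letters n r A \<and> x \<in> cantor n"
  using assms(2) cantor_neq_cantor_dot[OF assms(1), of r]
  by (auto simp: letters_def cantor_conc_iff cantor_dot_Cons_iff)

lemma inj_on_conc:
  assumes "inj_on f A" "conc w ` D \<subseteq> A"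
  shows "inj_on (\<lambda>x. f (conc w x)) D"
  using comp_inj_on[OF inj_conc[of w D] inj_on_subset[OF assms]] by (simp add: comp_def)

lemma pmap_step_state:
  assumes "2 \<le> n" "pmap n r s" "i \<in> letters n r (fst s)"
  shows "pmap n r (step_state n i s)"
proof -
  have sub: "conc [i] ` cantor n \<subseteq> fst s"
    using conc_letter_iff[OF assms(1)] assms(2,3) unfolding pmap_def by blast
  then have inj: "inj_on (\<lambda>x. snd s (conc [i] x)) (cantor n)"
    using assms(2) by (intro inj_on_conc) (auto simp: pmap_def)
  then show ?thesis
    unfolding pmap_def step_state_def
    using strip_inj[OF assms(1) inj] ucont_loc[OF assms(1) inj _ sub] assms(2)
    by (auto simp: loc_def pmap_def strip_def)
qed

text \<open>States are numbers, as the classes of transducers require, and \<open>d\<close> assigns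
  to each the map that it should induce. The assumptions turn transitions into passage to a local
  map; injectivity of \<open>d\<close> keeps distinct states inequivalent.\<close>

locale canonical =
  fixes n r :: nat and T :: "nat transducer" and d :: "nat \<Rightarrow> pmap" and q0 :: nat
  assumes n: "2 \<le> n"
    and q0: "q0 \<in> states T"
    and pmap: "q \<in> states T \<Longrightarrow> pmap n r (d q)"
    and inj: "inj_on d (states T)"
    and inp: "q \<in> states T \<Longrightarrow> inp T q = letters n r (fst (d q))"
    and step: "q \<in> states T \<Longrightarrow> i \<in> inp T q \<Longrightarrow>
      trans T i q \<in> states T \<and> d (trans T i q) = step_state n i (d q) \<and> out T i q = step_out n i (d q)"
    and reach: "q \<in> states T \<Longrightarrow> \<exists>w. can_read T w q0 \<and> wtrans T w q0 = q"
begin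

lemma wtrans_states: "q \<in> states T \<Longrightarrow> can_read T w q \<Longrightarrow> wtrans T w q \<in> states T"
  by (induction w arbitrary: q) (use step in auto)

lemma runs_cantor: "q \<in> states T \<Longrightarrow> fst (d q) = cantor n \<Longrightarrow> runs T q = cantor n"
proof -
  have "can_read T w q \<longleftrightarrow> w \<in> lists (X n)" if "q \<in> states T" "fst (d q) = cantor n" for w q
    using that
  proof (induction w arbitrary: q)
    case (Cons i w)
    then show ?case using inp[of q] step[of q i] by (auto simp: letters_def step_state_def)
  qed simp
  moreover have "x \<in> cantor n \<longleftrightarrow> (\<forall>k. pre k x \<in> lists (X n))" for x
  proof
    assume "\<forall>k. pre k x \<in> lists (X n)"
    then have "pre (Suc k) x \<in> lists (X n)" for k by blast
    then have "x k \<in> X n" for k by (simp add: pre_Suc)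
    then show "x \<in> cantor n" by (simp add: cantor_def)
  qed (use cantor_pre in blast)
  ultimately show "q \<in> states T \<Longrightarrow> fst (d q) = cantor n \<Longrightarrow> runs T q = cantor n"
    by (simp add: runs_def set_eq_iff)
qed

lemma runs_eq:
  assumes "q \<in> states T"
  shows "runs T q = fst (d q)"
proof (rule Set.set_eqI)
  fix x
  have x: "x = conc [x 0] (sdrop 1 x)"
    using conc_pre_sdrop[of 1 x] by (simp add: pre_def)
  have "x \<in> runs T q \<longleftrightarrow> x 0 \<in> inp T q \<and> sdrop 1 x \<in> runs T (trans T (x 0) q)"
    by (subst x) (simp add: runs_conc)
  also have "\<dots> \<longleftrightarrow> x 0 \<in> inp T q \<and> sdrop 1 x \<in> cantor n"
    using step[OF assms, of "x 0"] runs_cantor by (auto simp: step_state_def)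
  also have "\<dots> \<longleftrightarrow> conc [x 0] (sdrop 1 x) \<in> fst (d q)"
    using conc_letter_iff[OF n, of "fst (d q)" r] pmap[OF assms] inp[OF assms] by (auto simp: pmap_def)
  finally show "x \<in> runs T q \<longleftrightarrow> x \<in> fst (d q)" using x by simp
qed

text \<open>Stripping after each letter amounts to stripping once after the whole word, because the
  prefixes removed on the way do not affect what is common later
  (\<open>strip_conc\<close>).\<close>

lemma wtrans_wout:
  assumes "q \<in> states T" "can_read T w q" "w \<noteq> []"
  shows "d (wtrans T w q) = (cantor n, loc n (snd (d q)) w)"
    and "wout T w q = strip_pre n (\<lambda>x. snd (d q) (conc w x))"
    and "inj_on (\<lambda>x. snd (d q) (conc w x)) (cantor n)"
    and "\<And>x. x \<in> cantor n \<Longrightarrow> snd (d q) (conc w x) = conc (wout T w q) (snd (d (wtrans T w q)) x)"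
proof -
  have inj': "inj_on (\<lambda>x. snd (d q) (conc w x)) (cantor n)"
    if q: "q \<in> states T" and w: "can_read T w q" "w \<noteq> []" for w q
  proof (rule inj_onI)
    have wr: "conc w x \<in> fst (d q)" if "x \<in> cantor n" for x
    proof -
      obtain v i where vi: "w = v @ [i]" using w(2) by (metis rev_exhaust)
      then have "wtrans T v q \<in> states T" "i \<in> inp T (wtrans T v q)"
        using w wtrans_states[OF q, of v] by auto
      then have "wtrans T w q \<in> states T" "fst (d (wtrans T w q)) = cantor n"
        using step vi by (auto simp: step_state_def)
      then show ?thesis
        using that runs_conc[of w x T q] runs_eq q w by auto
    qed
    fix x y assume xy: "x \<in> cantor n" "y \<in> cantor n" "snd (d q) (conc w x) = snd (d q) (conc w y)"
    then have "conc w x = conc w y"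
      using wr pmap[OF q] unfolding pmap_def by (meson inj_onD)
    then show "x = y" by simp
  qed
  then show "inj_on (\<lambda>x. snd (d q) (conc w x)) (cantor n)"
    using assms by blast
  have main: "d (wtrans T w q) = (cantor n, loc n (snd (d q)) w) \<and> wout T w q = strip_pre n (\<lambda>x. snd (d q) (conc w x))"
    using assms
  proof (induction w rule: rev_induct)
    case (snoc i w)
    show ?case
    proof (cases "w = []")
      case True
      then show ?thesis
        using step[of q i] snoc.prems by (auto simp: step_state_def step_out_def)
    next
      case False
      let ?q = "wtrans T w q"
      have IH: "d ?q = (cantor n, loc n (snd (d q)) w)" "wout T w q = strip_pre n (\<lambda>x. snd (d q) (conc w x))"
        using snoc False by auto
      have q': "?q \<in> states T" "i \<in> inp T ?q"
        using snoc.prems wtrans_states by auto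
      then have i: "i \<in> X n" using inp[of ?q] IH by (simp add: letters_def)
      let ?y = "\<lambda>x. snd (d ?q) (conc [i] x)"
      have y: "inj_on ?y (cantor n)" using inj'[of ?q "[i]"] q' by simp
      have eq: "snd (d q) (conc (w @ [i]) x) = conc (wout T w q) (?y x)" if "x \<in> cantor n" for x
        using conc_strip[OF n inj'[of q w], of "conc [i] x"] that snoc.prems False i
        by (simp add: IH loc_def cantor_conc_iff)
      have "loc n (snd (d q)) (w @ [i]) = strip n ?y"
        unfolding loc_def by (simp only: strip_cong[of n, OF eq] strip_conc(1)[OF n y])
      moreover have "strip_pre n (\<lambda>x. snd (d q) (conc (w @ [i]) x)) = wout T w q @ strip_pre n ?y"
        by (simp only: strip_pre_cong[OF n eq] strip_conc(2)[OF n y])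
      ultimately show ?thesis
        using step[OF q'] by (simp add: step_state_def step_out_def loc_def)
    qed
  qed simp
  then show "d (wtrans T w q) = (cantor n, loc n (snd (d q)) w)"
    "wout T w q = strip_pre n (\<lambda>x. snd (d q) (conc w x))" by auto
  show "snd (d q) (conc w x) = conc (wout T w q) (snd (d (wtrans T w q)) x)" if "x \<in> cantor n" for x
    using conc_strip[OF n inj'[OF assms] that] main by (simp add: loc_def)
qed

lemma iout_eq:
  assumes "q \<in> states T" "x \<in> fst (d q)"
  shows "inf_output T q x" "iout T q x = snd (d q) x"
proof -
  have rd: "can_read T (pre k x) q" "sdrop k x \<in> runs T (wtrans T (pre k x) q)" for k
    using assms runs_conc[of "pre k x" "sdrop k x" T q] runs_eq by auto
  have dr: "sdrop k x \<in> cantor n" if "0 < k" for k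
    using rd[of k] wtrans_states[OF assms(1)] runs_eq that wtrans_wout(1)[OF assms(1) rd(1)[of k]]
    by (metis fst_conv length_pre less_irrefl list.size(3))
  show inf: "inf_output T q x"
    unfolding inf_output_def
  proof
    fix m
    have "ucont (fst (d q)) (snd (d q))"
      using pmap[OF assms(1)] by (simp add: pmap_def)
    then obtain K where K: "\<And>y z k. \<lbrakk>y \<in> fst (d q); z \<in> fst (d q); K \<le> k; pre k y = pre k z\<rbrakk> \<Longrightarrow>
        pre m (snd (d q) y) = pre m (snd (d q) z)"
      by (rule ucontD[where m = m]) blast
    \<comment> \<open>One letter more than \<open>K\<close>, so that the word is nonempty as
      \<open>wtrans_wout\<close> demands.\<close>
    let ?k = "Suc K"
    let ?w = "pre ?k x"
    have w: "?w \<noteq> []" by (metis length_pre list.size(3) nat.distinct(1))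
    have inA: "conc ?w z \<in> fst (d q)" if "z \<in> cantor n" for z
      using that runs_conc[of ?w z T q] runs_eq assms(1) rd(1)
        wtrans_wout(1)[OF assms(1) rd(1) w] wtrans_states[OF assms(1) rd(1)] by auto
    have "m \<le> length (strip_pre n (\<lambda>z. snd (d q) (conc ?w z)))"
      unfolding length_strip_pre[OF n wtrans_wout(3)[OF assms(1) rd(1) w]]
    proof (intro ballI)
      fix y z assume yz: "y \<in> cantor n" "z \<in> cantor n"
      have "pre ?k (conc ?w y) = pre ?k (conc ?w z)" by (simp add: pre_conc)
      then show "pre m (snd (d q) (conc ?w y)) = pre m (snd (d q) (conc ?w z))"
        by (intro K[OF inA[OF yz(1)] inA[OF yz(2)], where k = ?k]) simp
    qed
    then show "\<exists>k. m \<le> length (wout T (pre k x) q)"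
      using wtrans_wout(2)[OF assms(1) rd(1) w] by metis
  qed
  show "iout T q x = snd (d q) x"
  proof (rule iout_eqI[OF inf])
    fix k
    show "pre (length (wout T (pre k x) q)) (snd (d q) x) = wout T (pre k x) q"
    proof (cases "k = 0")
      case False
      then have "pre k x \<noteq> []" by (metis length_pre list.size(3))
      from wtrans_wout(4)[OF assms(1) rd(1) this dr[of k]] False
      have "snd (d q) x = conc (wout T (pre k x) q) (snd (d (wtrans T (pre k x) q)) (sdrop k x))"
        by simp
      then show ?thesis by (metis pre_length_conc)
    qed simp
  qed
qed

lemma letter_runs:
  assumes "q \<in> states T" "i \<in> inp T q"
  shows "{x \<in> runs T q. x 0 = i} = conc [i] ` cantor n"
proof -
  have A: "fst (d q) = cantor n \<or> fst (d q) = cantor_dot n r"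
    using pmap[OF assms(1)] by (simp add: pmap_def)
  have x: "x = conc [x 0] (sdrop 1 x)" for x
    using conc_pre_sdrop[of 1 x] by (simp add: pre_def)
  show ?thesis
  proof (intro equalityI subsetI)
    fix x assume "x \<in> {x \<in> runs T q. x 0 = i}"
    then have "conc [x 0] (sdrop 1 x) \<in> fst (d q)" "x 0 = i" using runs_eq[OF assms(1)] x by auto
    then show "x \<in> conc [i] ` cantor n" using conc_letter_iff[OF n A] x by blast
  next
    fix x assume "x \<in> conc [i] ` cantor n"
    then show "x \<in> {x \<in> runs T q. x 0 = i}"
      using conc_letter_iff[OF n A] runs_eq[OF assms(1)] inp[OF assms(1)] assms(2) by auto
  qed
qed

lemma minimal: "minimal T q0"
  unfolding minimal_def
proof (intro conjI ballI impI)
  fix q assume "q \<in> states T"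
  then show "\<exists>w. can_read T w q0 \<and> wtrans T w q0 = q" by (rule reach)
next
  fix p q assume pq: "p \<in> states T" "q \<in> states T" "p \<noteq> q"
  show "\<not> (runs T p = runs T q \<and> (\<forall>x\<in>runs T p. iout T p x = iout T q x))"
  proof
    assume a: "runs T p = runs T q \<and> (\<forall>x\<in>runs T p. iout T p x = iout T q x)"
    then have A: "fst (d p) = fst (d q)" using runs_eq pq by metis
    moreover have "snd (d p) = snd (d q)"
    proof (rule extensionalityI)
      show "snd (d p) \<in> extensional (fst (d p))" "snd (d q) \<in> extensional (fst (d p))"
        using pmap[OF pq(1)] pmap[OF pq(2)] A by (auto simp: pmap_def)
      fix x assume "x \<in> fst (d p)"
      then show "snd (d p) x = snd (d q) x"
        using a iout_eq(2)[OF pq(1), of x] iout_eq(2)[OF pq(2), of x] runs_eq[OF pq(1)] A by auto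
    qed
    ultimately have "d p = d q" by (simp add: prod_eq_iff)
    then show False using inj pq by (meson inj_onD)
  qed
next
  fix q i assume qi: "q \<in> states T" "i \<in> inp T q"
  have "conc [i] x \<in> fst (d q)" if "x \<in> cantor n" for x
    using letter_runs[OF qi] runs_eq[OF qi(1)] that by blast
  then have "iout T q ` {x \<in> runs T q. x 0 = i} = (\<lambda>x. snd (d q) (conc [i] x)) ` cantor n"
    unfolding letter_runs[OF qi] image_image using iout_eq(2)[OF qi(1)] by (intro image_cong) auto
  moreover have "inj_on (\<lambda>x. snd (d q) (conc [i] x)) (cantor n)"
    using wtrans_wout(3)[OF qi(1), of "[i]"] qi by simp
  ultimately show "greatest_common_prefix (out T i q) (iout T q ` {x \<in> runs T q. x 0 = i})"
    using strip_pre_greatest[OF n] step[OF qi] by (simp add: step_out_def)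
qed

end

text \<open>The states are the local maps reached from \<open>s0\<close> along readable words. There
  are only countably many words, so the states can be numbered.\<close>

lemma canonical_ex:
  assumes "2 \<le> n" "pmap n r s0"
  obtains T d q0 where "canonical n r T d q0" "d q0 = s0"
proof -
  define st where "st w = fold (step_state n) w s0" for w
  define W where "W = insert [] {i # w | i w. i \<in> letters n r (fst s0) \<and> w \<in> lists (X n)}"
  define St where "St = st ` W"
  have "countable W"
  proof -
    have "countable (letters n r (fst s0) \<union> X n)"
      by (simp add: letters_def countable_finite)
    then have "countable (lists (letters n r (fst s0) \<union> X n))" by (rule countable_lists)
    moreover have "W \<subseteq> lists (letters n r (fst s0) \<union> X n)"
      unfolding W_def by (auto simp: in_lists_conv_set)
    ultimately show ?thesis by (rule countable_subset[rotated])
  qed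
  then have cSt: "countable St" by (simp add: St_def)
  define c where "c = to_nat_on St"
  define d where "d = from_nat_into St"
  define T where "T = \<lparr>states = c ` St, inp = (\<lambda>q. letters n r (fst (d q))),
    trans = (\<lambda>i q. c (step_state n i (d q))), out = (\<lambda>i q. step_out n i (d q))\<rparr>"
  have dc: "d (c s) = s" if "s \<in> St" for s
    using that cSt by (simp add: c_def d_def)
  have fst_st: "fst (st w) = cantor n" if "w \<noteq> []" for w
    using that unfolding st_def by (cases w rule: rev_cases) (auto simp: step_state_def)
  have lets: "w @ [i] \<in> W" if w: "w \<in> W" and i: "i \<in> letters n r (fst (st w))" for w i
  proof (cases "w = []")
    case True
    then show ?thesis using i by (auto simp: W_def st_def)
  next
    case False
    then obtain j v where "w = j # v" "j \<in> letters n r (fst s0)" "v \<in> lists (X n)"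
      using w by (auto simp: W_def)
    then show ?thesis using i fst_st[OF False] by (simp add: W_def letters_def)
  qed
  have lets': "w \<in> W" "i \<in> letters n r (fst (st w))" if "w @ [i] \<in> W" for w i
    using that fst_st[of w] by (cases w; auto simp: W_def letters_def st_def)+
  have st_snoc: "st (w @ [i]) = step_state n i (st w)" for w i
    by (simp add: st_def)
  have pm: "pmap n r (st w)" if "w \<in> W" for w
    using that
  proof (induction w rule: rev_induct)
    case (snoc i w)
    then show ?case using lets'[OF snoc.prems] st_snoc pmap_step_state[OF assms(1)] by metis
  qed (use assms in \<open>simp add: st_def\<close>)
  have T: "states T = c ` St" "inp T (c s) = letters n r (fst s)" "trans T i (c s) = c (step_state n i s)"
      "out T i (c s) = step_out n i s" if "s \<in> St" for s i
    using that by (simp_all add: T_def dc)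
  have rd: "can_read T w (c s0) \<and> wtrans T w (c s0) = c (st w)" if "w \<in> W" for w
    using that
  proof (induction w rule: rev_induct)
    case (snoc i w)
    have "st w \<in> St" using lets'(1)[OF snoc.prems] by (simp add: St_def)
    then show ?case using snoc lets'[OF snoc.prems] by (auto simp: T st_snoc)
  qed (simp add: st_def)
  have "[] \<in> W" by (simp add: W_def)
  then have s0: "s0 \<in> St" unfolding St_def st_def by force
  have "canonical n r T d (c s0)"
  proof
    show "2 \<le> n" by fact
    show "c s0 \<in> states T" using s0 by (simp add: T_def)
    show "inj_on d (states T)" using dc by (auto simp: T_def inj_on_def)
    fix q assume "q \<in> states T"
    then obtain w where w: "w \<in> W" "q = c (st w)" by (auto simp: T_def St_def)
    have sw: "st w \<in> St" using w by (simp add: St_def)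
    show "pmap n r (d q)" using pm w dc[OF sw] by simp
    show "inp T q = letters n r (fst (d q))" by (simp add: T_def)
    show "\<exists>w. can_read T w (c s0) \<and> wtrans T w (c s0) = q" using rd w by blast
    fix i assume i: "i \<in> inp T q"
    then have "st (w @ [i]) \<in> St" using lets[OF w(1), of i] w(2) sw by (auto simp: T St_def)
    then show "trans T i q \<in> states T \<and> d (trans T i q) = step_state n i (d q) \<and> out T i q = step_out n i (d q)"
      using dc[OF sw] dc[of "st (w @ [i])"] w(2) sw by (auto simp: T st_snoc)
  qed
  then show thesis using that dc[OF s0] by blast
qed

lemma min_rep_ex:
  assumes n: "2 \<le> n" and f: "inj_on f (cantor n)" "f ` cantor n \<subseteq> cantor n" "ucont (cantor n) f"
  shows "\<exists>M :: nat transducer. min_rep n f M"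
proof -
  let ?f = "restrict f (cantor n)"
  \<comment> \<open>The \<open>1\<close> is an arbitrary number of dotted letters: only the domain
    \<open>cantor n\<close> occurs here.\<close>
  have "pmap n 1 (cantor n, ?f)"
    using f ucont_cong[of "cantor n" f ?f] by (simp add: pmap_def inj_on_def)
  then obtain T d q0 where T: "canonical n 1 T d q0" and d0: "d q0 = (cantor n, ?f)"
    by (rule canonical_ex[OF n])
  interpret canonical n 1 T d q0 by fact
  have st: "fst (d q) = cantor n \<and> snd (d q) ` cantor n \<subseteq> cantor n" if q: "q \<in> states T" for q
  proof -
    obtain w where w: "can_read T w q0" "wtrans T w q0 = q" using reach q by blast
    show ?thesis
    proof (cases "w = []")
      case True
      then show ?thesis using w d0 f(2) by auto
    next
      case False
      note W = wtrans_wout[OF q0 w(1) False]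
      have "snd (d q) x \<in> cantor n" if x: "x \<in> cantor n" for x
      proof -
        have "conc w x \<in> cantor n"
          using runs_conc[of w x T q0] runs_eq[OF q0] runs_eq[OF q] w W(1) x d0 by simp
        then have "f (conc w x) \<in> cantor n" "f (conc w x) = conc (wout T w q0) (snd (d q) x)"
          using W(4)[OF x] d0 w f(2) by auto
        then show ?thesis by (metis cantor_conc_iff)
      qed
      then show ?thesis using W(1) w by auto
    qed
  qed
  have inpX: "inp T q = X n" if "q \<in> states T" for q
    using st[OF that] inp[OF that] by (simp add: letters_def)
  have "transducer n T"
    unfolding transducer_def
  proof (intro conjI ballI)
    fix q assume q: "q \<in> states T"
    then show "inp T q = X n" by (rule inpX)
    show "inf_output T q x" if "x \<in> cantor n" for x
      using iout_eq(1)[OF q] st[OF q] that by simp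
    fix i assume "i \<in> X n"
    then have i: "i \<in> inp T q" using inpX q by simp
    then show "trans T i q \<in> states T" using step q by blast
    have "conc (out T i q) (snd (d (trans T i q)) (\<lambda>_. Let 0)) = snd (d q) (conc [i] (\<lambda>_. Let 0))"
      using wtrans_wout(4)[OF q, of "[i]" "\<lambda>_. Let 0"] i n by simp
    moreover have "snd (d q) (conc [i] (\<lambda>_. Let 0)) \<in> cantor n"
      using st[OF q] i inpX[OF q] cantor_two(1)[OF n] by (simp add: image_subset_iff cantor_conc_iff)
    ultimately show "out T i q \<in> lists (X n)" by (metis cantor_conc_iff)
  qed
  moreover have "\<forall>x\<in>cantor n. iout T q0 x = f x"
    using iout_eq(2)[OF q0] d0 by simp
  ultimately have "min_rep n f T"
    unfolding min_rep_def using minimal q0 by blast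
  then show ?thesis by blast
qed

section \<open>Cores and classes of isomorphic transducers\<close>

lemma wout_states_update [simp]: "wout (T\<lparr>states := Q\<rparr>) w q = wout T w q"
  by (induction w arbitrary: q) auto

lemma core_simps [simp]: "inp (core n T) = inp T" "trans (core n T) = trans T" "out (core n T) = out T"
    "iout (core n T) q = iout T q"
  by (simp_all add: core_def iout_def fun_eq_iff)

lemma states_core: "states (core n T) = {wtrans T w q | w q. w \<in> lists (X n) \<and>
     length w = (LEAST k. sync_level T k) \<and> q \<in> states T \<and> can_read T w q}"
  by (simp add: core_def)

lemma wtrans_in_states:
  assumes "\<And>q i. q \<in> states T \<Longrightarrow> i \<in> inp T q \<Longrightarrow> trans T i q \<in> states T"
  shows "q \<in> states T \<Longrightarrow> can_read T w q \<Longrightarrow> wtrans T w q \<in> states T"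
  by (induction w arbitrary: q) (use assms in auto)

text \<open>Write \<open>w @ [i]\<close> as \<open>j # v\<close>: the new state is reached by
  \<open>v\<close>, which has the prescribed length again, from the state after
  \<open>j\<close>.\<close>

lemma core_trans:
  assumes "\<And>q i. q \<in> states T \<Longrightarrow> i \<in> inp T q \<Longrightarrow> trans T i q \<in> states T"
    and "q \<in> states (core n T)" "i \<in> inp T q" "i \<in> X n"
  shows "trans T i q \<in> states (core n T)"
proof -
  obtain w p where w: "q = wtrans T w p" "w \<in> lists (X n)" "length w = (LEAST k. sync_level T k)"
      "p \<in> states T" "can_read T w p"
    using assms(2) unfolding states_core by blast
  obtain j v where jv: "w @ [i] = j # v" by (cases w) auto
  then have "can_read T (j # v) p" "j # v \<in> lists (X n)" "length v = length w"
      "trans T i q = wtrans T (j # v) p"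
    using w assms(3,4) by (auto simp flip: jv) (metis jv length_Cons length_append_singleton nat.inject)
  then have "trans T i q = wtrans T v (trans T j p)" "v \<in> lists (X n)" "can_read T v (trans T j p)"
     "trans T j p \<in> states T" "length v = (LEAST k. sync_level T k)"
    using assms(1) w by auto
  then show ?thesis unfolding states_core by blast
qed

lemma iso_wout:
  assumes "\<forall>q\<in>states T. inp U (f q) = inp T q \<and>
        (\<forall>i\<in>inp T q. trans U i (f q) = f (trans T i q) \<and> out U i (f q) = out T i q)"
    and "\<And>q. q \<in> states T \<Longrightarrow> inp T q = X n"
    and "\<And>q i. q \<in> states T \<Longrightarrow> i \<in> X n \<Longrightarrow> trans T i q \<in> states T"
  shows "q \<in> states T \<Longrightarrow> w \<in> lists (X n) \<Longrightarrow> wout U w (f q) = wout T w q"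
  by (induction w arbitrary: q) (use assms in auto)

lemma iso_class_iout:
  assumes "\<And>q. q \<in> states T \<Longrightarrow> inp T q = X n"
    and "\<And>q i. q \<in> states T \<Longrightarrow> i \<in> X n \<Longrightarrow> trans T i q \<in> states T"
    and "U \<in> iso_class T" "p \<in> states U"
  shows "\<exists>q\<in>states T. \<forall>x\<in>cantor n. iout U p x = iout T q x"
proof -
  obtain f where f: "bij_betw f (states T) (states U)"
    "\<forall>q\<in>states T. inp U (f q) = inp T q \<and>
        (\<forall>i\<in>inp T q. trans U i (f q) = f (trans T i q) \<and> out U i (f q) = out T i q)"
    using assms(3) unfolding iso_class_def transducer_iso_def by blast
  obtain q where q: "q \<in> states T" "p = f q"
    using f(1) assms(4) unfolding bij_betw_def by blast
  have "iout U p x = iout T q x" if "x \<in> cantor n" for x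
    unfolding iout_def q(2)
    by (simp add: iso_wout[OF f(2) assms(1,2) q(1)] cantor_pre[OF that])
  then show ?thesis using q by blast
qed

lemma transducer_iso_refl: "transducer_iso T T"
  unfolding transducer_iso_def by (intro exI[of _ id]) auto

lemma mem_iso_class: "T \<in> iso_class T"
  by (simp add: iso_class_def transducer_iso_refl)

lemma transducer_iso_trans:
  assumes "transducer_iso T U" "transducer_iso U V"
  shows "transducer_iso T V"
proof -
  obtain f where f: "bij_betw f (states T) (states U)"
    "\<forall>q\<in>states T. inp U (f q) = inp T q \<and>
        (\<forall>i\<in>inp T q. trans U i (f q) = f (trans T i q) \<and> out U i (f q) = out T i q)"
    using assms(1) unfolding transducer_iso_def by blast
  obtain g where g: "bij_betw g (states U) (states V)"
    "\<forall>q\<in>states U. inp V (g q) = inp U q \<and>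
        (\<forall>i\<in>inp U q. trans V i (g q) = g (trans U i q) \<and> out V i (g q) = out U i q)"
    using assms(2) unfolding transducer_iso_def by blast
  have "f q \<in> states U" if "q \<in> states T" for q
    using f(1) that by (meson bij_betwE)
  then show ?thesis
    unfolding transducer_iso_def
    using bij_betw_trans[OF f(1) g(1)] f(2) g(2) by (intro exI[of _ "g \<circ> f"]) auto
qed

lemma transducer_iso_sym:
  assumes "transducer_iso T U" "\<And>q i. q \<in> states T \<Longrightarrow> i \<in> inp T q \<Longrightarrow> trans T i q \<in> states T"
  shows "transducer_iso U T"
proof -
  obtain f where f: "bij_betw f (states T) (states U)"
    "\<forall>q\<in>states T. inp U (f q) = inp T q \<and>
        (\<forall>i\<in>inp T q. trans U i (f q) = f (trans T i q) \<and> out U i (f q) = out T i q)"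
    using assms(1) unfolding transducer_iso_def by blast
  let ?g = "inv_into (states T) f"
  have "inp T (?g p) = inp U p \<and> (\<forall>i\<in>inp U p. trans T i (?g p) = ?g (trans U i p) \<and> out T i (?g p) = out U i p)"
    if p: "p \<in> states U" for p
  proof -
    obtain q where "q \<in> states T" "p = f q" using f(1) p unfolding bij_betw_def by blast
    then show ?thesis using f(2) assms(2) bij_betw_inv_into_left[OF f(1)] by simp
  qed
  then show ?thesis
    unfolding transducer_iso_def using bij_betw_inv_into[OF f(1)] by blast
qed

lemma iso_class_eq:
  assumes "transducer_iso T U" "\<And>q i. q \<in> states T \<Longrightarrow> i \<in> inp T q \<Longrightarrow> trans T i q \<in> states T"
  shows "iso_class T = iso_class U"
proof -
  have "transducer_iso U T"
    by (rule transducer_iso_sym[OF assms(1)]) (rule assms(2))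
  then have "transducer_iso T W \<longleftrightarrow> transducer_iso U W" for W :: "nat transducer"
    using assms(1) transducer_iso_trans[of U T W] transducer_iso_trans[of T U W] by blast
  then show ?thesis by (simp add: iso_class_def)
qed

lemma transducer_can_read:
  assumes "transducer n M"
  shows "q \<in> states M \<Longrightarrow> can_read M w q \<longleftrightarrow> w \<in> lists (X n)"
    and "q \<in> states M \<Longrightarrow> w \<in> lists (X n) \<Longrightarrow> wtrans M w q \<in> states M"
  by (induction w arbitrary: q) (use assms in \<open>auto simp: transducer_def\<close>)

text \<open>A state of the core is reached from the initial state by some word \<open>w\<close>, so
  up to the output \<open>s\<close> written on the way it induces the restriction of
  \<open>f\<close> to the cone of \<open>w\<close>. This suffices for counting cones in the images
  of the states of a product.\<close>

lemma Core_map_iout: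
  assumes n: "2 \<le> n" and f: "inj_on f (cantor n)" "f ` cantor n \<subseteq> cantor n" "ucont (cantor n) f"
  shows "\<exists>U\<in>Core_map n f. states U \<noteq> {}"
    and "\<lbrakk>U \<in> Core_map n f; p \<in> states U\<rbrakk> \<Longrightarrow>
      \<exists>w\<in>lists (X n). \<exists>s. \<forall>x\<in>cantor n. f (conc w x) = conc s (iout U p x)"
proof -
  define M where "M = (SOME M :: nat transducer. min_rep n f M)"
  have "min_rep n f M"
    unfolding M_def using min_rep_ex[OF assms] by (rule someI_ex)
  then obtain q0 where q0: "q0 \<in> states M" "transducer n M" "minimal M q0" "\<forall>x\<in>cantor n. iout M q0 x = f x"
    unfolding min_rep_def by blast
  note rd = transducer_can_read[OF q0(2)]
  have C: "Core_map n f = iso_class (core n M)" by (simp add: Core_map_def M_def)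
  have sub: "states (core n M) \<subseteq> states M"
    unfolding states_core using rd by blast
  \<comment> \<open>A word of the length used in \<open>core\<close>, whatever that length is; the
    state to which it leads shows that the core is nonempty.\<close>
  let ?z = "replicate (LEAST k. sync_level M k) (Let 0)"
  have z: "?z \<in> lists (X n)" "length ?z = (LEAST k. sync_level M k)"
    using n by auto
  then have "wtrans M ?z q0 \<in> states (core n M)"
    unfolding states_core using rd(1)[OF q0(1)] q0(1) by blast
  then show "\<exists>U\<in>Core_map n f. states U \<noteq> {}"
    unfolding C using mem_iso_class by blast
  assume U: "U \<in> Core_map n f" "p \<in> states U"
  have inpC: "inp (core n M) q = X n" if "q \<in> states (core n M)" for q
    using that sub q0(2) by (auto simp: transducer_def)
  have trC: "trans (core n M) i q \<in> states (core n M)" if "q \<in> states (core n M)" "i \<in> X n" for q i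
    using core_trans[of M q n i] that sub q0(2) by (auto simp: transducer_def)
  have "\<exists>q\<in>states (core n M). \<forall>x\<in>cantor n. iout U p x = iout (core n M) q x"
    by (rule iso_class_iout[OF inpC trC]) (use U C in simp_all)
  then obtain q where q: "q \<in> states (core n M)" "\<And>x. x \<in> cantor n \<Longrightarrow> iout U p x = iout M q x"
    by auto
  then have "q \<in> states M" using sub by blast
  then obtain w where w: "can_read M w q0" "wtrans M w q0 = q"
    using q0(3) unfolding minimal_def by blast
  have "f (conc w x) = conc (wout M w q0) (iout U p x)" if x: "x \<in> cantor n" for x
  proof -
    have "inf_output M (wtrans M w q0) x"
      using q0(2) \<open>q \<in> states M\<close> w(2) x by (simp add: transducer_def)
    from iout_conc[OF this] q0(4) show ?thesis
      using x w rd(1)[OF q0(1)] q(2)[OF x] by (simp add: cantor_conc_iff)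
  qed
  then show "\<exists>w\<in>lists (X n). \<exists>s. \<forall>x\<in>cantor n. f (conc w x) = conc s (iout U p x)"
    using w rd(1)[OF q0(1)] by blast
qed


text \<open>
  In terms of local maps, synchronization at level \<open>k\<close> says that the local map at a long word
  depends only on the last \<open>k\<close> letters.
\<close>

definition lsync :: "nat \<Rightarrow> nat \<Rightarrow> (infword \<Rightarrow> infword) \<Rightarrow> nat \<Rightarrow> bool" where
  "lsync n r h k \<longleftrightarrow> (\<forall>w\<in>pluswords n r. \<forall>w'\<in>pluswords n r. \<forall>v\<in>lists (X n).
     length v = k \<longrightarrow> loc n h (w @ v) = loc n h (w' @ v))"

text \<open>For a synchronizing \<open>k\<close> these are the maps induced by the core. The
  inequality is strict because a dotted letter precedes the \<open>k\<close> letters that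
  synchronize.\<close>

definition long_locs :: "nat \<Rightarrow> nat \<Rightarrow> (infword \<Rightarrow> infword) \<Rightarrow> nat \<Rightarrow> (infword \<Rightarrow> infword) set" where
  "long_locs n r h k = {loc n h w | w. w \<in> pluswords n r \<and> k < length w}"

text \<open>Zeros inserted in front of the last \<open>k\<close> letters make the word as long as
  desired without changing its local map.\<close>

lemma long_locs_eq:
  assumes "2 \<le> n" "lsync n r h k" "k \<le> l"
  shows "long_locs n r h l = long_locs n r h k"
proof
  show "long_locs n r h l \<subseteq> long_locs n r h k"
    using assms(3) unfolding long_locs_def by fastforce
  show "long_locs n r h k \<subseteq> long_locs n r h l"
  proof
    fix g assume "g \<in> long_locs n r h k"
    then obtain w where w: "w \<in> pluswords n r" "k < length w" "g = loc n h w"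
      unfolding long_locs_def by blast
    obtain u v where uv: "w = u @ v" "u \<in> pluswords n r" "v \<in> lists (X n)" "length v = k"
      by (rule pluswords_split[OF w(1,2)])
    let ?u = "u @ replicate l (Let 0)"
    have "?u \<in> pluswords n r"
      using uv(2) assms(1) by (intro pluswords_appendI) auto
    then have "g = loc n h (?u @ v)" "?u @ v \<in> pluswords n r"
      using assms(2) uv w(3) pluswords_appendI unfolding lsync_def by blast+
    moreover have "l < length (?u @ v)"
      using uv(2) by (cases u) auto
    ultimately show "g \<in> long_locs n r h l"
      unfolding long_locs_def by blast
  qed
qed

section \<open>Minimal transducers over the dotted space\<close>

text \<open>\<open>Core\<close> takes whichever minimal transducer \<open>SOME\<close> returns, so
  its core has to be described by \<open>h\<close> alone. The states other than \<open>q0\<close>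
  turn out to induce exactly the local maps of \<open>h\<close>.\<close>

locale dot_rep =
  fixes n r :: nat and h :: "infword \<Rightarrow> infword" and A :: "'s transducer" and q0 :: 's
    and R S :: "'s set"
  assumes n: "2 \<le> n" and r: "1 \<le> r"
    and dt: "dot_transducer n r A q0 R S"
    and minA: "minimal A q0"
    and hA: "x \<in> cantor_dot n r \<Longrightarrow> iout A q0 x = h x"
    and inj_h: "inj_on h (cantor_dot n r)"
begin

lemma states_A: "states A = R \<union> S" and finite_R: "finite R"
  and no_cycle: "\<lbrakk>q \<in> R; w \<noteq> []; can_read A w q\<rbrakk> \<Longrightarrow> wtrans A w q \<noteq> q"
  and inf_output_S: "\<lbrakk>q \<in> S; x \<in> cantor n\<rbrakk> \<Longrightarrow> inf_output A q x"
  and q0_R: "q0 \<in> R"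
  using dt by (simp_all add: dot_transducer_def)

lemma q0: "q0 \<in> states A"
  by (simp add: states_A q0_R)

lemma inp_A: "q \<in> states A \<Longrightarrow> inp A q = (if q = q0 then dots r else X n)"
  using dt by (simp add: dot_transducer_def)

lemma inp0: "inp A q0 = dots r"
  by (simp add: inp_A q0)

lemma inpX: "q \<in> states A \<Longrightarrow> q \<noteq> q0 \<Longrightarrow> inp A q = X n"
  by (simp add: inp_A)

lemma trans_states:
  assumes "q \<in> states A" "i \<in> inp A q"
  shows "trans A i q \<in> states A" "trans A i q \<noteq> q0"
proof -
  have "\<forall>q\<in>states A. \<forall>i\<in>inp A q. trans A i q \<in> states A - {q0}"
    using dt unfolding dot_transducer_def by (elim conjE)
  then show "trans A i q \<in> states A" "trans A i q \<noteq> q0" using assms by blast+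
qed

lemma can_read_X: "q \<in> states A \<Longrightarrow> q \<noteq> q0 \<Longrightarrow> can_read A w q \<longleftrightarrow> w \<in> lists (X n)"
  by (induction w arbitrary: q) (auto simp: inpX trans_states)

lemma wtrans_X: "q \<in> states A \<Longrightarrow> q \<noteq> q0 \<Longrightarrow> w \<in> lists (X n) \<Longrightarrow> wtrans A w q \<in> states A \<and> wtrans A w q \<noteq> q0"
  by (induction w arbitrary: q) (auto simp: inpX trans_states)

lemma can_read_q0: "can_read A w q0 \<longleftrightarrow> w = [] \<or> w \<in> pluswords n r"
  by (cases w) (auto simp: inp0 can_read_X trans_states q0)

lemma wtrans_q0: "w \<in> pluswords n r \<Longrightarrow> wtrans A w q0 \<in> states A \<and> wtrans A w q0 \<noteq> q0"
  by (cases w) (auto simp: inp0 wtrans_X trans_states q0)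

lemma reach:
  assumes "q \<in> states A" "q \<noteq> q0"
  obtains w where "w \<in> pluswords n r" "q = wtrans A w q0"
  using minA assms can_read_q0 unfolding minimal_def by (metis wtrans_Nil)

lemma runs_X: "q \<in> states A \<Longrightarrow> q \<noteq> q0 \<Longrightarrow> runs A q = cantor n"
  unfolding runs_def cantor_def
proof (intro equalityI subsetI CollectI allI)
  fix x i assume q: "q \<in> states A" "q \<noteq> q0" and "x \<in> {x. \<forall>k. can_read A (pre k x) q}"
  then have "can_read A (pre (Suc i) x) q" by blast
  then show "x i \<in> X n" unfolding can_read_X[OF q] by (simp add: pre_Suc)
next
  fix x :: infword and k assume q: "q \<in> states A" "q \<noteq> q0" and "x \<in> {x. \<forall>i. x i \<in> X n}"
  then show "can_read A (pre k x) q"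
    using can_read_X[OF q] cantor_pre[of x n k] by (simp add: cantor_def)
qed

text \<open>States in \<open>R\<close> lie on no cycle and are finitely many, so by the pigeonhole
  principle every infinite input leads into \<open>S\<close>, where the output is infinite.\<close>

lemma inf_output_X:
  assumes q: "q \<in> states A" "q \<noteq> q0" and x: "x \<in> cantor n"
  shows "inf_output A q x"
proof -
  let ?q = "\<lambda>k. wtrans A (pre k x) q"
  have st: "?q k \<in> states A \<and> ?q k \<noteq> q0" for k
    using wtrans_X[OF q] cantor_pre[OF x] by blast
  have "\<exists>k. ?q k \<in> S"
  proof (rule ccontr)
    assume "\<nexists>k. ?q k \<in> S"
    then have R: "?q ` {..card R} \<subseteq> R"
      using st states_A by blast
    have "\<not> inj_on ?q {..card R}"
      using card_inj_on_le[OF _ R finite_R] by force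
    then obtain i j where ij: "i < j" "?q i = ?q j" "i \<le> card R"
      unfolding inj_on_def by (metis atMost_iff linorder_neqE_nat)
    obtain v where v: "pre j x = pre i x @ v" using pre_le_append[of i j x] ij(1) by auto
    have "v \<noteq> []" using ij(1) v by (metis append_Nil2 length_pre less_irrefl)
    moreover have "v \<in> lists (X n)"
      using cantor_pre[OF x, of j] v by simp
    then have "can_read A v (?q i)" using can_read_X st by blast
    moreover have "wtrans A v (?q i) = ?q i" using ij v by simp
    moreover have "?q i \<in> R" using R ij(3) by blast
    ultimately show False using no_cycle by blast
  qed
  then obtain k where "?q k \<in> S" by blast
  then have "inf_output A (?q k) (sdrop k x)"
    using inf_output_S cantor_pre[OF x, of k] by blast
  then show ?thesis
    using inf_output_conc[of A q "pre k x" "sdrop k x"] by simp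
qed

lemma h_conc:
  assumes "w \<in> pluswords n r" "x \<in> cantor n"
  shows "h (conc w x) = conc (wout A w q0) (iout A (wtrans A w q0) x)"
  using iout_conc[OF inf_output_X[OF _ _ assms(2)]] wtrans_q0[OF assms(1)] hA[OF pluswords_conc[OF assms]] by metis

lemma iout_inj:
  assumes "w \<in> pluswords n r"
  shows "inj_on (iout A (wtrans A w q0)) (cantor n)"
proof (rule inj_onI)
  fix x y assume xy: "x \<in> cantor n" "y \<in> cantor n" "iout A (wtrans A w q0) x = iout A (wtrans A w q0) y"
  then have "h (conc w x) = h (conc w y)" using h_conc[OF assms] by simp
  then show "x = y"
    using inj_onD[OF inj_h] pluswords_conc[OF assms] xy by (metis conc_inject)
qed

lemma letter_runs:
  assumes "q \<in> states A" "i \<in> inp A q"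
  shows "{x \<in> runs A q. x 0 = i} = conc [i] ` cantor n"
proof -
  have x: "x = conc [x 0] (sdrop 1 x)" for x
    using conc_pre_sdrop[of 1 x] by (simp add: pre_def)
  have "conc [i] y \<in> runs A q \<longleftrightarrow> y \<in> cantor n" for y
    using assms by (simp add: runs_conc runs_X trans_states)
  then have "x \<in> runs A q \<and> x 0 = i \<longleftrightarrow> x \<in> conc [i] ` cantor n" for x
    using x[of x] by (metis conc_single_0(1) imageE imageI)
  then show ?thesis by blast
qed

text \<open>By minimality each transition writes the whole greatest common prefix, so the outputs of
  the state that it enters have nothing in common.\<close>

lemma out_eq:
  assumes "q \<in> states A" "i \<in> inp A q"
  shows "\<And>x. x \<in> cantor n \<Longrightarrow> iout A q (conc [i] x) = conc (out A i q) (iout A (trans A i q) x)"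
    and "strip_pre n (iout A (trans A i q)) = []"
    and "inj_on (iout A (trans A i q)) (cantor n)"
proof -
  obtain w where w: "wtrans A w q0 = q" "can_read A w q0"
    using minA assms unfolding minimal_def by blast
  then have wi: "w @ [i] \<in> pluswords n r"
    using assms can_read_q0[of "w @ [i]"] by simp
  then show inj: "inj_on (iout A (trans A i q)) (cantor n)"
    using iout_inj[OF wi] w by simp
  show eq: "iout A q (conc [i] x) = conc (out A i q) (iout A (trans A i q) x)" if "x \<in> cantor n" for x
    using iout_conc[of A "[i]" q x] inf_output_X trans_states[OF assms] that by simp
  have "\<forall>q\<in>states A. \<forall>i\<in>inp A q. greatest_common_prefix (out A i q) (iout A q ` {x \<in> runs A q. x 0 = i})"
    using minA unfolding minimal_def by (elim conjE)
  then have "greatest_common_prefix (out A i q) (iout A q ` {x \<in> runs A q. x 0 = i})"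
    using assms by blast
  then have "greatest_common_prefix (out A i q) (iout A q ` conc [i] ` cantor n)"
    unfolding letter_runs[OF assms] .
  moreover have "iout A q ` conc [i] ` cantor n = (\<lambda>x. conc (out A i q) (iout A (trans A i q) x)) ` cantor n"
    unfolding image_image using eq by (intro image_cong) auto
  moreover have "inj_on (\<lambda>x. conc (out A i q) (iout A (trans A i q) x)) (cantor n)"
    using inj by (simp add: inj_on_def)
  ultimately have "out A i q = strip_pre n (\<lambda>x. conc (out A i q) (iout A (trans A i q) x))"
    using strip_pre_greatest[OF n] by simp
  also have "\<dots> = out A i q @ strip_pre n (iout A (trans A i q))"
    by (rule strip_conc(2)[OF n inj])
  finally show "strip_pre n (iout A (trans A i q)) = []" by simp
qed

text \<open>Since the map of a state has no common prefix left, removing the output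
  \<open>wout A w q0\<close> from the values of \<open>h\<close> on the cone is exactly
  stripping.\<close>

lemma loc_eq_iout:
  assumes "w \<in> pluswords n r"
  shows "loc n h w = restrict (iout A (wtrans A w q0)) (cantor n)"
proof -
  obtain u i where ui: "w = u @ [i]" using assms by (cases w rule: rev_cases) auto
  have "can_read A u q0" "i \<in> inp A (wtrans A u q0)" "wtrans A u q0 \<in> states A"
    using can_read_q0[of w] assms ui wtrans_in_states[of A q0 u] trans_states q0 by auto
  then have e: "strip_pre n (iout A (wtrans A w q0)) = []"
    using out_eq(2) ui by simp
  have "loc n h w = strip n (iout A (wtrans A w q0))"
    unfolding loc_def
    by (simp only: strip_cong[of n, OF h_conc[OF assms]] strip_conc(1)[OF n iout_inj[OF assms]])
  then show ?thesis
    using conc_strip[OF n iout_inj[OF assms]] e by (auto simp: restrict_def strip_def fun_eq_iff)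
qed

lemma state_eqI:
  assumes "p \<in> states A" "p \<noteq> q0" "q \<in> states A" "q \<noteq> q0"
    "restrict (iout A p) (cantor n) = restrict (iout A q) (cantor n)"
  shows "p = q"
proof -
  have "\<forall>x\<in>cantor n. iout A p x = iout A q x"
    using assms(5) by (metis restrict_apply')
  then show ?thesis
    using minA assms(1-4) runs_X unfolding minimal_def by metis
qed

lemma sync_level_lsync: "sync_level A k \<Longrightarrow> lsync n r h k"
  unfolding lsync_def
proof (intro ballI impI)
  fix w w' v assume s: "sync_level A k" and w: "w \<in> pluswords n r" "w' \<in> pluswords n r" "v \<in> lists (X n)" "length v = k"
  have "wtrans A (w @ v) q0 = wtrans A (w' @ v) q0"
    using s w wtrans_q0[of w] wtrans_q0[of w'] can_read_X unfolding sync_level_def by simp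
  then show "loc n h (w @ v) = loc n h (w' @ v)"
    using w by (simp add: loc_eq_iout pluswords_appendI)
qed

text \<open>The additional letter makes the word nonempty: its first letter is dotted or not and
  thereby separates \<open>q0\<close> from all other states, to which the hypothesis
  applies.\<close>

lemma lsync_sync_level:
  assumes "lsync n r h k"
  shows "sync_level A (Suc k)"
  unfolding sync_level_def
proof (intro allI impI ballI)
  fix w p q assume w: "length w = Suc k" and pq: "p \<in> states A" "q \<in> states A" "can_read A w p \<and> can_read A w q"
  obtain i v where iv: "w = i # v" "length v = k" using w by (cases w) auto
  show "wtrans A w p = wtrans A w q"
  proof (cases "i \<in> X n")
    case False
    then have "p = q0" "q = q0" using pq iv inpX by auto
    then show ?thesis by simp
  next
    case True
    then have ne: "p \<noteq> q0" "q \<noteq> q0" using pq iv inp0 dots_X_disjoint by auto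
    obtain u u' where u: "u \<in> pluswords n r" "p = wtrans A u q0" "u' \<in> pluswords n r" "q = wtrans A u' q0"
      using reach[OF pq(1) ne(1)] reach[OF pq(2) ne(2)] by metis
    have wX: "w \<in> lists (X n)" using can_read_X pq ne by blast
    have ui: "u @ [i] \<in> pluswords n r" "u' @ [i] \<in> pluswords n r" "v \<in> lists (X n)"
      using u wX iv by (auto intro: pluswords_appendI)
    then have "loc n h ((u @ [i]) @ v) = loc n h ((u' @ [i]) @ v)"
      using assms iv(2) unfolding lsync_def by blast
    then have "restrict (iout A (wtrans A w p)) (cantor n) = restrict (iout A (wtrans A w q)) (cantor n)"
      using loc_eq_iout[OF pluswords_appendI[OF ui(1,3)]] loc_eq_iout[OF pluswords_appendI[OF ui(2,3)]] iv u by simp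
    then show ?thesis
      using state_eqI wtrans_X wX pq ne by blast
  qed
qed

lemma not_sync_level_0: "\<not> sync_level A 0"
proof
  assume "sync_level A 0"
  moreover have "trans A (Dot 0) q0 \<in> states A" "trans A (Dot 0) q0 \<noteq> q0"
    using trans_states[OF q0] inp0 r by auto
  ultimately show False using q0 unfolding sync_level_def by fastforce
qed

text \<open>Reading zeros before a synchronizing word does not change the state that it forces;
  hence every core state is reached from \<open>q0\<close> by arbitrarily long words.\<close>

lemma states_core_eq:
  assumes "sync_level A k" "(LEAST k. sync_level A k) \<le> l"
  shows "states (core n A) = {wtrans A w q0 | w. w \<in> pluswords n r \<and> l < length w}"
proof -
  define K where "K = (LEAST k. sync_level A k)"
  have K: "sync_level A K" unfolding K_def using assms(1) by (rule LeastI)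
  have K0: "0 < K" using K not_sync_level_0 by (cases K) auto
  show ?thesis
  proof (intro equalityI subsetI)
    fix q assume "q \<in> states (core n A)"
    then obtain w p where w: "q = wtrans A w p" "w \<in> lists (X n)" "length w = K" "p \<in> states A" "can_read A w p"
      unfolding states_core K_def by blast
    then have p: "p \<noteq> q0" using K0 inp0 dots_X_disjoint by (cases w) auto
    obtain u where u: "u \<in> pluswords n r" "p = wtrans A u q0" using reach w(4) p by metis
    let ?z = "replicate l (Let 0)"
    have z: "?z \<in> lists (X n)" using n by auto
    then have "wtrans A w (wtrans A ?z p) = wtrans A w p"
      using K w wtrans_X[OF w(4) p z] can_read_X unfolding sync_level_def by blast
    then have "q = wtrans A (u @ ?z @ w) q0" using u w(1) by simp
    moreover have "u @ ?z @ w \<in> pluswords n r"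
      using z w(2) by (intro pluswords_appendI u) auto
    moreover have "l < length (u @ ?z @ w)" using w(3) K0 by simp
    ultimately show "q \<in> {wtrans A w q0 | w. w \<in> pluswords n r \<and> l < length w}" by blast
  next
    fix q assume "q \<in> {wtrans A w q0 | w. w \<in> pluswords n r \<and> l < length w}"
    then obtain w where w: "w \<in> pluswords n r" "K < length w" "q = wtrans A w q0"
      using assms(2) unfolding K_def by auto
    obtain u v where uv: "w = u @ v" "u \<in> pluswords n r" "v \<in> lists (X n)" "length v = K"
      by (rule pluswords_split[OF w(1,2)])
    then show "q \<in> states (core n A)"
      using w(3) wtrans_q0[OF uv(2)] can_read_X unfolding states_core K_def by fastforce
  qed
qed

lemma states_core_iout:
  assumes "lsync n r h k"
  shows "bij_betw (\<lambda>q. restrict (iout A q) (cantor n)) (states (core n A)) (long_locs n r h k)"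
    and "states (core n A) \<subseteq> states A - {q0}"
proof -
  \<comment> \<open>From the least synchronizing level on, the core is described by long words; from
    \<open>k\<close> on, their local maps form the same set. \<open>L\<close> is beyond
    both.\<close>
  define L where "L = max k (LEAST k. sync_level A k)"
  have C: "states (core n A) = {wtrans A w q0 | w. w \<in> pluswords n r \<and> L < length w}"
    by (rule states_core_eq[OF lsync_sync_level[OF assms]]) (simp add: L_def)
  show sub: "states (core n A) \<subseteq> states A - {q0}"
    unfolding C by (auto simp: wtrans_q0)
  let ?W = "{w. w \<in> pluswords n r \<and> L < length w}"
  have "(\<lambda>q. restrict (iout A q) (cantor n)) ` states (core n A) =
      (\<lambda>w. restrict (iout A (wtrans A w q0)) (cantor n)) ` ?W"
    unfolding C by (simp add: setcompr_eq_image image_image)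
  also have "\<dots> = loc n h ` ?W"
    by (intro image_cong) (simp_all add: loc_eq_iout)
  also have "\<dots> = long_locs n r h L"
    by (simp add: long_locs_def setcompr_eq_image)
  also have "\<dots> = long_locs n r h k"
    by (rule long_locs_eq[OF n assms]) (simp add: L_def)
  finally have img: "(\<lambda>q. restrict (iout A q) (cantor n)) ` states (core n A) = long_locs n r h k" .
  have "inj_on (\<lambda>q. restrict (iout A q) (cantor n)) (states (core n A))"
    by (rule inj_onI) (use sub state_eqI in blast)
  then show "bij_betw (\<lambda>q. restrict (iout A q) (cantor n)) (states (core n A)) (long_locs n r h k)"
    using img by (rule bij_betw_imageI)
qed

end

lemma dot_repI:
  assumes "min_dot_rep n r h A" "2 \<le> n" "1 \<le> r" "inj_on h (cantor_dot n r)"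
  obtains q0 R S where "dot_rep n r h A q0 R S"
  using assms unfolding min_dot_rep_def dot_rep_def by blast

text \<open>The map induced by a state determines the output on a letter, as a greatest common
  prefix, and the map of the next state, as what remains. So matching core states with equal maps is
  an isomorphism.\<close>

lemma core_iso:
  assumes A: "dot_rep n r h A q0 R S" and A': "dot_rep n r' g A' q0' R' S'"
    and k: "lsync n r h k" and k': "lsync n r' g k'" and eq: "long_locs n r h k = long_locs n r' g k'"
  shows "iso_class (core n A) = iso_class (core n A')"
proof (rule iso_class_eq)
  interpret A: dot_rep n r h A q0 R S by fact
  interpret A': dot_rep n r' g A' q0' R' S' by fact
  let ?v = "\<lambda>q. restrict (iout A q) (cantor n)" and ?v' = "\<lambda>q. restrict (iout A' q) (cantor n)"
  let ?Q = "states (core n A)" and ?Q' = "states (core n A')"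
  note v = A.states_core_iout[OF k] and v' = A'.states_core_iout[OF k']
  have inp: "inp A q = X n" if "q \<in> ?Q" for q
    using that v(2) A.inpX by blast
  have tr: "trans A i q \<in> ?Q" if "q \<in> ?Q" "i \<in> X n" for i q
    using core_trans[of A q n i] A.trans_states(1) that inp by blast
  then show "trans (core n A) i q \<in> states (core n A)" if "q \<in> states (core n A)" "i \<in> inp (core n A) q" for i q
    using that inp by simp
  have inp': "inp A' q = X n" if "q \<in> ?Q'" for q
    using that v'(2) A'.inpX by blast
  have tr': "trans A' i q \<in> ?Q'" if "q \<in> ?Q'" "i \<in> X n" for i q
    using core_trans[of A' q n i] A'.trans_states(1) that inp' by blast
  define f where "f = inv_into ?Q' ?v' \<circ> ?v"
  have f: "bij_betw f ?Q ?Q'"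
    unfolding f_def using v(1) v'(1) eq by (metis bij_betw_inv_into bij_betw_trans)
  have vf: "?v' (f q) = ?v q" if "q \<in> ?Q" for q
    unfolding f_def comp_def
    by (rule bij_betw_inv_into_right[OF v'(1), of "?v q"]) (use bij_betwE[OF v(1)] eq that in blast)
  have "trans A' i (f q) = f (trans A i q) \<and> out A' i (f q) = out A i q" if q: "q \<in> ?Q" and i: "i \<in> X n" for q i
  proof -
    have fq: "f q \<in> ?Q'" using f q by (meson bij_betwE)
    let ?y = "iout A (trans A i q)" and ?y' = "iout A' (trans A' i (f q))"
    have e: "q \<in> states A" "i \<in> inp A q" "f q \<in> states A'" "i \<in> inp A' (f q)"
      using q fq v(2) v'(2) inp inp' i by auto
    note o = A.out_eq[OF e(1,2)] and o' = A'.out_eq[OF e(3,4)]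
    have yy: "conc (out A i q) (?y x) = conc (out A' i (f q)) (?y' x)" if x: "x \<in> cantor n" for x
    proof -
      have "iout A q (conc [i] x) = iout A' (f q) (conc [i] x)"
        using vf[OF q] x i by (metis cantor_conc_iff Cons_in_lists_iff lists.Nil restrict_apply')
      then show ?thesis using o(1) o'(1) x by simp
    qed
    have "out A i q = strip_pre n (\<lambda>x. conc (out A i q) (?y x))"
      using strip_conc(2)[OF A.n o(3)] o(2) by simp
    also have "\<dots> = strip_pre n (\<lambda>x. conc (out A' i (f q)) (?y' x))"
      by (rule strip_pre_cong[OF A.n yy])
    also have "\<dots> = out A' i (f q)"
      using strip_conc(2)[OF A.n o'(3)] o'(2) by simp
    finally have out: "out A i q = out A' i (f q)" .
    then have "?v' (trans A' i (f q)) = ?v (trans A i q)"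
      using yy by (intro restrict_ext) simp
    also have "\<dots> = ?v' (f (trans A i q))" using vf[OF tr[OF q i]] by simp
    finally have "trans A' i (f q) = f (trans A i q)"
      using v'(1) tr'[OF fq i] f tr[OF q i] unfolding bij_betw_def
      by (metis (mono_tags, lifting) image_eqI inj_onD)
    then show ?thesis using out by simp
  qed
  moreover have "inp A' (f q) = inp A q" if "q \<in> ?Q" for q
    using inp[OF that] inp'[of "f q"] f that by (metis bij_betwE)
  ultimately show "transducer_iso (core n A) (core n A')"
    unfolding transducer_iso_def using f inp by (intro exI[of _ f]) auto
qed

section \<open>Existence of minimal transducers, and the groups in terms of local maps\<close>

text \<open>\<open>R\<close> collects the states whose map still has to write a dotted letter. By
  uniform continuity this letter is written after boundedly many input letters, which excludes
  cycles in \<open>R\<close>; synchronization bounds the number of states.\<close>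

lemma min_dot_rep_ex:
  assumes n: "2 \<le> n" and r: "1 \<le> r"
    and h: "inj_on h (cantor_dot n r)" "h ` cantor_dot n r \<subseteq> cantor_dot n r" "ucont (cantor_dot n r) h"
    and k: "lsync n r h k"
  shows "\<exists>A :: nat transducer. min_dot_rep n r h A \<and> finite (states A)"
proof -
  let ?C = "cantor_dot n r"
  let ?h = "restrict h ?C"
  have "pmap n r (?C, ?h)"
    using h ucont_cong[of ?C h ?h] by (simp add: pmap_def inj_on_def)
  then obtain T d q0 where T: "canonical n r T d q0" and d0: "d q0 = (?C, ?h)"
    by (rule canonical_ex[OF n])
  interpret canonical n r T d q0 by fact
  note z = cantor_two(1)[OF n]
  have rdw: "w \<in> pluswords n r" if "can_read T w q0" "w \<noteq> []" for w
  proof -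
    have "wtrans T w q0 \<in> states T" "fst (d (wtrans T w q0)) = cantor n"
      using wtrans_wout(1)[OF q0 that] wtrans_states[OF q0 that(1)] by auto
    then have "conc w (\<lambda>_. Let 0) \<in> ?C"
      using runs_conc[of w "\<lambda>_. Let 0" T q0] runs_eq[OF q0] runs_eq that(1) z d0 by simp
    then show ?thesis using cantor_dot_conc_iff that(2) by blast
  qed
  have rd: "can_read T w q0" "w \<noteq> []" if "w \<in> pluswords n r" for w
    using that pluswords_conc[OF that z] runs_eq[OF q0] d0 runs_conc[of w "\<lambda>_. Let 0" T q0] by auto
  have dw: "d (wtrans T w q0) = (cantor n, loc n h w)" if "w \<in> pluswords n r" for w
    using wtrans_wout(1)[OF q0 rd[OF that]] loc_cong[of n ?h w h] pluswords_conc[OF that] d0 by simp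
  have wq: "\<exists>w\<in>pluswords n r. q = wtrans T w q0" if "q \<in> states T" "q \<noteq> q0" for q
    using reach[OF that(1)] rdw that(2) by (metis wtrans_Nil)
  have fstq: "fst (d q) = cantor n" if "q \<in> states T" "q \<noteq> q0" for q
    using wq[OF that] dw by auto
  have inp_q: "inp T q = (if q = q0 then dots r else X n)" if "q \<in> states T" for q
    using inp[OF that] fstq[OF that] d0 cantor_neq_cantor_dot[OF n, of r] by (auto simp: letters_def)
  have tr: "trans T i q \<in> states T - {q0}" if "q \<in> states T" "i \<in> inp T q" for q i
    using step[OF that] d0 cantor_neq_cantor_dot[OF n, of r] by (auto simp: step_state_def)
  define R where "R = {q \<in> states T. snd (d q) ` fst (d q) \<subseteq> ?C}"
  define S where "S = {q \<in> states T. q \<noteq> q0 \<and> snd (d q) ` cantor n \<subseteq> cantor n}"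
  have stp: "snd (d q) (conc [i] x) = conc (out T i q) (snd (d (trans T i q)) x)" "conc [i] x \<in> fst (d q)"
    if "q \<in> states T" "i \<in> inp T q" "x \<in> cantor n" for q i x
    using wtrans_wout(4)[OF that(1), of "[i]" x] letter_runs[OF that(1,2)] runs_eq[OF that(1)] that by auto
  have tR: "(out T i q = [] \<and> trans T i q \<in> R) \<or> (out T i q \<in> pluswords n r \<and> trans T i q \<in> S)"
    if q: "q \<in> R" and i: "i \<in> inp T q" for q i
  proof -
    have qs: "q \<in> states T" using q by (simp add: R_def)
    note t = tr[OF qs i]
    have o: "conc (out T i q) (snd (d (trans T i q)) x) \<in> ?C" if "x \<in> cantor n" for x
      using stp[OF qs i that] q by (auto simp: R_def)
    show ?thesis
    proof (cases "out T i q = []")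
      case True
      then show ?thesis using o t fstq by (auto simp: R_def)
    next
      case False
      have p: "out T i q \<in> pluswords n r \<and> snd (d (trans T i q)) x \<in> cantor n" if "x \<in> cantor n" for x
        using o[OF that] cantor_dot_conc_iff[OF False] by blast
      then show ?thesis using p[OF z] t by (auto simp: S_def)
    qed
  qed
  have tS: "out T i q \<in> lists (X n) \<and> trans T i q \<in> S" if q: "q \<in> S" and i: "i \<in> inp T q" for q i
  proof -
    have qs: "q \<in> states T" "q \<noteq> q0" using q by (simp_all add: S_def)
    have p: "out T i q \<in> lists (X n) \<and> snd (d (trans T i q)) x \<in> cantor n" if "x \<in> cantor n" for x
    proof -
      have "snd (d q) (conc [i] x) \<in> cantor n"
        using stp(2)[OF qs(1) i that] q unfolding fstq[OF qs] S_def by blast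
      then show ?thesis unfolding stp(1)[OF qs(1) i that] by (simp only: cantor_conc_iff)
    qed
    then show ?thesis using p[OF z] tr[OF qs(1) i] by (auto simp: S_def)
  qed
  have q0R: "q0 \<in> R" using q0 d0 h(2) by (auto simp: R_def)
  have RSw: "wtrans T w q0 \<in> R \<union> S" if "can_read T w q0" for w
    using that
  proof (induction w rule: rev_induct)
    case (snoc i w)
    then show ?case using tR[of "wtrans T w q0" i] tS[of "wtrans T w q0" i] by auto
  qed (use q0R in simp)
  have RS: "states T = R \<union> S"
  proof
    show "states T \<subseteq> R \<union> S"
      using reach RSw by blast
    show "R \<union> S \<subseteq> states T"
      by (auto simp: R_def S_def)
  qed
  have disj: "R \<inter> S = {}"
  proof (rule ccontr)
    assume "R \<inter> S \<noteq> {}"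
    then obtain q where q: "q \<in> R" "q \<in> S" by blast
    then have "fst (d q) = cantor n" by (intro fstq) (simp_all add: S_def)
    then have "snd (d q) (\<lambda>_. Let 0) \<in> ?C" "snd (d q) (\<lambda>_. Let 0) \<in> cantor n"
      using q z unfolding R_def S_def by blast+
    then show False using cantor_dot_cantor_disjoint by blast
  qed
  have fin: "finite (states T)"
  proof (rule finite_subset)
    \<comment> \<open>A word longer than \<open>Suc k\<close> leads to the same state as a dotted
      letter followed by its last \<open>k\<close> letters.\<close>
    show "states T \<subseteq> insert q0 ((\<lambda>w. wtrans T w q0) ` {w \<in> pluswords n r. length w \<le> Suc k})"
    proof
      fix q assume q: "q \<in> states T"
      show "q \<in> insert q0 ((\<lambda>w. wtrans T w q0) ` {w \<in> pluswords n r. length w \<le> Suc k})"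
      proof (cases "q = q0")
        case False
        then obtain w where w: "w \<in> pluswords n r" "q = wtrans T w q0" using wq q by blast
        show ?thesis
        proof (cases "length w \<le> Suc k")
          case False
          then have kl: "k < length w" by simp
          obtain u v where uv: "w = u @ v" "u \<in> pluswords n r" "v \<in> lists (X n)" "length v = k"
            using pluswords_split[OF w(1) kl] .
          let ?w = "[Dot 0] @ v"
          have w': "[Dot 0] \<in> pluswords n r" "?w \<in> pluswords n r" using uv r by auto
          then have "d (wtrans T ?w q0) = d (wtrans T w q0)"
            using k uv w(1) dw[OF w'(2)] dw[OF w(1)] unfolding lsync_def by metis
          then have "wtrans T ?w q0 = q"
            using inj wtrans_states[OF q0 rd(1)] w' w unfolding inj_on_def by metis
          moreover have "?w \<in> {w \<in> pluswords n r. length w \<le> Suc k}"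
            using w'(2) uv(4) by simp
          ultimately show ?thesis by blast
        qed (use w in blast)
      qed simp
    qed
  qed (use finite_pluswords_le in simp)
  \<comment> \<open>One output letter suffices: once it is common to the image of a whole cone, the
    dotted letter has been written.\<close>
  obtain K where K: "\<And>x y k. \<lbrakk>x \<in> ?C; y \<in> ?C; K \<le> k; pre k x = pre k y\<rbrakk> \<Longrightarrow> pre 1 (h x) = pre 1 (h y)"
    using h(3) by (rule ucontD[where m = 1]) blast
  have short: "length w < K" if w: "w \<in> pluswords n r" and "wtrans T w q0 \<in> R" for w
  proof (rule ccontr)
    assume "\<not> length w < K"
    then have l: "K \<le> length w" by simp
    note W = wtrans_wout[OF q0 rd[OF w]]
    have "1 \<le> length (wout T w q0)"
      unfolding W(2) length_strip_pre[OF n W(3)]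
    proof (intro ballI)
      fix x y assume xy: "x \<in> cantor n" "y \<in> cantor n"
      show "pre 1 (snd (d q0) (conc w x)) = pre 1 (snd (d q0) (conc w y))"
        using K[OF pluswords_conc[OF w xy(1)] pluswords_conc[OF w xy(2)] l] xy pluswords_conc[OF w] d0 by simp
    qed
    moreover have "conc (wout T w q0) (snd (d (wtrans T w q0)) (\<lambda>_. Let 0)) \<in> ?C"
      using W(4)[OF z] d0 h(2) pluswords_conc[OF w z] by auto
    ultimately have "snd (d (wtrans T w q0)) (\<lambda>_. Let 0) \<in> cantor n"
      using cantor_dot_conc_iff[of "wout T w q0"] by fastforce
    moreover have "snd (d (wtrans T w q0)) (\<lambda>_. Let 0) \<in> ?C"
      using that(2) dw[OF w] z by (auto simp: R_def)
    ultimately show False using cantor_dot_cantor_disjoint by blast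
  qed
  have cyc: "wtrans T w q \<noteq> q" if q: "q \<in> R" and w: "w \<noteq> []" "can_read T w q" for q w
  proof
    assume e: "wtrans T w q = q"
    obtain u where u: "can_read T u q0" "wtrans T u q0 = q" using reach[of q] q unfolding R_def by blast
    \<comment> \<open>Running round the cycle produces words of any length that lead into
      \<open>R\<close>, against the bound in \<open>short\<close>.\<close>
    let ?u = "\<lambda>j. u @ concat (replicate j w)"
    have *: "can_read T (concat (replicate j w)) q \<and> wtrans T (concat (replicate j w)) q = q \<and>
        j \<le> length (concat (replicate j w))" for j
    proof (induction j)
      case (Suc j)
      then show ?case using w e by (cases w) auto
    qed simp
    have "can_read T (?u (Suc K)) q0" "?u (Suc K) \<noteq> []" "wtrans T (?u (Suc K)) q0 = q"
      using *[of "Suc K"] u w by auto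
    moreover have "K \<le> length (?u (Suc K))" using *[of "Suc K"] by simp
    ultimately show False using short[OF rdw] q by (metis linorder_not_less)
  qed
  have "dot_transducer n r T q0 R S"
    unfolding dot_transducer_def
  proof (intro conjI ballI allI impI)
    show "states T = R \<union> S" "R \<inter> S = {}" "q0 \<in> R" by fact+
    show "finite R" using fin RS by simp
    fix q assume "q \<in> states T"
    then show "inp T q = (if q = q0 then dots r else X n)" by (rule inp_q)
    fix i assume "i \<in> inp T q"
    then show "trans T i q \<in> states T - {q0}" using tr \<open>q \<in> states T\<close> by blast
  next
    fix q i assume qi: "q \<in> R" "i \<in> inp T q"
    show "out T i q = []" if "trans T i q \<in> R" using tR[OF qi] that disj by blast
    show "out T i q \<in> pluswords n r" if "trans T i q \<in> S" using tR[OF qi] that disj by blast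
  next
    fix q i assume qi: "q \<in> S" "i \<in> inp T q"
    then show "trans T i q \<in> S" "out T i q \<in> lists (X n)" using tS by blast+
  next
    fix q x assume "q \<in> S" "x \<in> cantor n"
    then show "inf_output T q x" using iout_eq(1)[of q x] fstq[of q] by (auto simp: S_def)
  next
    fix q w assume "q \<in> R" "w \<noteq> [] \<and> can_read T w q"
    then show "wtrans T w q \<noteq> q" using cyc by blast
  qed
  moreover have "\<forall>x\<in>?C. iout T q0 x = h x"
    using iout_eq(2)[OF q0] d0 by simp
  ultimately have "min_dot_rep n r h T"
    unfolding min_dot_rep_def using minimal by blast
  then show ?thesis using fin by blast
qed

lemma fin_sync_min_iff:
  assumes "2 \<le> n" "1 \<le> r"
    and h: "inj_on h (cantor_dot n r)" "h ` cantor_dot n r \<subseteq> cantor_dot n r" "ucont (cantor_dot n r) h"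
  shows "fin_sync_min n r h \<longleftrightarrow> (\<exists>k. lsync n r h k)"
proof
  assume "fin_sync_min n r h"
  then obtain A :: "nat transducer" and k where A: "min_dot_rep n r h A" "sync_level A k"
    unfolding fin_sync_min_def synchronizing_def by blast
  obtain q0 R S where "dot_rep n r h A q0 R S" using dot_repI[OF A(1) assms(1,2) h(1)] .
  from dot_rep.sync_level_lsync[OF this A(2)] show "\<exists>k. lsync n r h k" ..
next
  assume "\<exists>k. lsync n r h k"
  then obtain k where k: "lsync n r h k" ..
  obtain A :: "nat transducer" where A: "min_dot_rep n r h A" "finite (states A)"
    using min_dot_rep_ex[OF assms k] by blast
  obtain q0 R S where "dot_rep n r h A q0 R S" using dot_repI[OF A(1) assms(1,2) h(1)] .
  from dot_rep.lsync_sync_level[OF this k] show "fin_sync_min n r h"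
    using A unfolding fin_sync_min_def synchronizing_def by blast
qed

text \<open>Membership becomes a statement about the map and its local maps, so that elements can be
  constructed without building transducers for them.\<close>

lemma B_iff:
  assumes "2 \<le> n" "1 \<le> r"
  shows "h \<in> B n r \<longleftrightarrow> h \<in> extensional (cantor_dot n r) \<and> bij_betw h (cantor_dot n r) (cantor_dot n r) \<and>
    ucont (cantor_dot n r) h \<and> ucont (cantor_dot n r) (inv_into (cantor_dot n r) h) \<and>
    (\<exists>k. lsync n r h k) \<and> (\<exists>k. lsync n r (inv_into (cantor_dot n r) h) k)"
proof -
  let ?C = "cantor_dot n r"
  have "fin_sync_min n r h \<longleftrightarrow> (\<exists>k. lsync n r h k)"
    if "bij_betw h ?C ?C" "ucont ?C h" for h
    using fin_sync_min_iff[OF assms] that unfolding bij_betw_def by simp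
  then show ?thesis
    unfolding B_def homeomorphic_map_cantor_dot_top_iff using bij_betw_inv_into by blast
qed

lemma Core_rep:
  assumes "2 \<le> n" "1 \<le> r" "h \<in> B n r"
  obtains A :: "nat transducer" and q0 R S where "dot_rep n r h A q0 R S" "Core n r h = iso_class (core n A)"
proof -
  define A where "A = (SOME A :: nat transducer. min_dot_rep n r h A)"
  have "\<exists>A :: nat transducer. min_dot_rep n r h A"
    using assms(3) unfolding B_def fin_sync_min_def by blast
  then have "min_dot_rep n r h A"
    unfolding A_def by (rule someI_ex)
  moreover have "inj_on h (cantor_dot n r)"
    using assms(3) unfolding B_iff[OF assms(1,2)] bij_betw_def by blast
  ultimately obtain q0 R S where "dot_rep n r h A q0 R S"
    using dot_repI assms(1,2) by blast
  then show thesis using that unfolding Core_def A_def by blast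
qed

lemma Core_eqI:
  assumes "2 \<le> n" "1 \<le> r" "h \<in> B n r" "1 \<le> r'" "g \<in> B n r'"
    and "lsync n r h k" "lsync n r' g k'" "long_locs n r h k = long_locs n r' g k'"
  shows "Core n r h = Core n r' g"
proof -
  obtain A :: "nat transducer" and q0 R S where A: "dot_rep n r h A q0 R S" "Core n r h = iso_class (core n A)"
    using Core_rep[OF assms(1-3)] .
  obtain A' :: "nat transducer" and q0' R' S' where A': "dot_rep n r' g A' q0' R' S'" "Core n r' g = iso_class (core n A')"
    using Core_rep[OF assms(1,4,5)] .
  show ?thesis unfolding A(2) A'(2) by (rule core_iso[OF A(1) A'(1) assms(6-8)])
qed

text \<open>The length bound \<open>l\<close> is free because the same local maps occur at
  arbitrarily long words. A large \<open>l\<close> ensures that the dotted letter of the output is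
  written before the state is reached.\<close>

lemma Core_iout:
  assumes "2 \<le> n" "1 \<le> r" "h \<in> B n r"
  shows "\<exists>U\<in>Core n r h. states U \<noteq> {}"
    and "\<lbrakk>U \<in> Core n r h; p \<in> states U\<rbrakk> \<Longrightarrow>
      \<exists>w\<in>pluswords n r. l < length w \<and> (\<forall>x\<in>cantor n. iout U p x = loc n h w x)"
proof -
  obtain A :: "nat transducer" and q0 R S where A: "dot_rep n r h A q0 R S" and C: "Core n r h = iso_class (core n A)"
    using Core_rep[OF assms] .
  interpret dot_rep n r h A q0 R S by fact
  obtain k where k: "lsync n r h k" using assms(3) unfolding B_iff[OF assms(1,2)] by blast
  note v = states_core_iout[OF k]
  have "[Dot 0] @ replicate k (Let 0) \<in> pluswords n r"
    using assms(1,2) by (intro pluswords_appendI) auto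
  then have "long_locs n r h k \<noteq> {}"
    unfolding long_locs_def by fastforce
  then show "\<exists>U\<in>Core n r h. states U \<noteq> {}"
    unfolding C using mem_iso_class[of "core n A"] v(1) by (auto simp: bij_betw_def)
  assume U: "U \<in> Core n r h" "p \<in> states U"
  have inpC: "inp (core n A) q = X n" if "q \<in> states (core n A)" for q
    using that v(2) inpX by auto
  have trC: "trans (core n A) i q \<in> states (core n A)" if "q \<in> states (core n A)" "i \<in> X n" for q i
    using core_trans[of A q n i] that trans_states inpC[OF that(1)] v(2) by auto
  have "\<exists>q\<in>states (core n A). \<forall>x\<in>cantor n. iout U p x = iout (core n A) q x"
    by (rule iso_class_iout[OF inpC trC]) (use U C in simp_all)
  then obtain q where q: "q \<in> states (core n A)" "\<forall>x\<in>cantor n. iout U p x = iout A q x"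
    by auto
  have "restrict (iout A q) (cantor n) \<in> long_locs n r h (max k l)"
    using bij_betwE[OF v(1)] q(1) long_locs_eq[OF assms(1) k, of "max k l"] by auto
  then obtain w where w: "w \<in> pluswords n r" "max k l < length w" "restrict (iout A q) (cantor n) = loc n h w"
    unfolding long_locs_def by blast
  then have "iout U p x = loc n h w x" if "x \<in> cantor n" for x
    using q(2) that by (metis restrict_apply')
  then show "\<exists>w\<in>pluswords n r. l < length w \<and> (\<forall>x\<in>cantor n. iout U p x = loc n h w x)"
    using w by auto
qed

section \<open>Prefix replacement maps\<close>

text \<open>Lists rather than sets: \<open>prefix_map\<close> pairs two partitions by position, and
  the cyclic order is expressed by positions as well.\<close>

definition cone_partition :: "nat \<Rightarrow> word list \<Rightarrow> infword set \<Rightarrow> bool" where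
  "cone_partition n us U \<longleftrightarrow> distinct us \<and>
     (\<forall>u\<in>set us. \<forall>v\<in>set us. u \<noteq> v \<longrightarrow> cone n u \<inter> cone n v = {}) \<and> U = (\<Union>u\<in>set us. cone n u)"

definition prefix_map :: "nat \<Rightarrow> word list \<Rightarrow> word list \<Rightarrow> infword \<Rightarrow> infword" where
  "prefix_map n us cs x =
     (let i = THE i. i < length us \<and> x \<in> cone n (us ! i) in conc (cs ! i) (sdrop (length (us ! i)) x))"

lemma cone_partition_nth_eq:
  assumes "cone_partition n us U" "i < length us" "j < length us" "x \<in> cone n (us ! i)" "x \<in> cone n (us ! j)"
  shows "i = j"
  using assms nth_eq_iff_index_eq unfolding cone_partition_def by (metis disjoint_iff nth_mem)

lemma prefix_map_conc:
  assumes "cone_partition n us U" "i < length us" "x \<in> cantor n"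
  shows "prefix_map n us cs (conc (us ! i) x) = conc (cs ! i) x"
proof -
  have "(THE j. j < length us \<and> conc (us ! i) x \<in> cone n (us ! j)) = i"
    using assms cone_partition_nth_eq[OF assms(1)] mem_cone_conc[OF assms(3)] by (intro the_equality) blast+
  then show ?thesis by (simp add: prefix_map_def)
qed

lemma cone_partition_cases:
  assumes "cone_partition n us U" "x \<in> U"
  obtains i y where "i < length us" "y \<in> cantor n" "x = conc (us ! i) y"
proof -
  obtain u where u: "u \<in> set us" "x \<in> cone n u"
    using assms unfolding cone_partition_def by blast
  obtain i where "i < length us" "u = us ! i" using u(1) by (metis in_set_conv_nth)
  moreover obtain y where "y \<in> cantor n" "x = conc u y" using u(2) by (auto simp: cone_def)
  ultimately show thesis using that[of i y] by simp
qed

lemma cone_partition_mem: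
  "cone_partition n us U \<Longrightarrow> i < length us \<Longrightarrow> y \<in> cantor n \<Longrightarrow> conc (us ! i) y \<in> U"
  using mem_cone_conc[of y n "us ! i"] nth_mem[of i us] unfolding cone_partition_def by blast

lemma prefix_map_mem:
  assumes "cone_partition n us U" "cone_partition n cs V" "length us = length cs" "x \<in> U"
  shows "prefix_map n us cs x \<in> V" "prefix_map n cs us (prefix_map n us cs x) = x"
proof -
  obtain i y where "i < length us" "y \<in> cantor n" "x = conc (us ! i) y"
    using cone_partition_cases[OF assms(1,4)] .
  then show "prefix_map n us cs x \<in> V" "prefix_map n cs us (prefix_map n us cs x) = x"
    using prefix_map_conc[OF assms(1)] prefix_map_conc[OF assms(2)] cone_partition_mem[OF assms(2)] assms(3) by auto
qed

lemma bij_betw_prefix_map: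
  assumes "cone_partition n us U" "cone_partition n cs V" "length us = length cs"
  shows "bij_betw (prefix_map n us cs) U V"
  by (rule bij_betw_byWitness[of U "prefix_map n cs us"])
    (use prefix_map_mem[OF assms] prefix_map_mem[OF assms(2,1) assms(3)[symmetric]] in auto)

lemma cone_partition_length_le: "u \<in> set us \<Longrightarrow> length u \<le> sum_list (map length us)"
  by (simp add: member_le_sum_list)

lemma cone_partition_same_prefix:
  assumes "cone_partition n us U" "i < length us" "j < length us" "a \<in> cantor n" "b \<in> cantor n"
    "pre m (conc (us ! i) a) = pre m (conc (us ! j) b)" "length (us ! i) \<le> m" "length (us ! j) \<le> m"
  shows "i = j"
proof -
  have aux: "i = j"
    if ij: "i < length us" "j < length us" and ab: "a \<in> cantor n" "b \<in> cantor n"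
      and p: "pre m (conc (us ! i) a) = pre m (conc (us ! j) b)" and l: "length (us ! i) \<le> m"
        "length (us ! j) \<le> length (us ! i)" for i j a b
  proof -
    have "pre (length (us ! i)) (conc (us ! j) b) = us ! i"
      using pre_mono[OF p l(1)] by simp
    then have c: "conc (us ! j) b = conc (us ! i) (sdrop (length (us ! i)) (conc (us ! j) b))"
      by (rule pre_eq_append_conc)
    obtain t where t: "us ! i = us ! j @ t" "b = conc t (sdrop (length (us ! i)) (conc (us ! j) b))"
      using conc_eq_conc_le[OF c l(2)] .
    then have "t \<in> lists (X n)" using ab(2) cantor_conc_iff by metis
    then have "conc (us ! i) a \<in> cone n (us ! j)"
      using t(1) ab(1) by (simp add: mem_cone_conc cantor_conc_iff)
    then show ?thesis
      using cone_partition_nth_eq[OF assms(1) ij] mem_cone_conc[OF ab(1)] by blast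
  qed
  show ?thesis
    using aux[OF assms(2-7)] aux[OF assms(3,2,5,4) assms(6)[symmetric] assms(8)] by (metis nle_le)
qed

lemma ucont_prefix_map:
  assumes "cone_partition n us U"
  shows "ucont U (prefix_map n us cs)"
  unfolding ucont_def
proof
  fix m
  let ?E = "sum_list (map length us)"
  show "\<exists>K. \<forall>x\<in>U. \<forall>y\<in>U. pre K x = pre K y \<longrightarrow> pre m (prefix_map n us cs x) = pre m (prefix_map n us cs y)"
  \<comment> \<open>The sum of all lengths bounds each of them, so that many letters identify the
    cone; \<open>m\<close> more letters determine \<open>m\<close> letters behind its
    prefix.\<close>
  proof (intro exI[of _ "?E + m"] ballI impI)
    fix x y assume xy: "x \<in> U" "y \<in> U" "pre (?E + m) x = pre (?E + m) y"
    obtain i a where i: "i < length us" "a \<in> cantor n" "x = conc (us ! i) a"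
      using cone_partition_cases[OF assms xy(1)] .
    obtain j b where j: "j < length us" "b \<in> cantor n" "y = conc (us ! j) b"
      using cone_partition_cases[OF assms xy(2)] .
    have l: "length (us ! i) \<le> ?E" "length (us ! j) \<le> ?E"
      using i j by (simp_all add: cone_partition_length_le)
    then have ij: "i = j"
      using cone_partition_same_prefix[OF assms i(1) j(1) i(2) j(2), of "?E + m"] xy(3) i(3) j(3) by simp
    have "pre (length (us ! i) + m) x = pre (length (us ! i) + m) y"
      using l by (intro pre_mono[OF xy(3)]) simp
    then have "pre m a = pre m b"
      by (simp add: i(3) j(3) ij pre_plus_conc)
    then have "pre (length (cs ! i) + m) (conc (cs ! i) a) = pre (length (cs ! i) + m) (conc (cs ! i) b)"
      by (simp add: pre_plus_conc)
    then have "pre m (conc (cs ! i) a) = pre m (conc (cs ! i) b)"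
      by (rule pre_mono) simp
    then show "pre m (prefix_map n us cs x) = pre m (prefix_map n us cs y)"
      using prefix_map_conc[OF assms] i j ij by simp
  qed
qed

text \<open>Along a long word each of the three maps acts on a single cone. The prefix replaced in
  the input becomes part of \<open>w'\<close>, the one replaced in the output is removed by
  stripping, and the last \<open>k\<close> letters of the input survive.\<close>

lemma prefix_conj_loc:
  assumes n: "2 \<le> n"
    and h: "inj_on h (cantor_dot n r)" "ucont (cantor_dot n r) h" "lsync n r h k"
    and ds: "cone_partition n ds (cantor_dot n r')" and vs: "cone_partition n vs W" "length ds = length vs"
    and W: "W \<subseteq> cantor_dot n r" "h ` W \<subseteq> U" "U \<subseteq> cantor_dot n r"
    and us: "cone_partition n us U"
    and g: "\<And>x. x \<in> cantor_dot n r' \<Longrightarrow> g x = prefix_map n us cs (h (prefix_map n ds vs x))"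
  obtains D where "\<And>w u v. \<lbrakk>w \<in> pluswords n r'; u \<in> lists (X n); v \<in> lists (X n); length u = D; length v = k\<rbrakk> \<Longrightarrow>
    \<exists>w'\<in>pluswords n r. loc n g (w @ u @ v) = loc n h (w' @ v)"
proof -
  let ?E = "sum_list (map length us)"
  obtain K where K: "\<And>x y k. \<lbrakk>x \<in> cantor_dot n r; y \<in> cantor_dot n r; K \<le> k; pre k x = pre k y\<rbrakk> \<Longrightarrow>
      pre ?E (h x) = pre ?E (h y)"
    using h(2) by (rule ucontD[where m = ?E]) blast
  \<comment> \<open>The first summand carries the word beyond the prefixes in \<open>ds\<close>;
    \<open>K\<close> further letters make \<open>h\<close> fix \<open>?E\<close> letters of its
    value, enough to determine the cone of \<open>us\<close>.\<close>
  let ?D = "sum_list (map length ds) + K"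
  have "\<exists>w'\<in>pluswords n r. loc n g (w @ u @ v) = loc n h (w' @ v)"
    if w: "w \<in> pluswords n r'" and u: "u \<in> lists (X n)" and v: "v \<in> lists (X n)" and l: "length u = ?D" for w u v
  proof -
    note z = cantor_two(1)[OF n]
    have wu: "w @ u \<in> pluswords n r'" using w u by (rule pluswords_appendI)
    obtain i y where i: "i < length ds" "y \<in> cantor n" "conc (w @ u) (\<lambda>_. Let 0) = conc (ds ! i) y"
      using cone_partition_cases[OF ds pluswords_conc[OF wu z]] by metis
    have li: "length (ds ! i) \<le> sum_list (map length ds)"
      using i(1) by (simp add: cone_partition_length_le)
    then have "length (ds ! i) \<le> length (w @ u)" using l by simp
    then obtain t where t: "w @ u = ds ! i @ t" "y = conc t (\<lambda>_. Let 0)"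
      using conc_eq_conc_le[OF i(3)[symmetric]] by metis
    have tX: "t \<in> lists (X n)" using t(2) i(2) by (simp add: cantor_conc_iff)
    \<comment> \<open>The first letter of \<open>w\<close> comes on top of \<open>?D\<close>, so
      \<open>t\<close> is nonempty, and hence so is \<open>?w\<close> even if \<open>vs ! i\<close>
      is empty.\<close>
    have "w \<noteq> []" using w by auto
    moreover have "length w + length u = length (ds ! i) + length t"
      using arg_cong[OF t(1), of length] by simp
    ultimately have lt: "K \<le> length t" "t \<noteq> []" using li l by (cases w; auto)+
    let ?w = "vs ! i @ t"
    have Wm: "conc (?w @ v) x \<in> W" if "x \<in> cantor n" for x
      using cone_partition_mem[OF vs(1), of i "conc (t @ v) x"] i(1) vs(2) that tX v by (simp add: cantor_conc_iff)
    have wp: "?w \<in> pluswords n r"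
      using Wm[OF z] W(1) cantor_dot_conc_iff[of "?w @ v" "\<lambda>_. Let 0" n r] lt(2) pluswords_append_iff[of ?w v n r] by auto
    have hU: "h (conc (?w @ v) x) \<in> U" if "x \<in> cantor n" for x
      using Wm[OF that] W(2) by blast
    obtain j b where j: "j < length us" "b \<in> cantor n" "h (conc (?w @ v) (\<lambda>_. Let 0)) = conc (us ! j) b"
      using cone_partition_cases[OF us hU[OF z]] .
    have uj: "us ! j \<noteq> []"
    proof
      assume "us ! j = []"
      then have "b \<in> cantor_dot n r" using j(3) hU[OF z] W(3) by auto
      then show False using j(2) cantor_dot_cantor_disjoint by blast
    qed
    let ?y = "\<lambda>x. sdrop (length (us ! j)) (h (conc (?w @ v) x))"
    have y: "h (conc (?w @ v) x) = conc (us ! j) (?y x)" if "x \<in> cantor n" for x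
    proof -
      have "pre (length ?w) (conc (?w @ v) x) = pre (length ?w) (conc (?w @ v) (\<lambda>_. Let 0))"
        by (simp add: pre_conc del: conc_append)
      then have "pre ?E (h (conc (?w @ v) x)) = pre ?E (h (conc (?w @ v) (\<lambda>_. Let 0)))"
        using Wm[OF that] Wm[OF z] W(1) lt(1) by (intro K[where k = "length ?w"]) auto
      then have "pre (length (us ! j)) (h (conc (?w @ v) x)) = pre (length (us ! j)) (conc (us ! j) b)"
        unfolding j(3)[symmetric] using j(1) by (elim pre_mono) (simp add: cone_partition_length_le)
      then show ?thesis by (intro pre_eq_append_conc) simp
    qed
    have yc: "?y x \<in> cantor n" if "x \<in> cantor n" for x
      using y[OF that] hU[OF that] W(3) cantor_dot_conc_iff[OF uj] by (metis subsetD)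
    have "inj_on ?y (cantor n)"
    proof (rule inj_onI)
      fix x x' assume x: "x \<in> cantor n" "x' \<in> cantor n" "?y x = ?y x'"
      then have "h (conc (?w @ v) x) = h (conc (?w @ v) x')" using y by metis
      then have "conc (?w @ v) x = conc (?w @ v) x'"
        using inj_onD[OF h(1)] Wm x W(1) by blast
      then show "x = x'" by (simp del: conc_append)
    qed
    moreover have "g (conc (w @ u @ v) x) = conc (cs ! j) (?y x)" if "x \<in> cantor n" for x
    proof -
      have e: "conc (w @ u @ v) x = conc (ds ! i) (conc (t @ v) x)"
        using t(1) by (metis append.assoc conc_append)
      have tv: "conc (t @ v) x \<in> cantor n" using that tX v by (simp add: cantor_conc_iff)
      have "g (conc (w @ u @ v) x) = prefix_map n us cs (h (prefix_map n ds vs (conc (w @ u @ v) x)))"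
        by (rule g) (use w u v that in \<open>intro pluswords_conc pluswords_appendI; auto\<close>)
      also have "prefix_map n ds vs (conc (w @ u @ v) x) = conc (?w @ v) x"
        unfolding e using prefix_map_conc[OF ds i(1) tv] by simp
      also have "prefix_map n us cs (h (conc (?w @ v) x)) = conc (cs ! j) (?y x)"
        using prefix_map_conc[OF us j(1) yc[OF that], of cs] y[OF that] by simp
      finally show ?thesis .
    qed
    ultimately have "loc n g (w @ u @ v) = loc n h (?w @ v)"
      using y by (intro loc_eqI[OF n])
    then show ?thesis using wp by blast
  qed
  then show thesis using that[of ?D] by blast
qed

text \<open>The inverse of \<open>g\<close> has the same form with the roles of the partitions
  exchanged, so \<open>prefix_conj_loc\<close> treats both. Every long local map of \<open>g\<close>
  is one of \<open>h\<close>; for the converse, synchronization of \<open>h\<close> allows the word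
  in front of the last \<open>k\<close> letters to be chosen freely.\<close>

lemma prefix_conj:
  assumes n: "2 \<le> n" and r: "1 \<le> r" "1 \<le> r'" and h: "h \<in> B n r"
    and ds: "cone_partition n ds (cantor_dot n r')" and vs: "cone_partition n vs W" "length ds = length vs"
    and W: "W \<subseteq> cantor_dot n r"
    and us: "cone_partition n us (h ` W)" and cs: "cone_partition n cs (cantor_dot n r')" "length us = length cs"
    and g: "g = (\<lambda>x\<in>cantor_dot n r'. prefix_map n us cs (h (prefix_map n ds vs x)))"
  shows "g \<in> B n r'" "Core n r' g = Core n r h"
proof -
  let ?C = "cantor_dot n r" and ?C' = "cantor_dot n r'"
  let ?h = "inv_into ?C h"
  let ?g = "\<lambda>x. prefix_map n us cs (h (prefix_map n ds vs x))"
  let ?f = "\<lambda>x. prefix_map n vs ds (?h (prefix_map n cs us x))"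
  have hB: "bij_betw h ?C ?C" "ucont ?C h" "ucont ?C ?h"
    using h unfolding B_iff[OF n r(1)] by blast+
  obtain k k' where k: "lsync n r h k" "lsync n r ?h k'"
    using h unfolding B_iff[OF n r(1)] by blast
  have hi: "inj_on h ?C" "inj_on ?h ?C"
    using hB(1) bij_betw_inv_into[OF hB(1)] by (auto simp: bij_betw_def)
  have U: "h ` W \<subseteq> ?C" using W hB(1) unfolding bij_betw_def by blast
  have hU: "?h ` h ` W = W" using W hi(1) by (simp add: inv_into_image_cancel)
  note pds = bij_betw_prefix_map[OF ds vs] and pus = bij_betw_prefix_map[OF us cs]
  have "bij_betw h W (h ` W)" using W hi(1) by (metis bij_betw_imageI inj_on_subset)
  then have bg: "bij_betw ?g ?C' ?C'"
    using bij_betw_trans[OF bij_betw_trans[OF pds] pus] by (simp add: comp_def)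
  have bgg: "bij_betw g ?C' ?C'"
    using bg by (rule iffD1[OF bij_betw_cong, rotated]) (simp add: g)
  have "ucont ?C' ?g"
    by (rule ucont_comp[OF ucont_comp[OF ucont_prefix_map[OF ds] hB(2)] ucont_prefix_map[OF us]])
      (use pds W in \<open>auto simp: bij_betw_def\<close>)
  then have ug: "ucont ?C' g"
    by (rule iffD1[OF ucont_cong, rotated]) (simp add: g)
  have fg: "inv_into ?C' g y = ?f y" if y: "y \<in> ?C'" for y
  proof -
    have 1: "prefix_map n cs us y \<in> h ` W" "prefix_map n us cs (prefix_map n cs us y) = y"
      using prefix_map_mem[OF cs(1) us cs(2)[symmetric] y] by auto
    then obtain w where w: "w \<in> W" "prefix_map n cs us y = h w" by blast
    then have hw: "?h (prefix_map n cs us y) = w" using hi(1) W by (simp add: subset_iff)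
    have 2: "prefix_map n vs ds w \<in> ?C'" "prefix_map n ds vs (prefix_map n vs ds w) = w"
      using prefix_map_mem[OF vs(1) ds vs(2)[symmetric] w(1)] by auto
    have "g (?f y) = y" "?f y \<in> ?C'" using 1 2 w hw by (simp_all add: g)
    then show ?thesis using bgg by (metis bij_betw_def inv_into_f_f)
  qed
  have pcs: "prefix_map n cs us ` ?C' = h ` W"
    using bij_betw_prefix_map[OF cs(1) us cs(2)[symmetric]] by (simp add: bij_betw_def)
  then have "(\<lambda>x. ?h (prefix_map n cs us x)) ` ?C' = W"
    using hU by (metis image_image)
  then have "ucont ?C' ?f"
    using pcs U by (intro ucont_comp[OF ucont_comp[OF ucont_prefix_map[OF cs(1)] hB(3)] ucont_prefix_map[OF vs(1)]]) simp_all
  then have uf: "ucont ?C' (inv_into ?C' g)"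
    by (rule iffD1[OF ucont_cong, rotated]) (simp add: fg)
  obtain D where D: "\<And>w u v. \<lbrakk>w \<in> pluswords n r'; u \<in> lists (X n); v \<in> lists (X n); length u = D; length v = k\<rbrakk> \<Longrightarrow>
      \<exists>w'\<in>pluswords n r. loc n g (w @ u @ v) = loc n h (w' @ v)"
    by (rule prefix_conj_loc[OF n hi(1) hB(2) k(1) ds vs W subset_refl U us, of g cs]) (simp add: g, blast)
  obtain D' where D': "\<And>w u v. \<lbrakk>w \<in> pluswords n r'; u \<in> lists (X n); v \<in> lists (X n); length u = D'; length v = k'\<rbrakk> \<Longrightarrow>
      \<exists>w'\<in>pluswords n r. loc n (inv_into ?C' g) (w @ u @ v) = loc n ?h (w' @ v)"
    by (rule prefix_conj_loc[OF n hi(2) hB(3) k(2) cs(1) us cs(2)[symmetric] U _ W vs(1), of "inv_into ?C' g" ds])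
      (simp add: hU, simp add: fg, blast)
  have sync: "lsync n r' f (D + k)"
    if D: "\<And>w u v. \<lbrakk>w \<in> pluswords n r'; u \<in> lists (X n); v \<in> lists (X n); length u = D; length v = k\<rbrakk> \<Longrightarrow>
      \<exists>w'\<in>pluswords n r. loc n f (w @ u @ v) = loc n h (w' @ v)" and k: "lsync n r h k" for f h D k
    unfolding lsync_def
  proof (intro ballI impI)
    fix w w' v assume w: "w \<in> pluswords n r'" "w' \<in> pluswords n r'" "v \<in> lists (X n)" "length v = D + k"
    have v: "take D v \<in> lists (X n)" "drop D v \<in> lists (X n)" "length (take D v) = D" "length (drop D v) = k"
      using w by (auto dest: in_set_takeD in_set_dropD)
    then show "loc n f (w @ v) = loc n f (w' @ v)"
      using D[OF w(1) v] D[OF w(2) v] k unfolding lsync_def by (metis append_take_drop_id)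
  qed
  have sg: "lsync n r' g (D + k)" by (rule sync[OF D k(1)])
  have sg': "lsync n r' (inv_into ?C' g) (D' + k')" by (rule sync[OF D' k(2)])
  have "g \<in> extensional ?C'" by (simp add: g)
  then show gB: "g \<in> B n r'"
    unfolding B_iff[OF n r(2)] using bgg ug uf sg sg' by blast
  show "Core n r' g = Core n r h"
  proof (rule Core_eqI[OF n r(2) gB r(1) h sg k(1)])
    show "long_locs n r' g (D + k) = long_locs n r h k"
    proof
      show "long_locs n r' g (D + k) \<subseteq> long_locs n r h k"
      proof
        fix f assume "f \<in> long_locs n r' g (D + k)"
        then obtain w where w: "w \<in> pluswords n r'" "D + k < length w" "f = loc n g w"
          unfolding long_locs_def by blast
        obtain u v where uv: "w = u @ v" "u \<in> pluswords n r'" "v \<in> lists (X n)" "length v = D + k"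
          using pluswords_split[OF w(1,2)] .
        have v: "take D v \<in> lists (X n)" "drop D v \<in> lists (X n)" "length (take D v) = D" "length (drop D v) = k"
          using uv by (auto dest: in_set_takeD in_set_dropD)
        obtain w' where w': "w' \<in> pluswords n r" "loc n g (u @ take D v @ drop D v) = loc n h (w' @ drop D v)"
          using D[OF uv(2) v] by blast
        moreover have "w' @ drop D v \<in> pluswords n r" "k < length (w' @ drop D v)"
          using w'(1) v by (auto intro: pluswords_appendI)
        ultimately show "f \<in> long_locs n r h k"
          using uv w(3) unfolding long_locs_def by auto
      qed
      show "long_locs n r h k \<subseteq> long_locs n r' g (D + k)"
      proof
        fix f assume "f \<in> long_locs n r h k"
        then obtain w where w: "w \<in> pluswords n r" "k < length w" "f = loc n h w"
          unfolding long_locs_def by blast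
        obtain u v where uv: "w = u @ v" "u \<in> pluswords n r" "v \<in> lists (X n)" "length v = k"
          using pluswords_split[OF w(1,2)] .
        let ?z = "replicate D (Let 0)"
        have z: "[Dot 0] \<in> pluswords n r'" "?z \<in> lists (X n)" "length ?z = D" using n r by auto
        obtain w' where w': "w' \<in> pluswords n r" "loc n g ([Dot 0] @ ?z @ v) = loc n h (w' @ v)"
          using D[OF z(1,2) uv(3) z(3) uv(4)] by blast
        then have "f = loc n g ([Dot 0] @ ?z @ v)"
          using k(1) uv w(3) unfolding lsync_def by metis
        moreover have "[Dot 0] @ ?z @ v \<in> pluswords n r'"
          using z uv(3) by (intro pluswords_appendI) auto
        ultimately show "f \<in> long_locs n r' g (D + k)"
          unfolding long_locs_def using uv(4) by fastforce
      qed
    qed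
  qed
qed

section \<open>The cyclic order\<close>

text \<open>On the circle obtained from \<open>simeq\<close> a cone is an arc; \<open>mn w\<close>
  and \<open>mx n w\<close> are its first and its last point.\<close>

definition mn :: "word \<Rightarrow> infword" where
  "mn w = conc w (\<lambda>_. Let 0)"

definition mx :: "nat \<Rightarrow> word \<Rightarrow> infword" where
  "mx n w = conc w (\<lambda>_. Let (n - 1))"

text \<open>\<open>simeq\<close> with an orientation: the last point of a cone is followed by the
  first point of the next one, and the final disjunct closes the circle.\<close>

definition nxt :: "nat \<Rightarrow> nat \<Rightarrow> infword \<Rightarrow> infword \<Rightarrow> bool" where
  "nxt n r x y \<longleftrightarrow>
     (\<exists>w\<in>pluswords n r. \<exists>i. 0 < i \<and> i < n \<and> x = mx n (w @ [Let (i - 1)]) \<and> y = mn (w @ [Let i]))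
   \<or> (\<exists>a. 0 < a \<and> a < r \<and> x = mx n [Dot (a - 1)] \<and> y = mn [Dot a])
   \<or> (x = mx n [Dot (r - 1)] \<and> y = mn [Dot 0])"

definition inner_nxt :: "nat \<Rightarrow> infword \<Rightarrow> infword \<Rightarrow> bool" where
  "inner_nxt n x y \<longleftrightarrow> (\<exists>w\<in>lists (X n). \<exists>i. 0 < i \<and> i < n \<and> x = mx n (w @ [Let (i - 1)]) \<and> y = mn (w @ [Let i]))"

lemma simeq_iff_nxt:
  assumes "2 \<le> n" "1 \<le> r"
  shows "simeq n r x y \<longleftrightarrow> x = y \<or> nxt n r x y \<or> nxt n r y x"
proof -
  have i: "0 < i \<and> i \<le> n - 1 \<longleftrightarrow> 0 < i \<and> i < n" "0 < a \<and> a \<le> r - 1 \<longleftrightarrow> 0 < a \<and> a < r" for i a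
    using assms by auto
  show ?thesis
    unfolding simeq_def nxt_def mn_def mx_def doubleton_eq_iff
    by (simp only: conj_assoc[symmetric] i) blast
qed

lemma conc_const:
  assumes "conc t (\<lambda>_. c) = (\<lambda>_. c)"
  shows "set t \<subseteq> {c}"
  using assms by (metis (no_types, lifting) conc_nth in_set_conv_nth singletonI subsetI)

text \<open>If the longer word is \<open>u @ t\<close>, then \<open>t\<close> consists of letters
  \<open>n - 1\<close> only; as the longer word does not end in that letter, \<open>t\<close> is
  empty.\<close>

lemma mx_inject:
  assumes "mx n u = mx n v" "u \<noteq> []" "v \<noteq> []" "last u \<noteq> Let (n - 1)" "last v \<noteq> Let (n - 1)"
  shows "u = v"
proof -
  have aux: "u = v" if e: "mx n u = mx n v" and l: "length u \<le> length v" and v: "last v \<noteq> Let (n - 1)" for u v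
  proof -
    obtain t where t: "v = u @ t" "(\<lambda>_. Let (n - 1)) = conc t (\<lambda>_. Let (n - 1))"
      using conc_eq_conc_le[OF e[unfolded mx_def] l] .
    have "t = []"
    proof (rule ccontr)
      assume "t \<noteq> []"
      then have "last t \<in> {Let (n - 1)}" using conc_const[OF t(2)[symmetric]] last_in_set by blast
      then show False using v t(1) \<open>t \<noteq> []\<close> by simp
    qed
    then show ?thesis using t(1) by simp
  qed
  show ?thesis using aux[of u v] aux[of v u] assms by (metis nle_le)
qed

lemma nxt_cases:
  assumes "nxt n r x y" "1 \<le> r"
  obtains w i where "w \<in> pluswords n r" "0 < i" "i < n" "x = mx n (w @ [Let (i - 1)])" "y = mn (w @ [Let i])"
    | a where "a < r" "x = mx n [Dot a]" "y = mn [Dot (Suc a mod r)]"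
proof -
  consider w i where "w \<in> pluswords n r" "0 < i" "i < n" "x = mx n (w @ [Let (i - 1)])" "y = mn (w @ [Let i])"
    | a where "0 < a" "a < r" "x = mx n [Dot (a - 1)]" "y = mn [Dot a]"
    | "x = mx n [Dot (r - 1)]" "y = mn [Dot 0]"
    using assms(1) unfolding nxt_def by blast
  then show thesis
  proof cases
    case 1
    then show ?thesis using that(1) by blast
  next
    case 2
    then show ?thesis using that(2)[of "a - 1"] by simp
  next
    case 3
    then show ?thesis using that(2)[of "r - 1"] assms(2) by simp
  qed
qed

lemma nxt_functional:
  assumes n: "2 \<le> n" "1 \<le> r" and "nxt n r x y" "nxt n r x z"
  shows "y = z"
  using assms(3,2)
proof (cases rule: nxt_cases)
  case (1 w i)
  note L = this
  from assms(4,2) show ?thesis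
  proof (cases rule: nxt_cases)
    case (1 v j)
    have "w @ [Let (i - 1)] = v @ [Let (j - 1)]"
      by (rule mx_inject[of n]) (use L 1 in auto)
    then have "w = v" "i = j" using L(2) 1(2) by auto
    then show ?thesis using L 1 by simp
  next
    case (2 a)
    have "w @ [Let (i - 1)] = [Dot a]"
      by (rule mx_inject[of n]) (use L 2 in auto)
    then show ?thesis by simp
  qed
next
  case (2 a)
  note L = this
  from assms(4,2) show ?thesis
  proof (cases rule: nxt_cases)
    case (1 w i)
    have "w @ [Let (i - 1)] = [Dot a]"
      by (rule mx_inject[of n]) (use L 1 in auto)
    then show ?thesis by simp
  next
    case (2 b)
    have "[Dot b] = [Dot a]"
      by (rule mx_inject[of n]) (use L 2 in auto)
    then show ?thesis using L 2 by simp
  qed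
qed

lemma nxt_inner:
  assumes "w \<in> pluswords n r" "inner_nxt n x y"
  shows "nxt n r (conc w x) (conc w y)"
proof -
  obtain v i where v: "v \<in> lists (X n)" "0 < i" "i < n" "x = mx n (v @ [Let (i - 1)])" "y = mn (v @ [Let i])"
    using assms(2) unfolding inner_nxt_def by blast
  then have "conc w x = mx n ((w @ v) @ [Let (i - 1)])" "conc w y = mn ((w @ v) @ [Let i])" "w @ v \<in> pluswords n r"
    using assms(1) by (auto simp: mx_def mn_def intro: pluswords_appendI)
  then show ?thesis using v unfolding nxt_def by blast
qed

text \<open>As \<open>x\<close> is not constantly \<open>n - 1\<close>, the word whose last letter
  is increased properly extends \<open>w\<close>, so the successor stays in the cone of
  \<open>w\<close>.\<close>

lemma nxt_conc:
  assumes "w \<in> pluswords n r" "x \<noteq> (\<lambda>_. Let (n - 1))" "nxt n r (conc w x) z" "1 \<le> r"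
  obtains y where "z = conc w y" "inner_nxt n x y"
proof -
  have ex: "\<exists>t. t \<noteq> [] \<and> u = w @ t \<and> x = mx n t" if e: "conc w x = mx n u" for u
  proof (cases "length u \<le> length w")
    case True
    obtain t where t: "w = u @ t" "(\<lambda>_. Let (n - 1)) = conc t x"
      using conc_eq_conc_le[OF e[unfolded mx_def, symmetric] True] .
    have "x = (\<lambda>_. Let (n - 1))"
      using arg_cong[OF t(2), of "sdrop (length t)"] by (simp add: sdrop_def)
    then show ?thesis using assms(2) by blast
  next
    case False
    then have l: "length w \<le> length u" by simp
    obtain t where t: "u = w @ t" "x = conc t (\<lambda>_. Let (n - 1))"
      using conc_eq_conc_le[OF e[unfolded mx_def] l] .
    then show ?thesis using False by (intro exI[of _ t]) (auto simp: mx_def)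
  qed
  from assms(3,4) show thesis
  proof (cases rule: nxt_cases)
    case (1 v i)
    obtain t where t: "t \<noteq> []" "v @ [Let (i - 1)] = w @ t" "x = mx n t" using ex 1 by blast
    then obtain s where s: "t = s @ [Let (i - 1)]" "v = w @ s"
      by (metis append_butlast_last_id append_assoc butlast_snoc last_appendR last_snoc)
    then have "s \<in> lists (X n)"
      using 1(1) assms(1) pluswords_append_iff[of w s n r] by (cases w) auto
    then have "inner_nxt n x (mn (s @ [Let i]))"
      unfolding inner_nxt_def using t s 1 by blast
    then show thesis using that[of "mn (s @ [Let i])"] 1 s by (simp add: mn_def)
  next
    case (2 a)
    obtain t where "t \<noteq> []" "[Dot a] = w @ t" using ex 2 by blast
    then show thesis using assms(1) by (cases w) auto
  qed
qed

lemma inner_nxt_cantor: "inner_nxt n x y \<Longrightarrow> x \<in> cantor n \<and> y \<in> cantor n"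
  unfolding inner_nxt_def mx_def mn_def by (auto simp: cantor_conc_iff)

section \<open>Partitions into cones in cyclic order\<close>

definition adjacent :: "nat \<Rightarrow> nat \<Rightarrow> word \<Rightarrow> word \<Rightarrow> bool" where
  "adjacent n r u v \<longleftrightarrow> nxt n r (mx n u) (mn v)"

text \<open>Repeating the head at the end closes the circle; the cone of a one-element list is thus
  adjacent to itself.\<close>

definition cyclic_partition :: "nat \<Rightarrow> nat \<Rightarrow> word list \<Rightarrow> bool" where
  "cyclic_partition n r ws \<longleftrightarrow> cone_partition n ws (cantor_dot n r) \<and> set ws \<subseteq> pluswords n r \<and> ws \<noteq> [] \<and>
     successively (adjacent n r) (ws @ [hd ws])"

lemma cyclic_partition_adjacent:
  assumes "cyclic_partition n r ws" "i < length ws"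
  shows "adjacent n r (ws ! i) (ws ! (Suc i mod length ws))"
proof -
  have "adjacent n r ((ws @ [hd ws]) ! i) ((ws @ [hd ws]) ! Suc i)"
    using assms successively_nth[of "adjacent n r" "ws @ [hd ws]" i] by (simp add: cyclic_partition_def)
  moreover have "(ws @ [hd ws]) ! Suc i = ws ! (Suc i mod length ws)"
  proof (cases "Suc i < length ws")
    case False
    then have "Suc i = length ws" using assms(2) by simp
    then show ?thesis using assms(2) by (metis hd_conv_nth length_0_conv less_nat_zero_code mod_self nth_append_length)
  qed (simp add: nth_append)
  ultimately show ?thesis using assms(2) by (simp add: nth_append)
qed

lemma cone_partition_conc_eq:
  assumes "cone_partition n us U" "i < length us" "j < length us" "a \<in> cantor n" "b \<in> cantor n"
  shows "conc (us ! i) a = conc (us ! j) b \<longleftrightarrow> i = j \<and> a = b"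
  using cone_partition_nth_eq[OF assms(1-3), of "conc (us ! i) a"] mem_cone_conc[OF assms(4), of "us ! i"]
    mem_cone_conc[OF assms(5), of "us ! j"] by auto

text \<open>Since successors are unique, adjacency leaves room for no other gluing between the
  cones. The description uses only positions and coordinates inside the cones, so it is carried
  along when two partitions are matched by position.\<close>

lemma nxt_cyclic_partition:
  assumes n: "2 \<le> n" "1 \<le> r" and ws: "cyclic_partition n r ws"
    and ij: "i < length ws" "j < length ws" and xy: "x \<in> cantor n" "y \<in> cantor n"
  shows "nxt n r (conc (ws ! i) x) (conc (ws ! j) y) \<longleftrightarrow>
    (i = j \<and> inner_nxt n x y) \<or> (j = Suc i mod length ws \<and> x = (\<lambda>_. Let (n - 1)) \<and> y = (\<lambda>_. Let 0))"
    (is "?L \<longleftrightarrow> ?R")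
proof
  have part: "cone_partition n ws (cantor_dot n r)" and wsi: "ws ! i \<in> pluswords n r"
    using ws ij unfolding cyclic_partition_def by auto
  let ?k = "Suc i mod length ws"
  have k: "?k < length ws" using ij by (intro mod_less_divisor) auto
  have adj: "nxt n r (conc (ws ! i) (\<lambda>_. Let (n - 1))) (conc (ws ! ?k) (\<lambda>_. Let 0))"
    using cyclic_partition_adjacent[OF ws ij(1)] by (simp add: adjacent_def mx_def mn_def)
  show ?L if R: ?R
    using R adj nxt_inner[OF wsi] by blast
  assume L: ?L
  show ?R
  proof (cases "x = (\<lambda>_. Let (n - 1))")
    case True
    then have e: "conc (ws ! j) y = conc (ws ! ?k) (\<lambda>_. Let 0)"
      using nxt_functional[OF n] L adj by blast
    then have "j = ?k"
      using cone_partition_nth_eq[OF part ij(2) k] mem_cone_conc[OF xy(2)] mem_cone_conc[OF cantor_two(1)[OF n(1)]]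
      by metis
    then show ?thesis using e True by simp
  next
    case False
    obtain z where z: "conc (ws ! j) y = conc (ws ! i) z" "inner_nxt n x z"
      using nxt_conc[OF wsi False L n(2)] .
    then have "i = j"
      using cone_partition_nth_eq[OF part ij] mem_cone_conc[OF xy(2)] mem_cone_conc inner_nxt_cantor by metis
    then show ?thesis using z by simp
  qed
qed

lemma cone_partition_append:
  assumes "2 \<le> n" "cone_partition n us U" "cone_partition n vs V" "U \<inter> V = {}"
  shows "cone_partition n (us @ vs) (U \<union> V)"
proof -
  have d: "cone n u \<inter> cone n v = {}" if "u \<in> set us" "v \<in> set vs" for u v
    using that assms(2-4) unfolding cone_partition_def by blast
  then have "set us \<inter> set vs = {}"
    using cone_ex[OF assms(1)] by blast
  moreover have "\<forall>u\<in>set (us @ vs). \<forall>v\<in>set (us @ vs). u \<noteq> v \<longrightarrow> cone n u \<inter> cone n v = {}"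
    using d assms(2,3) unfolding cone_partition_def by (metis Un_iff inf_commute set_append)
  ultimately show ?thesis
    using assms(2,3) unfolding cone_partition_def by (simp add: SUP_union)
qed

lemma cone_partition_appendD:
  assumes "cone_partition n (us @ vs) U"
  shows "cone_partition n us (\<Union>u\<in>set us. cone n u)" "cone_partition n vs (\<Union>u\<in>set vs. cone n u)"
    "(\<Union>u\<in>set us. cone n u) \<inter> (\<Union>u\<in>set vs. cone n u) = {}"
    "U = (\<Union>u\<in>set us. cone n u) \<union> (\<Union>u\<in>set vs. cone n u)"
proof -
  have d: "distinct us" "distinct vs" "set us \<inter> set vs = {}"
    and c: "\<And>u v. u \<in> set us \<union> set vs \<Longrightarrow> v \<in> set us \<union> set vs \<Longrightarrow> u \<noteq> v \<Longrightarrow> cone n u \<inter> cone n v = {}"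
    and U: "U = (\<Union>u\<in>set us \<union> set vs. cone n u)"
    using assms unfolding cone_partition_def by auto
  show "cone_partition n us (\<Union>u\<in>set us. cone n u)" "cone_partition n vs (\<Union>u\<in>set vs. cone n u)"
    using c d unfolding cone_partition_def by auto
  show "U = (\<Union>u\<in>set us. cone n u) \<union> (\<Union>u\<in>set vs. cone n u)"
    using U by auto
  have "cone n u \<inter> cone n v = {}" if "u \<in> set us" "v \<in> set vs" for u v
    using c[of u v] d(3) that by blast
  then show "(\<Union>u\<in>set us. cone n u) \<inter> (\<Union>u\<in>set vs. cone n u) = {}" by blast
qed

definition children :: "nat \<Rightarrow> word \<Rightarrow> word list" where
  "children n w = map (\<lambda>i. w @ [Let i]) [0..<n]"

lemma cone_partition_children: "cone_partition n (children n w) (cone n w)"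
proof -
  have "cone n u \<inter> cone n v = {}" if "u \<in> set (children n w)" "v \<in> set (children n w)" "u \<noteq> v" for u v
  proof -
    have "length u = length v" using that(1,2) by (auto simp: children_def)
    then show ?thesis using that(3) cone_same_length by blast
  qed
  moreover have "distinct (children n w)"
    by (simp add: children_def distinct_map inj_on_def)
  moreover have "(\<Union>u\<in>set (children n w). cone n u) = cone n w"
    using UN_cone_letters[of n w] by (simp add: children_def atLeast0LessThan)
  ultimately show ?thesis unfolding cone_partition_def by blast
qed

lemma mn_snoc [simp]: "mn (w @ [Let 0]) = mn w"
proof -
  have "conc [Let 0] (\<lambda>_. Let 0) = (\<lambda>_. Let 0)" by (auto simp: conc_def fun_eq_iff)
  then show ?thesis by (simp add: mn_def)
qed

lemma mx_snoc: "mx n (w @ [Let (n - 1)]) = mx n w"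
proof -
  have "conc [Let (n - 1)] (\<lambda>_. Let (n - 1)) = (\<lambda>_. Let (n - 1))" by (auto simp: conc_def fun_eq_iff)
  then show ?thesis by (simp add: mx_def)
qed

text \<open>The first child has the first point of the cone and the last child its last point, so
  adjacency to the neighbours is inherited.\<close>

lemma cyclic_partition_expand:
  assumes n: "2 \<le> n" and ws: "cyclic_partition n r (xs @ w # ys)"
  shows "cyclic_partition n r (xs @ children n w @ ys)"
proof -
  let ?ex = "children n w"
  let ?h = "hd (xs @ w # ys)" and ?h' = "hd (xs @ ?ex @ ys)"
  have part: "cone_partition n (xs @ w # ys) (cantor_dot n r)" and plus: "set (xs @ w # ys) \<subseteq> pluswords n r"
    and succ: "successively (adjacent n r) (xs @ (w # ys @ [?h]))"
    using ws unfolding cyclic_partition_def by simp_all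
  note p1 = cone_partition_appendD[OF part]
  have "cone_partition n ([w] @ ys) (\<Union>u\<in>set (w # ys). cone n u)" using p1(2) by simp
  note p2 = cone_partition_appendD[OF this]
  have "cone_partition n (?ex @ ys) (cone n w \<union> (\<Union>u\<in>set ys. cone n u))"
    using p2(3) by (intro cone_partition_append[OF n cone_partition_children p2(2)]) simp
  then have "cone_partition n (xs @ ?ex @ ys) (cantor_dot n r)"
    using cone_partition_append[OF n p1(1), of "?ex @ ys"] p1(3,4) by simp
  moreover have "set (xs @ ?ex @ ys) \<subseteq> pluswords n r"
    using plus by (auto simp: children_def intro: pluswords_appendI)
  moreover have exne: "?ex \<noteq> []" using n by (simp add: children_def)
  moreover have "successively (adjacent n r) ((xs @ ?ex @ ys) @ [?h'])"
  proof -
    have hd: "hd ?ex = w @ [Let 0]" "last ?ex = w @ [Let (n - 1)]"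
      using n by (simp_all add: children_def hd_map last_map)
    have a: "adjacent n r u (w @ [Let 0]) \<longleftrightarrow> adjacent n r u w"
        "adjacent n r (w @ [Let (n - 1)]) u \<longleftrightarrow> adjacent n r w u" for u
      unfolding adjacent_def mx_snoc mn_snoc by simp_all
    have h: "adjacent n r u ?h' \<longleftrightarrow> adjacent n r u ?h" for u
      using exne hd a by (cases xs) (simp_all add: hd_append)
    have ex: "successively (adjacent n r) ?ex"
      unfolding children_def successively_map unfolding successively_conv_nth
    proof (intro allI impI)
      fix i assume "Suc i < length [0..<n]"
      then show "adjacent n r (w @ [Let ([0..<n] ! i)]) (w @ [Let ([0..<n] ! Suc i)])"
        using plus unfolding adjacent_def nxt_def by (intro disjI1 bexI[of _ w] exI[of _ "Suc i"]) auto
    qed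
    have s: "successively (adjacent n r) xs" "xs = [] \<or> adjacent n r (last xs) w"
        "adjacent n r w (hd (ys @ [?h]))" "successively (adjacent n r) ys" "ys = [] \<or> adjacent n r (last ys) ?h"
      using succ unfolding successively_append_iff successively_Cons by auto
    have "adjacent n r w (hd (ys @ [?h']))"
      using s(3) h by (cases ys) auto
    then show ?thesis
      using s ex exne hd a h by (auto simp: successively_append_iff)
  qed
  ultimately show ?thesis unfolding cyclic_partition_def by simp
qed

lemma cyclic_partition_rotate: "cyclic_partition n r ws \<Longrightarrow> cyclic_partition n r (rotate m ws)"
proof (induction m)
  case (Suc m)
  have "cyclic_partition n r (rotate1 vs)" if "cyclic_partition n r vs" for vs
  proof (cases vs)
    case (Cons x xs)
    have "cone_partition n (rotate1 vs) U \<longleftrightarrow> cone_partition n vs U" for U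
      by (simp add: cone_partition_def)
    moreover have "successively (adjacent n r) (rotate1 vs @ [hd (rotate1 vs)])"
      using that unfolding cyclic_partition_def Cons
      by (cases xs) (auto simp: successively_append_iff successively_Cons hd_append)
    ultimately show ?thesis
      using that unfolding cyclic_partition_def by (simp add: Cons)
  qed (use that in simp)
  then show ?case using Suc by simp
qed simp

lemma cyclic_partition_dots:
  assumes "1 \<le> r"
  shows "cyclic_partition n r (map (\<lambda>a. [Dot a]) [0..<r])"
proof -
  let ?ws = "map (\<lambda>a. [Dot a]) [0..<r]"
  have "cone n u \<inter> cone n v = {}" if "u \<in> set ?ws" "v \<in> set ?ws" "u \<noteq> v" for u v
  proof -
    have "length u = length v" using that(1,2) by auto
    then show ?thesis using that(3) cone_same_length by blast
  qed
  moreover have "cantor_dot n r = (\<Union>u\<in>set ?ws. cone n u)"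
  proof
    show "cantor_dot n r \<subseteq> (\<Union>u\<in>set ?ws. cone n u)"
    proof
      fix x assume "x \<in> cantor_dot n r"
      then have x: "pre 1 x \<in> pluswords n r" "sdrop 1 x \<in> cantor n" using cantor_dot_pre by auto
      then obtain a where "pre 1 x = [Dot a]" "a < r" by (auto simp: pre_def dots_def)
      then have "x \<in> cone n [Dot a]" using x(2) conc_pre_sdrop[of 1 x] mem_cone_conc by metis
      then show "x \<in> (\<Union>u\<in>set ?ws. cone n u)" using \<open>a < r\<close> by auto
    qed
    show "(\<Union>u\<in>set ?ws. cone n u) \<subseteq> cantor_dot n r"
      by (auto simp: cone_def cantor_dot_Cons_iff)
  qed
  ultimately have "cone_partition n ?ws (cantor_dot n r)"
    unfolding cone_partition_def by (auto simp: distinct_map inj_on_def)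
  moreover have "successively (adjacent n r) (?ws @ [hd ?ws])"
    unfolding successively_conv_nth
  proof (intro allI impI)
    fix i assume i: "Suc i < length (?ws @ [hd ?ws])"
    show "adjacent n r ((?ws @ [hd ?ws]) ! i) ((?ws @ [hd ?ws]) ! Suc i)"
    proof (cases "Suc i < r")
      case True
      then show ?thesis
        unfolding adjacent_def nxt_def by (intro disjI2 disjI1 exI[of _ "Suc i"]) (simp add: nth_append)
    next
      case False
      then have "i = r - 1" "Suc i = r" using i by auto
      then show ?thesis
        using assms unfolding adjacent_def nxt_def by (intro disjI2) (simp add: nth_append hd_map)
    qed
  qed
  ultimately show ?thesis
    unfolding cyclic_partition_def using assms by auto
qed

lemma cyclic_partition_level:
  assumes "2 \<le> n" "1 \<le> r"
  shows "\<exists>ws. cyclic_partition n r ws \<and> (\<forall>w\<in>set ws. length w = Suc L)"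
proof (induction L)
  case 0
  then show ?case using cyclic_partition_dots[OF assms(2), of n] by (intro exI[of _ "map (\<lambda>a. [Dot a]) [0..<r]"]) auto
next
  case (Suc L)
  have ex: "cyclic_partition n r (zs @ concat (map (children n) xs))" if "cyclic_partition n r (zs @ xs)" for zs xs
    using that
  proof (induction xs arbitrary: zs)
    case (Cons x xs)
    then have "cyclic_partition n r ((zs @ children n x) @ xs)"
      using cyclic_partition_expand[OF assms(1)] by simp
    from Cons.IH[OF this] show ?case by simp
  qed simp
  obtain ws where ws: "cyclic_partition n r ws" "\<forall>w\<in>set ws. length w = Suc L" using Suc by blast
  have "\<forall>w\<in>set (concat (map (children n) ws)). length w = Suc (Suc L)"
    using ws(2) by (auto simp: children_def)
  then show ?case
    using ex[of "[]" ws] ws(1) by (intro exI[of _ "concat (map (children n) ws)"]) simp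
qed

text \<open>Starting from the \<open>r\<close> dotted letters, each expansion of a cone adds
  \<open>n - 1\<close> cones.\<close>

lemma cyclic_partition_length:
  assumes "2 \<le> n" "1 \<le> r"
  shows "\<exists>ws. cyclic_partition n r ws \<and> length ws = r + t * (n - 1)"
proof (induction t)
  case 0
  then show ?case using cyclic_partition_dots[OF assms(2), of n] by (intro exI[of _ "map (\<lambda>a. [Dot a]) [0..<r]"]) auto
next
  case (Suc t)
  then obtain w ws where ws: "cyclic_partition n r ([] @ w # ws)" "length (w # ws) = r + t * (n - 1)"
    by (metis append_Nil cyclic_partition_def neq_Nil_conv)
  from cyclic_partition_expand[OF assms(1) ws(1)] ws(2) assms(1) show ?case
    by (intro exI[of _ "children n w @ ws"]) (simp add: children_def)
qed

section \<open>Boundary points and arcs\<close>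

text \<open>Formulated through \<open>simeq\<close>, so that a bijection of the space that preserves
  \<open>simeq\<close> carries the boundary of a set to that of its image.\<close>

definition boundary :: "nat \<Rightarrow> nat \<Rightarrow> infword set \<Rightarrow> infword \<Rightarrow> bool" where
  "boundary n r U x \<longleftrightarrow> x \<in> U \<and> (\<exists>y\<in>cantor_dot n r. y \<notin> U \<and> simeq n r x y)"

text \<open>Consecutive cones of \<open>us\<close> are glued to each other. Only the first and the
  last of them have a neighbour in the nonempty rest \<open>zs\<close>.\<close>

lemma boundary_arc:
  assumes n: "2 \<le> n" "1 \<le> r" and ws: "cyclic_partition n r (us @ zs)" and ne: "us \<noteq> []" "zs \<noteq> []"
    and U: "U = (\<Union>u\<in>set us. cone n u)"
  shows "boundary n r U x \<longleftrightarrow> x = mn (us ! 0) \<or> x = mx n (us ! (length us - 1))"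
proof
  let ?ws = "us @ zs" and ?M = "length us"
  have part: "cone_partition n ?ws (cantor_dot n r)"
    using ws by (simp add: cyclic_partition_def)
  have M: "0 < ?M" "?M < length ?ws" using ne by auto
  have inU: "conc (?ws ! i) y \<in> U \<longleftrightarrow> i < ?M" if "i < length ?ws" "y \<in> cantor n" for i y
  proof
    assume "conc (?ws ! i) y \<in> U"
    then obtain j where j: "j < ?M" "conc (?ws ! i) y \<in> cone n (?ws ! j)"
      unfolding U by (auto simp: in_set_conv_nth nth_append)
    then show "i < ?M"
      using cone_partition_nth_eq[OF part, of i j] mem_cone_conc[OF that(2)] that(1) by auto
  next
    assume "i < ?M"
    then show "conc (?ws ! i) y \<in> U"
      unfolding U using mem_cone_conc[OF that(2)] by (auto simp: nth_append intro!: bexI[of _ "us ! i"])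
  qed
  note C = cone_partition_mem[OF part]
  note c = cantor_two(1)[OF n(1)]
  have c': "(\<lambda>_. Let (n - 1)) \<in> cantor n" using n by simp
  show "boundary n r U x" if "x = mn (us ! 0) \<or> x = mx n (us ! (?M - 1))"
    using that
  proof
    assume x: "x = mn (us ! 0)"
    let ?N = "length ?ws - 1"
    have N: "?N < length ?ws" "\<not> ?N < ?M" "Suc ?N mod length ?ws = 0" using M ne(2) by (cases zs; auto)+
    have "nxt n r (mx n (?ws ! ?N)) (mn (?ws ! 0))"
      using cyclic_partition_adjacent[OF ws N(1)] N(3) by (simp add: adjacent_def)
    then have "simeq n r x (mx n (?ws ! ?N))"
      unfolding simeq_iff_nxt[OF n] using x M by (simp add: nth_append)
    moreover have "x \<in> U" using inU[of 0, OF _ c] M x by (simp add: nth_append mn_def)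
    moreover have "mx n (?ws ! ?N) \<in> cantor_dot n r" "mx n (?ws ! ?N) \<notin> U"
      using inU[OF N(1) c'] C[OF N(1) c'] N(2) unfolding mx_def by auto
    ultimately show ?thesis unfolding boundary_def by blast
  next
    assume x: "x = mx n (us ! (?M - 1))"
    have N: "?M - 1 < length ?ws" "?M - 1 < ?M" "Suc (?M - 1) mod length ?ws = ?M"
      using M(1) M(2) by (linarith, linarith, metis Suc_diff_1 mod_less)
    have "nxt n r (mx n (?ws ! (?M - 1))) (mn (?ws ! ?M))"
      using cyclic_partition_adjacent[OF ws N(1)] N(3) by (simp add: adjacent_def)
    then have "simeq n r x (mn (?ws ! ?M))"
      unfolding simeq_iff_nxt[OF n] using x N by (simp add: nth_append)
    moreover have "x \<in> U" using inU[OF N(1) c'] N(2) x by (simp add: nth_append mx_def)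
    moreover have "mn (?ws ! ?M) \<in> cantor_dot n r" "mn (?ws ! ?M) \<notin> U"
      using inU[OF M(2) c] C[OF M(2) c] unfolding mn_def by auto
    ultimately show ?thesis unfolding boundary_def by blast
  qed
  assume "boundary n r U x"
  then obtain y where xy: "x \<in> U" "y \<in> cantor_dot n r" "y \<notin> U" "simeq n r x y"
    unfolding boundary_def by blast
  then have "x \<in> cantor_dot n r"
    using part unfolding cone_partition_def U by auto
  then obtain i a where i: "i < length ?ws" "a \<in> cantor n" "x = conc (?ws ! i) a"
    by (rule cone_partition_cases[OF part])
  obtain j b where j: "j < length ?ws" "b \<in> cantor n" "y = conc (?ws ! j) b"
    using cone_partition_cases[OF part xy(2)] .
  have ij: "i < ?M" "\<not> j < ?M"
    using inU[OF i(1,2)] inU[OF j(1,2)] xy(1,3) i(3) j(3) by simp_all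
  have "x \<noteq> y" using xy(1,3) by blast
  moreover have "x = y \<or> nxt n r x y \<or> nxt n r y x"
    using xy(4) unfolding simeq_iff_nxt[OF n] .
  ultimately consider "nxt n r x y" | "nxt n r y x" by blast
  then show "x = mn (us ! 0) \<or> x = mx n (us ! (?M - 1))"
  proof cases
    case 1
    then have *: "j = Suc i mod length ?ws" "a = (\<lambda>_. Let (n - 1))"
      using nxt_cyclic_partition[OF n ws i(1) j(1) i(2) j(2)] ij i(3) j(3) by auto
    have "Suc i mod length ?ws = Suc i" using ij(1) M(2) by (intro mod_less) linarith
    then have "i = ?M - 1" using * ij by linarith
    then show ?thesis using i(3) ij * by (simp add: nth_append mx_def)
  next
    case 2
    then have *: "i = Suc j mod length ?ws" "a = (\<lambda>_. Let 0)"
      using nxt_cyclic_partition[OF n ws j(1) i(1) j(2) i(2)] ij i(3) j(3) by auto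
    have "i = 0"
    proof (cases "Suc j = length ?ws")
      case False
      then have "Suc j mod length ?ws = Suc j" using j(1) by (intro mod_less) linarith
      then show ?thesis using * ij by linarith
    qed (use * in simp)
    then show ?thesis using i(3) ij * by (simp add: nth_append mn_def)
  qed
qed

text \<open>Matching positions keeps every gluing within \<open>us\<close>. The one addition comes
  from closing \<open>cs\<close> to a circle, which glues the last point of the arc to the
  first.\<close>

lemma simeq_prefix_map_arc:
  assumes n: "2 \<le> n" "1 \<le> r" "1 \<le> r'" and ws: "cyclic_partition n r (us @ zs)" and ne: "us \<noteq> []" "zs \<noteq> []"
    and U: "U = (\<Union>u\<in>set us. cone n u)" and cs: "cyclic_partition n r' cs" "length us = length cs"
    and xy: "x \<in> U" "y \<in> U"
  shows "simeq n r' (prefix_map n us cs x) (prefix_map n us cs y) \<longleftrightarrow>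
    simeq n r x y \<or> boundary n r U x \<and> boundary n r U y"
proof -
  let ?ws = "us @ zs" and ?M = "length us"
  have M: "0 < ?M" "?M < length ?ws" using ne by auto
  have part: "cone_partition n us U"
    using cone_partition_appendD(1)[of n us zs "cantor_dot n r"] ws unfolding U cyclic_partition_def by blast
  obtain i a where i: "i < ?M" "a \<in> cantor n" "x = conc (us ! i) a"
    using cone_partition_cases[OF part xy(1)] .
  obtain j b where j: "j < ?M" "b \<in> cantor n" "y = conc (us ! j) b"
    using cone_partition_cases[OF part xy(2)] .
  \<comment> \<open>\<open>?s\<close> is the gluing that both partitions share, \<open>?e\<close>
    the one that only the closed circle \<open>cs\<close> has.\<close>
  let ?s = "\<lambda>i j a b. (i = j \<and> inner_nxt n a b) \<or> (j = Suc i \<and> a = (\<lambda>_. Let (n - 1)) \<and> b = (\<lambda>_. Let 0))"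
  let ?e = "\<lambda>i j a b. i = ?M - 1 \<and> j = 0 \<and> a = (\<lambda>_. Let (n - 1)) \<and> b = (\<lambda>_. Let 0)"
  have N: "nxt n r (conc (us ! i) a) (conc (us ! j) b) \<longleftrightarrow> ?s i j a b"
    if "i < ?M" "j < ?M" "a \<in> cantor n" "b \<in> cantor n" for i j a b
  proof -
    have "Suc i mod length ?ws = Suc i" using that(1) M(2) by (intro mod_less) linarith
    then show ?thesis
      using nxt_cyclic_partition[OF n(1,2) ws, of i j a b] that M(2) unfolding nth_append by simp
  qed
  have N': "nxt n r' (conc (cs ! i) a) (conc (cs ! j) b) \<longleftrightarrow> ?s i j a b \<or> ?e i j a b"
    if "i < ?M" "j < ?M" "a \<in> cantor n" "b \<in> cantor n" for i j a b
  proof -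
    have "j = Suc i mod length cs \<longleftrightarrow> j = Suc i \<or> (i = ?M - 1 \<and> j = 0)"
      using that(1,2) cs(2) by (cases "Suc i = ?M") auto
    then show ?thesis
      using nxt_cyclic_partition[OF n(1,3) cs(1), of i j a b] that cs(2) by auto
  qed
  have eq: "conc (us ! i) a = conc (us ! j) b \<longleftrightarrow> i = j \<and> a = b"
    by (rule cone_partition_conc_eq[OF part i(1) j(1) i(2) j(2)])
  have eq': "conc (cs ! i) a = conc (cs ! j) b \<longleftrightarrow> i = j \<and> a = b"
    using cs i j by (intro cone_partition_conc_eq[of n cs "cantor_dot n r'"]) (auto simp: cyclic_partition_def)
  have bd: "boundary n r U (conc (us ! i) a) \<longleftrightarrow> (i = 0 \<and> a = (\<lambda>_. Let 0)) \<or> (i = ?M - 1 \<and> a = (\<lambda>_. Let (n - 1)))"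
    if "i < ?M" "a \<in> cantor n" for i a
  proof -
    have 0: "conc (us ! i) a = mn (us ! 0) \<longleftrightarrow> i = 0 \<and> a = (\<lambda>_. Let 0)"
      unfolding mn_def using M(1) n by (intro cone_partition_conc_eq[OF part] that) simp_all
    have 1: "conc (us ! i) a = mx n (us ! (?M - 1)) \<longleftrightarrow> i = ?M - 1 \<and> a = (\<lambda>_. Let (n - 1))"
      unfolding mx_def using M(1) n by (intro cone_partition_conc_eq[OF part] that) simp_all
    show ?thesis unfolding boundary_arc[OF n(1,2) ws ne U] 0 1 by blast
  qed
  have p: "prefix_map n us cs x = conc (cs ! i) a" "prefix_map n us cs y = conc (cs ! j) b"
    unfolding i(3) j(3) by (rule prefix_map_conc[OF part], use i j in simp_all)+
  have s: "simeq n r x y \<longleftrightarrow> (i = j \<and> a = b) \<or> ?s i j a b \<or> ?s j i b a"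
    unfolding simeq_iff_nxt[OF n(1,2)] i(3) j(3) N[OF i(1) j(1) i(2) j(2)] N[OF j(1) i(1) j(2) i(2)] eq ..
  have s': "simeq n r' (prefix_map n us cs x) (prefix_map n us cs y) \<longleftrightarrow>
      (i = j \<and> a = b) \<or> (?s i j a b \<or> ?e i j a b) \<or> (?s j i b a \<or> ?e j i b a)"
    unfolding p simeq_iff_nxt[OF n(1,3)] N'[OF i(1) j(1) i(2) j(2)] N'[OF j(1) i(1) j(2) i(2)] eq' ..
  have b: "boundary n r U x \<longleftrightarrow> (i = 0 \<and> a = (\<lambda>_. Let 0)) \<or> (i = ?M - 1 \<and> a = (\<lambda>_. Let (n - 1)))"
    "boundary n r U y \<longleftrightarrow> (j = 0 \<and> b = (\<lambda>_. Let 0)) \<or> (j = ?M - 1 \<and> b = (\<lambda>_. Let (n - 1)))"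
    unfolding i(3) j(3) by (rule bd[OF i(1,2)], rule bd[OF j(1,2)])
  have "?e i j a b \<or> ?e j i b a \<Longrightarrow> boundary n r U x \<and> boundary n r U y"
    unfolding b by blast
  moreover have "boundary n r U x \<and> boundary n r U y \<Longrightarrow> (i = j \<and> a = b) \<or> ?e i j a b \<or> ?e j i b a"
    unfolding b by blast
  ultimately show ?thesis
    unfolding s s' by argo
qed

text \<open>Going round the circle, each entrance into \<open>U\<close> and each exit from it yields
  a boundary point. At most two boundary points leave room for one entrance and one exit, so the
  cones inside \<open>U\<close> are consecutive.\<close>

lemma arc_ex:
  assumes n: "2 \<le> n" "1 \<le> r" and ws: "cyclic_partition n r ws"
    and dec: "\<And>w. w \<in> set ws \<Longrightarrow> cone n w \<subseteq> U \<or> cone n w \<inter> U = {}"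
    and U: "U \<subseteq> cantor_dot n r" "U \<noteq> {}" "U \<noteq> cantor_dot n r"
    and bd: "\<And>x. boundary n r U x \<Longrightarrow> x = p \<or> x = q"
  obtains us zs where "cyclic_partition n r (us @ zs)" "us \<noteq> []" "zs \<noteq> []" "U = (\<Union>u\<in>set us. cone n u)"
proof -
  let ?P = "\<lambda>w. cone n w \<subseteq> U"
  let ?N = "length ws"
  note c = cantor_two(1)[OF n(1)]
  have c': "(\<lambda>_. Let (n - 1)) \<in> cantor n" using n by simp
  have part: "cone_partition n ws (cantor_dot n r)" and N0: "0 < ?N"
    using ws by (auto simp: cyclic_partition_def)
  \<comment> \<open>Without an entrance, being outside \<open>U\<close> would propagate from one
    cone to all others.\<close>
  have "\<exists>s<?N. \<not> ?P (ws ! s) \<and> ?P (ws ! (Suc s mod ?N))"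
  proof (rule ccontr)
    assume no: "\<nexists>s. s < ?N \<and> \<not> ?P (ws ! s) \<and> ?P (ws ! (Suc s mod ?N))"
    obtain x where "x \<in> U" using U(2) by blast
    then obtain i a where "i < ?N" "a \<in> cantor n" "x = conc (ws ! i) a"
      using cone_partition_cases[OF part] U(1) by blast
    then have i: "i < ?N" "?P (ws ! i)" using dec[of "ws ! i"] mem_cone_conc[of a n] \<open>x \<in> U\<close> by auto
    obtain y where "y \<in> cantor_dot n r" "y \<notin> U" using U(1,3) by blast
    then obtain k b where "k < ?N" "b \<in> cantor n" "y = conc (ws ! k) b"
      using cone_partition_cases[OF part] by blast
    then have k: "k < ?N" "\<not> ?P (ws ! k)" using mem_cone_conc[of b n] \<open>y \<notin> U\<close> by auto
    have "\<not> ?P (ws ! ((k + m) mod ?N))" for m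
    proof (induction m)
      case (Suc m)
      have "(k + m) mod ?N < ?N" using N0 by simp
      then have "\<not> ?P (ws ! (Suc ((k + m) mod ?N) mod ?N))" using no Suc by blast
      then show ?case by (simp add: mod_Suc_eq)
    qed (use k in simp)
    from this[of "?N - k + i"] show False using i k by simp
  qed
  then obtain s where s: "s < ?N" "\<not> ?P (ws ! s)" "?P (ws ! (Suc s mod ?N))" by blast
  \<comment> \<open>Rotate to an entrance: the list now starts inside \<open>U\<close> and ends
    outside.\<close>
  define vs where "vs = rotate (Suc s) ws"
  have vs: "cyclic_partition n r vs" "length vs = ?N" "set vs = set ws"
    using cyclic_partition_rotate[OF ws] by (simp_all add: vs_def del: rotate_Suc)
  have partv: "cone_partition n vs (cantor_dot n r)" using vs by (simp add: cyclic_partition_def)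
  have v0: "?P (vs ! 0)" using s N0 by (simp add: vs_def nth_rotate del: rotate_Suc)
  have "Suc s + (?N - 1) = s + ?N" using N0 by simp
  then have "(Suc s + (?N - 1)) mod ?N = s" using s(1) by (metis mod_add_self2 mod_less)
  then have vN: "\<not> ?P (vs ! (?N - 1))" using s N0 by (simp add: vs_def nth_rotate del: rotate_Suc)
  have notP: "y \<notin> U" if "\<not> ?P w" "w \<in> set vs" "y \<in> cone n w" for w y
    using dec that vs(3) by blast
  have up: "boundary n r U (mn (vs ! k))"
    if "i < ?N" "\<not> ?P (vs ! i)" "k = Suc i mod ?N" "?P (vs ! k)" for i k
  proof -
    have k: "k < ?N" using that N0 by simp
    have "nxt n r (mx n (vs ! i)) (mn (vs ! k))"
      using cyclic_partition_adjacent[OF vs(1), of i] that vs(2) by (simp add: adjacent_def)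
    moreover have "mx n (vs ! i) \<notin> U"
      using notP[OF that(2)] that(1) vs(2) mem_cone_conc[OF c'] by (simp add: mx_def)
    moreover have "mx n (vs ! i) \<in> cantor_dot n r"
      using cone_partition_mem[OF partv _ c'] that(1) vs(2) by (simp add: mx_def)
    moreover have "mn (vs ! k) \<in> U" using that(4) mem_cone_conc[OF c] by (auto simp: mn_def)
    ultimately show ?thesis unfolding boundary_def simeq_iff_nxt[OF n] by blast
  qed
  have down: "boundary n r U (mx n (vs ! i))"
    if "i < ?N" "?P (vs ! i)" "k = Suc i mod ?N" "\<not> ?P (vs ! k)" for i k
  proof -
    have k: "k < ?N" using that N0 by simp
    have "nxt n r (mx n (vs ! i)) (mn (vs ! k))"
      using cyclic_partition_adjacent[OF vs(1), of i] that vs(2) by (simp add: adjacent_def)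
    moreover have "mn (vs ! k) \<notin> U"
      using notP[OF that(4)] k vs(2) mem_cone_conc[OF c] by (simp add: mn_def)
    moreover have "mn (vs ! k) \<in> cantor_dot n r"
      using cone_partition_mem[OF partv _ c] k vs(2) by (simp add: mn_def)
    moreover have "mx n (vs ! i) \<in> U" using that(2) mem_cone_conc[OF c'] by (auto simp: mx_def)
    ultimately show ?thesis unfolding boundary_def simeq_iff_nxt[OF n] by blast
  qed
  define us where "us = takeWhile ?P vs"
  define zs where "zs = dropWhile ?P vs"
  have uz: "vs = us @ zs" by (simp add: us_def zs_def)
  have une: "us \<noteq> []" using v0 vs(2) N0 by (cases vs) (auto simp: us_def)
  have zne: "zs \<noteq> []"
  proof
    assume "zs = []"
    then have "?P (vs ! (?N - 1))" using vs(2) N0 unfolding zs_def dropWhile_eq_Nil_conv by simp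
    then show False using vN by blast
  qed
  have usP: "?P u" if "u \<in> set us" for u using that unfolding us_def by (auto dest: set_takeWhileD)
  have zsP: "\<not> ?P z" if zin: "z \<in> set zs" for z
  proof
    assume "?P z"
    let ?M = "length us"
    have "?N = ?M + length zs" using vs(2) uz by simp
    moreover have "0 < length zs" using zne by simp
    ultimately have M: "0 < ?M" "?M < ?N" using une by simp_all
    have vM: "\<not> ?P (vs ! ?M)"
      using hd_dropWhile[of ?P vs] zne uz hd_conv_nth[of zs] unfolding zs_def by (metis nth_append_length_plus add_0_right)
    obtain l where l: "l < length zs" "z = zs ! l" using zin by (metis in_set_conv_nth)
    \<comment> \<open>A further cone inside \<open>U\<close> after the exit would be entered at some
      \<open>j\<close>, and its first point would be a third boundary point besides the two ends of
      the first run.\<close>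
    let ?Q = "\<lambda>j. ?M \<le> j \<and> j < ?N \<and> ?P (vs ! j)"
    have "?Q (?M + l)" using l \<open>?P z\<close> uz vs(2) by (metis add_less_cancel_left le_add1 length_append nth_append_length_plus)
    define j where "j = (LEAST j. ?Q j)"
    have j: "?M \<le> j" "j < ?N" "?P (vs ! j)"
      using LeastI[of ?Q, OF \<open>?Q (?M + l)\<close>] by (simp_all add: j_def)
    then have "?M \<noteq> j" using vM by blast
    then have j1: "?M \<le> j - 1" "j - 1 < j" "j = Suc (j - 1)" using j by auto
    then have "\<not> ?P (vs ! (j - 1))" using not_less_Least[of "j - 1" ?Q] j unfolding j_def by auto
    then have b2: "boundary n r U (mn (vs ! j))" using up[of "j - 1" j] j j1 by auto
    have b0: "boundary n r U (mn (vs ! 0))" using up[of "?N - 1" 0] v0 vN N0 by simp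
    have "?P (vs ! (?M - 1))" using usP M uz by (simp add: nth_append)
    then have b1: "boundary n r U (mx n (vs ! (?M - 1)))" using down[of "?M - 1" ?M] vM M by auto
    have ne: "conc (vs ! i) x \<noteq> conc (vs ! k) y" if "i \<noteq> k" "i < ?N" "k < ?N" "x \<in> cantor n" "y \<in> cantor n" for i k x y
      using cone_partition_nth_eq[OF partv, of i k] that vs(2) mem_cone_conc by metis
    have mj: "?M - 1 \<noteq> j" "?M - 1 < ?N" "0 \<noteq> j" using j M by linarith+
    have "mn (vs ! 0) \<noteq> mn (vs ! j)" "mx n (vs ! (?M - 1)) \<noteq> mn (vs ! j)"
      unfolding mn_def mx_def using ne[OF mj(3) N0 j(2) c c] ne[OF mj(1,2) j(2) c' c] by blast+
    moreover have "mn (vs ! 0) \<noteq> mx n (vs ! (?M - 1))"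
    proof (cases "?M - 1 = 0")
      \<comment> \<open>The run is a single cone; its two ends differ because \<open>n\<close> is at
        least \<open>2\<close>.\<close>
      case True
      have "(\<lambda>_. Let 0) \<noteq> (\<lambda>_. Let (n - 1) :: letter)" using n by (auto simp: fun_eq_iff)
      then show ?thesis unfolding mn_def mx_def True conc_inject .
    next
      case False
      then have "0 \<noteq> ?M - 1" by simp
      then show ?thesis unfolding mn_def mx_def by (rule ne[OF _ N0 mj(2) c c'])
    qed
    ultimately show False using bd[OF b0] bd[OF b1] bd[OF b2] by metis
  qed
  have "U = (\<Union>u\<in>set us. cone n u)"
  proof
    show "(\<Union>u\<in>set us. cone n u) \<subseteq> U" using usP by blast
    show "U \<subseteq> (\<Union>u\<in>set us. cone n u)"
    proof
      fix x assume x: "x \<in> U"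
      then obtain v where v: "v \<in> set vs" "x \<in> cone n v"
        using U(1) partv unfolding cone_partition_def by blast
      then have "?P v" using notP x by blast
      then have "v \<in> set us" using zsP v(1) uz by auto
      then show "x \<in> (\<Union>u\<in>set us. cone n u)" using v(2) by blast
    qed
  qed
  then show thesis using that[of us zs] vs(1) une zne uz by simp
qed

section \<open>The signature\<close>

lemma has_sig_cone_partition:
  assumes "2 \<le> n" "cone_partition n us U"
  shows "has_sig n U (length us)"
proof -
  have "has_sig n (\<Union>u\<in>set us. cone n u) (card (set us) * 1)"
    using assms by (intro has_sig_UN_const has_sig_cone) (auto simp: cone_partition_def)
  then show ?thesis
    using assms(2) unfolding cone_partition_def by (simp add: distinct_card)
qed

lemma has_sig_image:
  assumes n: "2 \<le> n" and f: "inj_on f V" and U: "U \<subseteq> V" "has_sig n U b"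
    and a: "\<And>w. w \<noteq> [] \<Longrightarrow> cone n w \<subseteq> V \<Longrightarrow> has_sig n (f ` cone n w) a"
  shows "has_sig n (f ` U) (b * a)"
proof -
  obtain L where L: "\<And>l. L \<le> l \<Longrightarrow> clopen_level n l U \<and> [card (cones n l U) = b] (mod (n - 1))"
    using has_sig_level[OF n U(2)] by metis
  \<comment> \<open>\<open>Suc L\<close> rather than \<open>L\<close> keeps the words nonempty, as
    the assumption on cones requires.\<close>
  let ?l = "Suc L"
  have l: "finite (cones n ?l U)" "U = (\<Union>w\<in>cones n ?l U. cone n w)" "[card (cones n ?l U) = b] (mod (n - 1))"
    using L[of ?l] unfolding clopen_level_def by simp_all
  have c: "w \<noteq> [] \<and> cone n w \<subseteq> V \<and> length w = ?l" if "w \<in> cones n ?l U" for w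
    using that U(1) unfolding cones_def by auto
  have "has_sig n (\<Union>w\<in>cones n ?l U. f ` cone n w) (card (cones n ?l U) * a)"
  proof (rule has_sig_UN_const[OF n l(1)])
    fix w v assume w: "w \<in> cones n ?l U" "v \<in> cones n ?l U" "w \<noteq> v"
    have "length w = length v" using c[OF w(1)] c[OF w(2)] by simp
    then have "cone n w \<inter> cone n v = {}" using cone_same_length w(3) by blast
    moreover have "f ` (cone n w \<inter> cone n v) = f ` cone n w \<inter> f ` cone n v"
      using c[OF w(1)] c[OF w(2)] by (intro inj_on_image_Int[OF f]) auto
    ultimately show "f ` cone n w \<inter> f ` cone n v = {}" by simp
  qed (use a c in blast)
  moreover have "f ` U = (\<Union>w\<in>cones n ?l U. f ` cone n w)"
    by (subst l(2)) (rule image_UN)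
  ultimately show ?thesis
    using has_sig_cong[OF cong_scalar_right[OF l(3), of a]] by simp
qed

lemma cone_subset_cantor_dot: "2 \<le> n \<Longrightarrow> w \<noteq> [] \<Longrightarrow> cone n w \<subseteq> cantor_dot n r \<longleftrightarrow> w \<in> pluswords n r"
  using cantor_dot_conc_iff[of w _ n r] cantor_two(1)[of n] unfolding cone_def by blast

lemma cone_subset_cantor: "2 \<le> n \<Longrightarrow> cone n w \<subseteq> cantor n \<longleftrightarrow> w \<in> lists (X n)"
  using cantor_conc_iff[of w _ n] cantor_two(1)[of n] unfolding cone_def by blast

lemma image_cone_loc:
  assumes "2 \<le> n" "inj_on f V" "cone n w \<subseteq> V"
  shows "f ` cone n w = conc (strip_pre n (\<lambda>x. f (conc w x))) ` loc n f w ` cantor n"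
proof -
  have "inj_on (\<lambda>x. f (conc w x)) (cantor n)"
    using inj_on_conc[OF assms(2)] assms(3) by (simp add: cone_def)
  then show ?thesis
    unfolding cone_def image_image loc_def using conc_strip[OF assms(1)] by (intro image_cong) simp_all
qed

text \<open>
  Synchronization makes the signature independent of the cone: splitting a cone at the level of
  synchronization gives pieces whose local maps do not depend on the cone.
\<close>

lemma signature_ex:
  assumes n: "2 \<le> n" "1 \<le> r" and h: "bij_betw h (cantor_dot n r) (cantor_dot n r)"
    "ucont (cantor_dot n r) (inv_into (cantor_dot n r) h)" "lsync n r h k"
  shows "\<exists>a. \<forall>w\<in>pluswords n r. has_sig n (h ` cone n w) a"
proof -
  let ?C = "cantor_dot n r"
  have inj: "inj_on h ?C" and hC: "h ` ?C = ?C" using h(1) by (auto simp: bij_betw_def)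
  have cone_C: "cone n w \<subseteq> ?C" if "w \<in> pluswords n r" for w
    using cone_subset_cantor_dot[OF n(1), of w r] that by (cases w) auto
  \<comment> \<open>The inverse is uniformly continuous: boundedly many letters of a point decide
    whether its preimage lies in the cone, so the image is a union of cones of one level.\<close>
  have ex: "\<exists>a. has_sig n (h ` cone n w) a" if w: "w \<in> pluswords n r" for w
  proof -
    obtain K where K: "\<And>x y k. \<lbrakk>x \<in> ?C; y \<in> ?C; K \<le> k; pre k x = pre k y\<rbrakk> \<Longrightarrow>
        pre (length w) (inv_into ?C h x) = pre (length w) (inv_into ?C h y)"
      using h(2) by (rule ucontD[where m = "length w"]) blast
    let ?U = "h ` cone n w" and ?L = "Suc K"
    let ?W = "{u \<in> pluswords n r. length u = ?L \<and> cone n u \<subseteq> ?U}"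
    have UC: "?U \<subseteq> ?C" using cone_C[OF w] hC by blast
    have "y \<in> (\<Union>u\<in>?W. cone n u)" if y: "y \<in> ?U" for y
    proof -
      let ?u = "pre ?L y"
      have u: "?u \<in> pluswords n r" "y \<in> cone n ?u"
        using cantor_dot_pre[of y n r ?L] y UC mem_cone_conc[of "sdrop ?L y" n ?u] by auto
      have "cone n ?u \<subseteq> ?U"
      proof
        fix z assume z: "z \<in> cone n ?u"
        then have zC: "z \<in> ?C" using cone_C[OF u(1)] by blast
        have "pre ?L z = ?u" using z unfolding cone_def by (auto simp: pre_conc)
        then have "pre (length w) (inv_into ?C h z) = pre (length w) (inv_into ?C h y)"
          using K[OF zC, of y ?L] y UC by auto
        also have "\<dots> = w"
          using y cone_C[OF w] inv_into_f_f[OF inj] by (auto simp: cone_def subset_iff pre_conc)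
        finally have e: "inv_into ?C h z = conc w (sdrop (length w) (inv_into ?C h z))"
          by (rule pre_eq_append_conc)
        have "inv_into ?C h z \<in> ?C" using zC hC by (simp add: inv_into_into)
        then have "inv_into ?C h z \<in> cone n w"
          using e cantor_dot_conc_iff[of w _ n r] w mem_cone_conc by (metis Nil_pluswords)
        moreover have "h (inv_into ?C h z) = z" using zC hC by (simp add: f_inv_into_f)
        ultimately show "z \<in> ?U" by (metis imageI)
      qed
      then show ?thesis using u by auto
    qed
    then have "?U = (\<Union>u\<in>?W. cone n u)" by blast
    moreover have "finite ?W" by (rule finite_subset[OF _ finite_pluswords_le[of n r ?L]]) auto
    ultimately have "clopen_level n ?L ?U"
      by (intro clopen_levelI(1)[OF n(1)]) auto
    then show ?thesis by (rule clopen_level_imp_has_sig)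
  qed
  \<comment> \<open>The count for the image of the cone of \<open>w @ v\<close> depends only on the
    last \<open>k\<close> letters \<open>v\<close>; \<open>[Dot 0]\<close> is a representative of
    the word in front of them.\<close>
  define \<alpha> where "\<alpha> v = (SOME a. has_sig n (h ` cone n ([Dot 0] @ v)) a)" for v
  have z: "[Dot 0] \<in> pluswords n r" using n by simp
  have \<alpha>: "has_sig n (h ` cone n (w @ v)) (\<alpha> v)"
    if w: "w \<in> pluswords n r" and v: "v \<in> lists (X n)" "length v = k" for w v
  proof -
    have "has_sig n (h ` cone n ([Dot 0] @ v)) (\<alpha> v)"
      unfolding \<alpha>_def using ex[OF pluswords_appendI[OF z v(1)]] by (rule someI_ex)
    then have "has_sig n (loc n h ([Dot 0] @ v) ` cantor n) (\<alpha> v)"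
      using image_cone_loc[OF n(1) inj cone_C[OF pluswords_appendI[OF z v(1)]]] has_sig_conc[OF n(1)] by simp
    moreover have "loc n h ([Dot 0] @ v) = loc n h (w @ v)"
      using h(3) w z v unfolding lsync_def by blast
    ultimately show ?thesis
      using image_cone_loc[OF n(1) inj cone_C[OF pluswords_appendI[OF w v(1)]]] has_sig_conc[OF n(1)] by simp
  qed
  let ?V = "{v \<in> lists (X n). length v = k}"
  have "has_sig n (h ` cone n w) (\<Sum>v\<in>?V. \<alpha> v)" if w: "w \<in> pluswords n r" for w
  proof -
    have "h ` cone n w = (\<Union>v\<in>?V. h ` cone n (w @ v))"
      by (subst cone_split[of n w k]) (rule image_UN)
    moreover have "has_sig n (\<Union>v\<in>?V. h ` cone n (w @ v)) (\<Sum>v\<in>?V. \<alpha> v)"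
    proof (rule has_sig_UN[OF n(1) finite_X_words])
      fix u v assume uv: "u \<in> ?V" "v \<in> ?V" "u \<noteq> v"
      have "cone n (w @ u) \<inter> cone n (w @ v) = {}"
        using cone_same_length[of _ n "w @ u" "w @ v"] uv by auto
      moreover have "h ` (cone n (w @ u) \<inter> cone n (w @ v)) = h ` cone n (w @ u) \<inter> h ` cone n (w @ v)"
        using cone_C w uv pluswords_appendI by (intro inj_on_image_Int[OF inj]) auto
      ultimately show "h ` cone n (w @ u) \<inter> h ` cone n (w @ v) = {}" by simp
    qed (use \<alpha>[OF w] in simp)
    ultimately show ?thesis by simp
  qed
  then show ?thesis by blast
qed

definition signature :: "nat \<Rightarrow> nat \<Rightarrow> (infword \<Rightarrow> infword) \<Rightarrow> nat \<Rightarrow> bool" where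
  "signature n r h a \<longleftrightarrow> (\<forall>w\<in>pluswords n r. has_sig n (h ` cone n w) a)"

lemma signature_image:
  assumes "2 \<le> n" "signature n r h a" "inj_on h (cantor_dot n r)" "U \<subseteq> cantor_dot n r" "has_sig n U b"
  shows "has_sig n (h ` U) (b * a)"
  using assms cone_subset_cantor_dot[OF assms(1)] unfolding signature_def
  by (intro has_sig_image[OF assms(1,3,4,5)]) blast

lemma B_signature:
  assumes n: "2 \<le> n" "1 \<le> r" and h: "h \<in> B n r"
  obtains a b where "signature n r h a" "[a * b = 1] (mod (n - 1))" "[r * a = r] (mod (n - 1))"
proof -
  let ?C = "cantor_dot n r" and ?h = "inv_into (cantor_dot n r) h"
  have hB: "bij_betw h ?C ?C" "ucont ?C h" "ucont ?C ?h" "\<exists>k. lsync n r h k" "\<exists>k. lsync n r ?h k"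
    using h unfolding B_iff[OF n] by blast+
  have bi: "bij_betw ?h ?C ?C" using bij_betw_inv_into[OF hB(1)] .
  have inj: "inj_on h ?C" "inj_on ?h ?C" and hC: "h ` ?C = ?C" using hB(1) bi by (auto simp: bij_betw_def)
  have "ucont ?C (inv_into ?C ?h)"
    using hB(2) by (rule iffD1[OF ucont_cong, rotated]) (simp add: inv_into_inv_into_eq[OF hB(1)])
  then obtain b where b: "signature n r ?h b"
    using signature_ex[OF n bi] hB(5) unfolding signature_def by blast
  obtain a where a: "signature n r h a"
    using signature_ex[OF n hB(1,3)] hB(4) unfolding signature_def by blast
  have z: "[Dot 0] \<in> pluswords n r" using n by simp
  then have zC: "cone n [Dot 0] \<subseteq> ?C" using cone_subset_cantor_dot[OF n(1)] by blast
  have "has_sig n (?h ` h ` cone n [Dot 0]) (a * b)"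
    using a z zC hC unfolding signature_def by (intro signature_image[OF n(1) b inj(2)]) auto
  moreover have "?h ` h ` cone n [Dot 0] = cone n [Dot 0]"
    using zC inj(1) by (simp add: inv_into_image_cancel)
  ultimately have 1: "[a * b = 1] (mod (n - 1))"
    using has_sig_unique[OF n(1)] has_sig_cone[OF n(1)] by metis
  have "has_sig n ?C r"
    using has_sig_cone_partition[OF n(1)] cyclic_partition_dots[OF n(2), of n]
    unfolding cyclic_partition_def by fastforce
  then have "[r * a = r] (mod (n - 1))"
    using has_sig_unique[OF n(1)] signature_image[OF n(1) a inj(1) subset_refl] hC by metis
  then show thesis using that a 1 by blast
qed

section \<open>The signature of a core\<close>

text \<open>All representatives and states are quantified over because the product picks them with
  \<open>SOME\<close>. The first conjunct excludes the vacuous case, in which every number would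
  qualify.\<close>

definition class_sig :: "nat \<Rightarrow> transducer_class \<Rightarrow> nat \<Rightarrow> bool" where
  "class_sig n E a \<longleftrightarrow> (\<exists>T\<in>E. states T \<noteq> {}) \<and> (\<forall>T\<in>E. \<forall>q\<in>states T. has_sig n (iout T q ` cantor n) a)"

lemma class_sig_unique: "2 \<le> n \<Longrightarrow> class_sig n E a \<Longrightarrow> class_sig n E b \<Longrightarrow> [a = b] (mod (n - 1))"
  unfolding class_sig_def using has_sig_unique by blast

lemma Core_state_sig:
  assumes n: "2 \<le> n" "1 \<le> r" and h: "h \<in> B n r" and a: "signature n r h a"
    and T: "T \<in> Core n r h" "q \<in> states T"
  shows "inj_on (iout T q) (cantor n)" "iout T q ` cantor n \<subseteq> cantor n" "ucont (cantor n) (iout T q)"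
    "\<And>w. w \<in> lists (X n) \<Longrightarrow> has_sig n (iout T q ` cone n w) a"
proof -
  let ?C = "cantor_dot n r"
  have hB: "bij_betw h ?C ?C" "ucont ?C h" using h unfolding B_iff[OF n] by blast+
  then have inj: "inj_on h ?C" and hC: "h ` ?C = ?C" by (auto simp: bij_betw_def)
  \<comment> \<open>At words longer than \<open>K\<close> the dotted letter of the output is already
    written; hence the prefix \<open>?s\<close> below is nonempty and the state maps
    \<open>cantor n\<close> into itself.\<close>
  obtain K where K: "\<And>x y k. \<lbrakk>x \<in> ?C; y \<in> ?C; K \<le> k; pre k x = pre k y\<rbrakk> \<Longrightarrow> pre 1 (h x) = pre 1 (h y)"
    using hB(2) by (rule ucontD[where m = 1]) blast
  obtain w where w: "w \<in> pluswords n r" "K < length w" and f: "\<And>x. x \<in> cantor n \<Longrightarrow> iout T q x = loc n h w x"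
    using Core_iout(2)[OF n h T] by metis
  have wC: "conc w ` cantor n \<subseteq> ?C" using pluswords_conc[OF w(1)] by blast
  then have iw: "inj_on (\<lambda>x. h (conc w x)) (cantor n)" by (rule inj_on_conc[OF inj])
  let ?s = "strip_pre n (\<lambda>x. h (conc w x))"
  have eq: "h (conc w x) = conc ?s (iout T q x)" if "x \<in> cantor n" for x
    using conc_strip[OF n(1) iw that] f[OF that] by (simp add: loc_def)
  show "inj_on (iout T q) (cantor n)"
    using strip_inj[OF n(1) iw] f inj_on_cong[of "cantor n" "iout T q" "loc n h w"] by (simp add: loc_def)
  show "ucont (cantor n) (iout T q)"
    using ucont_loc[where f = h, OF n(1) iw hB(2) wC] ucont_cong[of "cantor n" "iout T q" "loc n h w"] f by simp
  have "1 \<le> length ?s"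
    unfolding length_strip_pre[OF n(1) iw]
  proof (intro ballI)
    fix x y assume xy: "x \<in> cantor n" "y \<in> cantor n"
    show "pre 1 (h (conc w x)) = pre 1 (h (conc w y))"
      using K[OF pluswords_conc[OF w(1) xy(1)] pluswords_conc[OF w(1) xy(2)], of "length w"] w(2) by simp
  qed
  then have s: "?s \<noteq> []" by auto
  show "iout T q ` cantor n \<subseteq> cantor n"
  proof
    fix y assume "y \<in> iout T q ` cantor n"
    then obtain x where x: "x \<in> cantor n" "y = iout T q x" by blast
    have "h (conc w x) \<in> ?C" using hC pluswords_conc[OF w(1) x(1)] by blast
    then show "y \<in> cantor n" using cantor_dot_conc_iff[OF s] x(2) unfolding eq[OF x(1)] by blast
  qed
  fix v assume v: "v \<in> lists (X n)"
  have "conc ?s ` iout T q ` cone n v = h ` cone n (w @ v)"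
    unfolding cone_def image_image conc_append
    using eq v by (intro image_cong) (simp_all add: cantor_conc_iff)
  moreover have "has_sig n (h ` cone n (w @ v)) a"
    using a pluswords_appendI[OF w(1) v] by (simp add: signature_def)
  ultimately show "has_sig n (iout T q ` cone n v) a"
    using has_sig_conc[OF n(1)] by metis
qed

lemma class_sig_Core:
  assumes "2 \<le> n" "1 \<le> r" "h \<in> B n r" "signature n r h a"
  shows "class_sig n (Core n r h) a"
  unfolding class_sig_def
  using Core_iout(1)[OF assms(1-3)] Core_state_sig(4)[OF assms, of _ _ "[]"] by (auto simp: cone_def)

text \<open>Whatever \<open>SOME\<close> picks, a state of the product induces, up to a prefix, the
  composite on some cone. The first map sends this cone to \<open>a\<close> cones, each of which the
  second map sends to \<open>b\<close> cones, always modulo \<open>n - 1\<close>.\<close>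

lemma class_sig_core_mult:
  assumes n: "2 \<le> n" and g: "1 \<le> r" "g \<in> B n r" "signature n r g a"
    and h: "1 \<le> r'" "h \<in> B n r'" "signature n r' h b"
  shows "class_sig n (core_mult n (Core n r g) (Core n r' h)) (a * b)"
proof -
  let ?P = "\<lambda>E. \<exists>T\<in>Core n r g. \<exists>U\<in>Core n r' h. \<exists>q1\<in>states T. \<exists>q2\<in>states U. E = Core_map n (iout U q2 \<circ> iout T q1)"
  have "\<exists>E. ?P E"
    using Core_iout(1)[OF n g(1,2)] Core_iout(1)[OF n h(1,2)] by blast
  then have "?P (core_mult n (Core n r g) (Core n r' h))"
    unfolding core_mult_def by (rule someI_ex)
  then obtain T U q1 q2 where T: "T \<in> Core n r g" "q1 \<in> states T" and U: "U \<in> Core n r' h" "q2 \<in> states U"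
      and E: "core_mult n (Core n r g) (Core n r' h) = Core_map n (iout U q2 \<circ> iout T q1)"
    by blast
  note t = Core_state_sig[OF n g T] and u = Core_state_sig[OF n h U]
  let ?f = "iout U q2 \<circ> iout T q1"
  have f: "inj_on ?f (cantor n)" "?f ` cantor n \<subseteq> cantor n" "ucont (cantor n) ?f"
    using comp_inj_on[OF t(1) inj_on_subset[OF u(1) t(2)]] t(2) u(2) ucont_comp[OF t(3) u(3) t(2)]
    by (auto simp: comp_def)
  note M = Core_map_iout[OF n f]
  have "has_sig n (iout V p ` cantor n) (a * b)" if V: "V \<in> Core_map n ?f" "p \<in> states V" for V p
  proof -
    obtain w s where w: "w \<in> lists (X n)" and s: "\<forall>x\<in>cantor n. ?f (conc w x) = conc s (iout V p x)"
      using M(2)[OF V] by blast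
    have "iout T q1 ` cone n w \<subseteq> cantor n"
      using t(2) cone_subset_cantor[OF n] w by blast
    then have "has_sig n (iout U q2 ` iout T q1 ` cone n w) (a * b)"
      using u(4) cone_subset_cantor[OF n] by (intro has_sig_image[OF n u(1) _ t(4)[OF w]]) blast+
    moreover have "iout U q2 ` iout T q1 ` cone n w = conc s ` iout V p ` cantor n"
      unfolding cone_def image_image using s by (intro image_cong) simp_all
    ultimately show ?thesis using has_sig_conc[OF n] by metis
  qed
  then show ?thesis
    unfolding class_sig_def E using M(1) by blast
qed


section \<open>Changing the number of dotted letters\<close>

text \<open>The bounds make \<open>r\<close> the least positive number in its residue class, so
  \<open>l\<close> is not smaller and the multiple is not negative.\<close>

lemma length_eq_add_mult:
  assumes "[l = r] (mod m)" "1 \<le> (l :: nat)" "1 \<le> r" "r \<le> m"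
  obtains t where "l = r + t * m"
proof -
  have "r \<le> l"
  proof (rule ccontr)
    assume "\<not> r \<le> l"
    then have "m dvd r - l" "0 < r - l" "r - l < m"
      using assms cong_altdef_nat[of l r m] by (auto simp: cong_sym_eq)
    then show False by (simp add: nat_dvd_not_less)
  qed
  then have "m dvd l - r" using assms(1) cong_altdef_nat by blast
  then obtain t where "l - r = m * t" ..
  then show thesis using that[of t] \<open>r \<le> l\<close> by (simp add: mult.commute)
qed

text \<open>
  Restrict \<open>h\<close> to \<open>r'\<close> of the cones below \<open>[Dot 0]\<close>, regarded as a copy of the space with
  \<open>r'\<close> dotted letters. If the image consists of \<open>r'\<close> cones modulo \<open>n - 1\<close>, it can be mapped
  back to that space by prefix replacement, which does not change the core. If \<open>h\<close> preserves
  \<open>\<simeq>\<close>, the image is an arc, and the replacement can be chosen to preserve the order of the cones.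
\<close>

locale reduction =
  fixes n r r' :: nat and h :: "infword \<Rightarrow> infword" and a :: nat
  assumes n: "2 \<le> n" and r: "1 \<le> r" "1 \<le> r'" "r' \<le> n - 1"
    and h: "h \<in> B n r" and sig: "signature n r h a" and cong: "[r' * a = r'] (mod (n - 1))"
begin

definition ds :: "word list" where "ds = map (\<lambda>a. [Dot a]) [0..<r']"
text \<open>As \<open>r'\<close> is at most \<open>n - 1\<close>, the child with the last letter is
  left out. So \<open>W\<close> is a proper subset, even for \<open>r = 1\<close>, and has two
  ends.\<close>

definition vs :: "word list" where "vs = map (\<lambda>i. [Dot 0, Let i]) [0..<r']"
definition W :: "infword set" where "W = (\<Union>v\<in>set vs. cone n v)"

lemma cyc_ds: "cyclic_partition n r' ds"
  unfolding ds_def by (rule cyclic_partition_dots[OF r(2)])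

lemma part_ds: "cone_partition n ds (cantor_dot n r')"
  using cyc_ds by (simp add: cyclic_partition_def)

lemma length_vs: "length ds = length vs" "length vs = r'" "vs \<noteq> []"
  using r(2) by (auto simp: ds_def vs_def)

lemma cyc_vs: obtains zs where "cyclic_partition n r (vs @ zs)" "zs \<noteq> []"
proof -
  let ?ys = "map (\<lambda>a. [Dot a]) [1..<r]"
  have "map (\<lambda>a. [Dot a]) [0..<r] = [] @ [Dot 0] # ?ys"
    using r(1) by (simp add: upt_conv_Cons)
  then have "cyclic_partition n r ([] @ [Dot 0] # ?ys)"
    using cyclic_partition_dots[OF r(1), of n] by simp
  then have "cyclic_partition n r (children n [Dot 0] @ ?ys)"
    using cyclic_partition_expand[OF n] by fastforce
  moreover have "[0..<n] = [0..<r'] @ [r'..<n]"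
    using r(3) n by (metis le0 upt_add_eq_append le_add_diff_inverse diff_le_self le_trans)
  then have "children n [Dot 0] = vs @ map (\<lambda>i. [Dot 0, Let i]) [r'..<n]"
    by (simp add: children_def vs_def)
  moreover have "r' < n" using r(3) n by linarith
  ultimately show thesis using that[of "map (\<lambda>i. [Dot 0, Let i]) [r'..<n] @ ?ys"] by simp
qed

lemma part_vs: "cone_partition n vs W"
proof -
  obtain zs where "cyclic_partition n r (vs @ zs)" using cyc_vs .
  then show ?thesis unfolding W_def cyclic_partition_def using cone_partition_appendD(1) by blast
qed

lemma W_subset: "W \<subseteq> cantor_dot n r" "W \<noteq> {}" "W \<noteq> cantor_dot n r"
proof -
  obtain zs where zs: "cyclic_partition n r (vs @ zs)" "zs \<noteq> []" using cyc_vs .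
  then have "cone_partition n (vs @ zs) (cantor_dot n r)" by (simp add: cyclic_partition_def)
  note p = cone_partition_appendD[OF this]
  show "W \<subseteq> cantor_dot n r" using p(4) unfolding W_def by blast
  obtain v z where v: "v \<in> set vs" "z \<in> set zs" using zs(2) length_vs(3) by (meson list.set_sel(1))
  obtain x y where xy: "x \<in> cone n v" "y \<in> cone n z" using cone_ex[OF n] by meson
  show "W \<noteq> {}" using v(1) xy(1) unfolding W_def by blast
  have "y \<in> cantor_dot n r" "y \<notin> W" using p(3,4) v(2) xy(2) unfolding W_def by blast+
  then show "W \<noteq> cantor_dot n r" by blast
qed

lemma h_bij: "bij_betw h (cantor_dot n r) (cantor_dot n r)" "inj_on h (cantor_dot n r)" "h ` cantor_dot n r = cantor_dot n r"
  using h unfolding B_iff[OF n r(1)] bij_betw_def by blast+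

lemma has_sig_hW: "has_sig n (h ` W) r'"
proof -
  have "has_sig n W r'" using has_sig_cone_partition[OF n part_vs] length_vs by simp
  then have "has_sig n (h ` W) (r' * a)"
    by (rule signature_image[OF n sig h_bij(2) W_subset(1)])
  then show ?thesis by (rule has_sig_cong[OF cong])
qed

text \<open>Each partition of the image has \<open>r'\<close> cones modulo \<open>n - 1\<close>, and
  at least one. Cyclic partitions of the target space exist for all such numbers from
  \<open>r'\<close> on.\<close>

lemma target_ex:
  assumes us: "cone_partition n us (h ` W)"
  obtains cs where "cyclic_partition n r' cs" "length us = length cs"
proof -
  have "[length us = r'] (mod (n - 1))"
    using has_sig_unique[OF n has_sig_cone_partition[OF n us] has_sig_hW] .
  moreover have "us \<noteq> []" using us W_subset(2) by (auto simp: cone_partition_def)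
  ultimately obtain t where "length us = r' + t * (n - 1)"
    using length_eq_add_mult[of "length us" r' "n - 1"] r by (cases us) auto
  then show thesis using cyclic_partition_length[OF n r(2)] that by metis
qed

lemma Core_in_O_set: "Core n r h \<in> O_set n r'"
proof -
  obtain L where L: "clopen_level n L (h ` W)" using has_sig_hW unfolding has_sig_def by blast
  obtain us where us: "set us = cones n L (h ` W)" "distinct us"
    using L finite_distinct_list unfolding clopen_level_def by metis
  have "cone n u \<inter> cone n v = {}" if "u \<in> cones n L (h ` W)" "v \<in> cones n L (h ` W)" "u \<noteq> v" for u v
    using that cone_same_length[of _ n u v] by (auto simp: cones_def)
  then have p: "cone_partition n us (h ` W)"
    using us L unfolding cone_partition_def clopen_level_def by simp
  obtain cs where cs: "cyclic_partition n r' cs" "length us = length cs" using target_ex[OF p] .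
  then have "cone_partition n cs (cantor_dot n r')" by (simp add: cyclic_partition_def)
  from prefix_conj[OF n r(1,2) h part_ds part_vs length_vs(1) W_subset(1) p this cs(2) refl]
  show ?thesis unfolding O_set_def by (metis imageI)
qed

text \<open>Passing from the \<open>r'\<close> dotted letters to \<open>W\<close> cuts the circle
  open, and passing from the image back closes it. Both steps change \<open>simeq\<close> only at
  the two ends, and \<open>h\<close> takes the ends of \<open>W\<close> to those of its image, so
  the changes cancel.\<close>

lemma Core_in_TO_set:
  assumes hT: "h \<in> TB n r"
  shows "Core n r h \<in> TO_set n r'"
proof -
  let ?C = "cantor_dot n r" and ?U = "h ` W"
  have hs: "simeq n r (h x) (h y) \<longleftrightarrow> simeq n r x y" if "x \<in> ?C" "y \<in> ?C" for x y
    using hT that unfolding TB_def by blast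
  have bd: "boundary n r ?U (h x) \<longleftrightarrow> boundary n r W x" if x: "x \<in> W" for x
  proof -
    have xC: "x \<in> ?C" using x W_subset(1) by blast
    have "h y \<in> ?U \<longleftrightarrow> y \<in> W" if "y \<in> ?C" for y
      using h_bij(2) that W_subset(1) by (simp add: inj_on_image_mem_iff)
    then have "(\<exists>y\<in>h ` ?C. y \<notin> ?U \<and> simeq n r (h x) y) \<longleftrightarrow> (\<exists>y\<in>?C. y \<notin> W \<and> simeq n r x y)"
      using hs[OF xC] by auto
    then show ?thesis unfolding boundary_def h_bij(3) using x by blast
  qed
  obtain zs0 where zs0: "cyclic_partition n r (vs @ zs0)" "zs0 \<noteq> []" using cyc_vs .
  have bdW: "boundary n r W x \<longleftrightarrow> x = mn (vs ! 0) \<or> x = mx n (vs ! (length vs - 1))" for x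
    by (rule boundary_arc[OF n r(1) zs0(1) length_vs(3) zs0(2) W_def])
  have bdU: "x = h (mn (vs ! 0)) \<or> x = h (mx n (vs ! (length vs - 1)))" if "boundary n r ?U x" for x
  proof -
    have "x \<in> ?U" using that by (simp add: boundary_def)
    then obtain w where "w \<in> W" "x = h w" by blast
    then show ?thesis using bd[of w] that bdW[of w] by blast
  qed
  have U: "?U \<subseteq> ?C" "?U \<noteq> {}" "?U \<noteq> ?C"
    using W_subset h_bij(2,3) inj_on_image_eq_iff[OF h_bij(2) W_subset(1) subset_refl] by auto
  obtain L where "\<And>l. L \<le> l \<Longrightarrow> clopen_level n l ?U \<and> [card (cones n l ?U) = r'] (mod (n - 1))"
    using has_sig_level[OF n has_sig_hW] by metis
  then have L: "?U = (\<Union>w\<in>cones n (Suc L) ?U. cone n w)"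
    unfolding clopen_level_def using le_SucI by blast
  \<comment> \<open>The image is a union of cones of level \<open>Suc L\<close>, so each cone of a
    partition of this level is inside it or disjoint from it.\<close>
  obtain ws where ws: "cyclic_partition n r ws" "\<forall>w\<in>set ws. length w = Suc L"
    using cyclic_partition_level[OF n r(1)] by blast
  have dec: "cone n w \<subseteq> ?U \<or> cone n w \<inter> ?U = {}" if w: "w \<in> set ws" for w
  proof (rule disjCI)
    assume "cone n w \<inter> ?U \<noteq> {}"
    then obtain x where x: "x \<in> cone n w" "x \<in> ?U" by blast
    then obtain u where u: "u \<in> cones n (Suc L) ?U" "x \<in> cone n u" using L by blast
    then have "u = w" using cone_same_length[OF u(2) x(1)] ws(2) w by (simp add: cones_def)
    then show "cone n w \<subseteq> ?U" using u(1) by (simp add: cones_def)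
  qed
  obtain us zs where us: "cyclic_partition n r (us @ zs)" "us \<noteq> []" "zs \<noteq> []" "?U = (\<Union>u\<in>set us. cone n u)"
    using arc_ex[OF n r(1) ws(1) dec U bdU] by blast
  then have p: "cone_partition n us ?U"
    using cone_partition_appendD(1)[of n us zs ?C] unfolding us(4) cyclic_partition_def by blast
  obtain cs where cs: "cyclic_partition n r' cs" "length us = length cs" using target_ex[OF p] .
  then have pc: "cone_partition n cs (cantor_dot n r')" by (simp add: cyclic_partition_def)
  define g where "g = (\<lambda>x\<in>cantor_dot n r'. prefix_map n us cs (h (prefix_map n ds vs x)))"
  note g = prefix_conj[OF n r(1,2) h part_ds part_vs length_vs(1) W_subset(1) p pc cs(2) g_def]
  have "simeq n r' (g x) (g y) \<longleftrightarrow> simeq n r' x y" if xy: "x \<in> cantor_dot n r'" "y \<in> cantor_dot n r'" for x y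
  proof -
    let ?x = "prefix_map n ds vs x" and ?y = "prefix_map n ds vs y"
    have m: "?x \<in> W" "?y \<in> W" "prefix_map n vs ds ?x = x" "prefix_map n vs ds ?y = y"
      using prefix_map_mem[OF part_ds part_vs length_vs(1)] xy by auto
    have mC: "?x \<in> ?C" "?y \<in> ?C" using m W_subset(1) by auto
    have "simeq n r' (g x) (g y) \<longleftrightarrow> simeq n r (h ?x) (h ?y) \<or> boundary n r ?U (h ?x) \<and> boundary n r ?U (h ?y)"
      unfolding g_def using xy m
      by (simp add: simeq_prefix_map_arc[OF n r(1,2) us(1,2,3,4) cs])
    also have "\<dots> \<longleftrightarrow> simeq n r ?x ?y \<or> boundary n r W ?x \<and> boundary n r W ?y"
      unfolding hs[OF mC] bd[OF m(1)] bd[OF m(2)] ..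
    also have "\<dots> \<longleftrightarrow> simeq n r' (prefix_map n vs ds ?x) (prefix_map n vs ds ?y)"
      by (rule simeq_prefix_map_arc[OF n r(1,2) zs0(1) length_vs(3) zs0(2) W_def cyc_ds
            length_vs(1)[symmetric] m(1,2), symmetric])
    finally show ?thesis unfolding m .
  qed
  then have "g \<in> TB n r'" unfolding TB_def using g(1) by blast
  then show ?thesis unfolding TO_set_def using g(2) by (metis imageI)
qed

end


section \<open>The homomorphisms\<close>

text \<open>Elements of \<open>ZFact\<close> are cosets of integers. For \<open>n = 2\<close> the
  modulus is \<open>1\<close> and all residues coincide, in accordance with the trivial
  ring.\<close>

definition residue :: "nat \<Rightarrow> nat \<Rightarrow> int set" where
  "residue n a = ZMod (int n - 1) (int a)"

lemma residue_eq_iff: "2 \<le> n \<Longrightarrow> residue n a = residue n b \<longleftrightarrow> [a = b] (mod (n - 1))"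
proof -
  assume n: "2 \<le> n"
  have "residue n a = residue n b \<longleftrightarrow> int a mod (int n - 1) = int b mod (int n - 1)"
    unfolding residue_def using ZMod_imp_zmod zmod_imp_ZMod by blast
  also have "\<dots> \<longleftrightarrow> [int a = int b] (mod int (n - 1))"
    using n by (simp add: cong_def of_nat_diff)
  finally show ?thesis by (simp add: cong_int_iff)
qed

lemma residue_ring:
  "residue n a \<in> carrier (ZFact (int n - 1))"
  "residue n a \<otimes>\<^bsub>ZFact (int n - 1)\<^esub> residue n b = residue n (a * b)"
  "\<one>\<^bsub>ZFact (int n - 1)\<^esub> = residue n 1"
proof -
  have h: "(+>\<^bsub>\<Z>\<^esub>) (Idl\<^bsub>\<Z>\<^esub> {int n - 1}) \<in> ring_hom \<Z> (ZFact (int n - 1))"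
    unfolding ZFact_def by (intro ideal.rcos_ring_hom int.genideal_ideal) simp
  have res: "residue n a = Idl\<^bsub>\<Z>\<^esub> {int n - 1} +>\<^bsub>\<Z>\<^esub> int a" for a
    by (simp add: residue_def ZMod_def)
  show "residue n a \<in> carrier (ZFact (int n - 1))"
    unfolding res using ring_hom_closed[OF h] by simp
  show "residue n a \<otimes>\<^bsub>ZFact (int n - 1)\<^esub> residue n b = residue n (a * b)"
    unfolding res using ring_hom_mult[OF h, of "int a" "int b"] by simp
  show "\<one>\<^bsub>ZFact (int n - 1)\<^esub> = residue n 1"
    unfolding res using ring_hom_one[OF h] by simp
qed

lemma residue_unit:
  assumes "2 \<le> n" "[a * b = 1] (mod (n - 1))"
  shows "residue n a \<in> Units (ZFact (int n - 1))"
proof -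
  have "residue n (a * b) = residue n 1" "residue n (b * a) = residue n 1"
    using assms residue_eq_iff by (simp_all add: mult.commute)
  then show ?thesis
    unfolding Units_def using residue_ring by (auto intro!: bexI[of _ "residue n b"])
qed

text \<open>The chosen number is unique modulo \<open>n - 1\<close> whenever it exists, so the
  residue does not depend on the choice.\<close>

definition sig_hom :: "nat \<Rightarrow> transducer_class \<Rightarrow> int set" where
  "sig_hom n E = residue n (SOME a. class_sig n E a)"

lemma sig_hom_eq: "2 \<le> n \<Longrightarrow> class_sig n E a \<Longrightarrow> sig_hom n E = residue n a"
  unfolding sig_hom_def residue_eq_iff by (metis class_sig_unique residue_eq_iff someI)

lemma carrier_O_groupE:
  assumes "2 \<le> n" "E \<in> carrier (O_group n)"
  obtains r h a b where "1 \<le> r" "r \<le> n - 1" "h \<in> B n r" "E = Core n r h" "signature n r h a"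
    "[a * b = 1] (mod (n - 1))" "sig_hom n E = residue n a"
proof -
  obtain r h where rh: "1 \<le> r" "r \<le> n - 1" "h \<in> B n r" "E = Core n r h"
    using assms(2) by (auto simp: O_group_def O_set_def)
  obtain a b where ab: "signature n r h a" "[a * b = 1] (mod (n - 1))"
    using B_signature[OF assms(1) rh(1,3)] .
  then show thesis using that rh sig_hom_eq[OF assms(1)] class_sig_Core[OF assms(1) rh(1,3)] by blast
qed

lemma sig_hom_hom:
  assumes n: "2 \<le> n"
  shows "sig_hom n \<in> hom (O_group n) (units_of (ZFact (int n - 1)))"
proof (rule homI)
  fix E assume "E \<in> carrier (O_group n)"
  then obtain a b where "[a * b = 1] (mod (n - 1))" "sig_hom n E = residue n a"
    using carrier_O_groupE[OF n] by metis
  then show "sig_hom n E \<in> carrier (units_of (ZFact (int n - 1)))"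
    using residue_unit[OF n] by (simp add: units_of_carrier)
next
  fix E F assume E: "E \<in> carrier (O_group n)" and F: "F \<in> carrier (O_group n)"
  obtain r g a where g: "1 \<le> r" "g \<in> B n r" "signature n r g a" "E = Core n r g" "sig_hom n E = residue n a"
    using carrier_O_groupE[OF n E] by metis
  obtain r' h b where h: "1 \<le> r'" "h \<in> B n r'" "signature n r' h b" "F = Core n r' h" "sig_hom n F = residue n b"
    using carrier_O_groupE[OF n F] by metis
  have "E \<otimes>\<^bsub>O_group n\<^esub> F = core_mult n E F" by (simp add: O_group_def)
  then have "sig_hom n (E \<otimes>\<^bsub>O_group n\<^esub> F) = residue n (a * b)"
    using sig_hom_eq[OF n class_sig_core_mult[OF n g(1-3) h(1-3)]] g(4) h(4) by simp
  then show "sig_hom n (E \<otimes>\<^bsub>O_group n\<^esub> F) = sig_hom n E \<otimes>\<^bsub>units_of (ZFact (int n - 1))\<^esub> sig_hom n F"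
    using g(5) h(5) by (simp add: units_of_mult residue_ring)
qed

lemma Core_sig_hom_1:
  assumes n: "2 \<le> n" and h: "h \<in> B n 1"
  shows "sig_hom n (Core n 1 h) = residue n 1"
proof -
  obtain a b where ab: "signature n 1 h a" "[1 * a = 1] (mod (n - 1))"
    by (rule B_signature[OF n order_refl h])
  then have "sig_hom n (Core n 1 h) = residue n a"
    using sig_hom_eq[OF n] class_sig_Core[OF n order_refl h] by blast
  then show ?thesis using ab(2) residue_eq_iff[OF n] by simp
qed

lemma kernel_sig_hom_O:
  assumes n: "2 \<le> n"
  shows "kernel (O_group n) (units_of (ZFact (int n - 1))) (sig_hom n) = O_set n 1"
proof
  show "O_set n 1 \<subseteq> kernel (O_group n) (units_of (ZFact (int n - 1))) (sig_hom n)"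
  proof
    fix E assume "E \<in> O_set n 1"
    then obtain h where h: "h \<in> B n 1" "E = Core n 1 h" by (auto simp: O_set_def)
    have "E \<in> carrier (O_group n)"
      using \<open>E \<in> O_set n 1\<close> n by (auto simp: O_group_def intro!: bexI[of _ 1])
    then show "E \<in> kernel (O_group n) (units_of (ZFact (int n - 1))) (sig_hom n)"
      using Core_sig_hom_1[OF n h(1)] h(2) by (simp add: kernel_def units_of_one residue_ring)
  qed
  show "kernel (O_group n) (units_of (ZFact (int n - 1))) (sig_hom n) \<subseteq> O_set n 1"
  proof
    fix E assume "E \<in> kernel (O_group n) (units_of (ZFact (int n - 1))) (sig_hom n)"
    then have E: "E \<in> carrier (O_group n)" "sig_hom n E = residue n 1"
      by (simp_all add: kernel_def units_of_one residue_ring)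
    obtain r h a where h: "1 \<le> r" "h \<in> B n r" "E = Core n r h" "signature n r h a" "sig_hom n E = residue n a"
      using carrier_O_groupE[OF n E(1)] by metis
    \<comment> \<open>For one dotted letter the congruence of the locale says that the residue of
      \<open>a\<close> is that of \<open>1\<close>.\<close>
    have "reduction n r 1 h a"
      using h n E(2) residue_eq_iff[OF n] by unfold_locales auto
    then show "E \<in> O_set n 1" using reduction.Core_in_O_set h(3) by blast
  qed
qed

lemma kernel_sig_hom_TO:
  assumes n: "2 \<le> n"
  shows "kernel (TO_group n) (units_of (ZFact (int n - 1))) (sig_hom n) = TO_set n 1"
proof
  have c: "carrier (TO_group n) = TO_set n (n - 1)" by (simp add: TO_group_def)
  show "TO_set n 1 \<subseteq> kernel (TO_group n) (units_of (ZFact (int n - 1))) (sig_hom n)"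
  proof
    fix E assume "E \<in> TO_set n 1"
    then obtain h where h: "h \<in> TB n 1" "E = Core n 1 h" by (auto simp: TO_set_def)
    then have hB: "h \<in> B n 1" by (simp add: TB_def)
    obtain a where a: "signature n 1 h a" by (rule B_signature[OF n order_refl hB])
    \<comment> \<open>For \<open>n - 1\<close> dotted letters the congruence of the locale is
      satisfied by every \<open>a\<close>, both sides being multiples of the modulus.\<close>
    have "reduction n 1 (n - 1) h a"
      using a n hB by unfold_locales (auto simp: cong_def)
    then have "E \<in> TO_set n (n - 1)" using reduction.Core_in_TO_set h by blast
    then show "E \<in> kernel (TO_group n) (units_of (ZFact (int n - 1))) (sig_hom n)"
      using Core_sig_hom_1[OF n hB] h(2) by (simp add: kernel_def units_of_one residue_ring c)
  qed
  show "kernel (TO_group n) (units_of (ZFact (int n - 1))) (sig_hom n) \<subseteq> TO_set n 1"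
  proof
    fix E assume "E \<in> kernel (TO_group n) (units_of (ZFact (int n - 1))) (sig_hom n)"
    then have E: "E \<in> TO_set n (n - 1)" "sig_hom n E = residue n 1"
      by (simp_all add: kernel_def units_of_one residue_ring c)
    then obtain h where h: "h \<in> TB n (n - 1)" "E = Core n (n - 1) h" by (auto simp: TO_set_def)
    then have hB: "h \<in> B n (n - 1)" by (simp add: TB_def)
    have r: "1 \<le> n - 1" using n by simp
    obtain a where a: "signature n (n - 1) h a" by (rule B_signature[OF n r hB])
    then have "residue n a = residue n 1"
      using sig_hom_eq[OF n class_sig_Core[OF n r hB]] h(2) E(2) by simp
    then have "reduction n (n - 1) 1 h a"
      using a n r hB residue_eq_iff[OF n] by unfold_locales auto
    then show "E \<in> TO_set n 1" using reduction.Core_in_TO_set h by blast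
  qed
qed

theorem theorem1p9:
  fixes n :: nat
  assumes "n \<ge> 2"
  shows "(\<exists>\<phi>. \<phi> \<in> hom (TO_group n) (units_of (ZFact (int n - 1))) \<and>
              kernel (TO_group n) (units_of (ZFact (int n - 1))) \<phi> = TO_set n 1) \<and>
         (\<exists>\<psi>. \<psi> \<in> hom (O_group n) (units_of (ZFact (int n - 1))) \<and>
              kernel (O_group n) (units_of (ZFact (int n - 1))) \<psi> = O_set n 1)"
proof -
  \<comment> \<open>Both groups share the multiplication, so the same map serves for the smaller
    one.\<close>
  have "carrier (TO_group n) \<subseteq> carrier (O_group n)"
    using assms by (force simp: TO_group_def O_group_def TO_set_def O_set_def TB_def)
  moreover have "mult (TO_group n) = mult (O_group n)" by (simp add: TO_group_def)
  ultimately have "sig_hom n \<in> hom (TO_group n) (units_of (ZFact (int n - 1)))"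
    using hom_in_carrier[OF sig_hom_hom[OF assms]] hom_mult[OF sig_hom_hom[OF assms]]
    by (intro homI) (simp_all add: subset_iff)
  then show ?thesis
    using kernel_sig_hom_TO[OF assms] sig_hom_hom[OF assms] kernel_sig_hom_O[OF assms] by blast
qed

end
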